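(* Let $a<b$ be real numbers. Assume that $E=[a,b]\cup\{x_k\}_{k\ge1}$, where the points $x_k\in\mathbb{R}\setminus[a,b]$ are distinct and satisfy \[ \sum_{k=1}^{\infty}\mathrm{dist}(x_k,[a,b])^{1/2}<\infty . \] Then, for every $x_*\in\overline{\mathbb{R}}\setminus E$, \[ \frac{T_{n,x_*}(z)}{\|T_{n,x_*}\|_E}\,B_{x_*}(z)^n\;\to\;\frac12\,A_{x_*}(z)\qquad (n\to\infty) \] locally uniformly on compact subsets of $\Omega=\overline{\mathbb{C}}\setminus[a,b]$.
   Context: $\overline{\mathbb{R}}=\mathbb{R}\cup\{\infty\}$; $\|\cdot\|_E$ is the supremum norm on $E$. Extremal polynomials: $T_{n,\infty}$ is the unique monic polynomial of degree $n$ minimizing $\|\cdot\|_E$. For $x_*\in\mathbb{R}\setminus E$, $T_{n,x_*}$ is the unique polynomial minimizing $\|P\|_E$ among all polynomials $P$ of degree at most $n$ with $P(x_* )=1$. Define on $\Omega$ \[ B(z)=\frac{z-\frac{a+b}{2}-\sqrt{(z-a)(z-b)}}{\frac{b-a}{2}}, \] with the branch such that $\sqrt{(z-a)(z-b)}=z-(a+b)/2+O(z^{-1})$ as $z\to\infty$. Then $B$ maps $\Omega$ conformally onto the unit disk with $B(\infty)=0$. For $y\in\mathbb{R}\setminus[a,b]$ put $\beta_y=B(y)$ and \[ b_y(z)=\frac{|\beta_y|}{\beta_y}\,\frac{\beta_y-B(z)}{1-\overline{\beta_y}B(z)},\qquad A(z)=\prod_{k=1}^\infty b_{x_k}(z),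 \] the product converging locally uniformly in $\Omega$ under the stated summability condition. Normalizations: $B_\infty=B$ and $A_\infty=A$; for $x_*\in\mathbb{R}\setminus E$, $B_{x_*}(z)=\frac{|B(x_* )|}{B(x_* )}B(z)$ and $A_{x_*}(z)=\frac{|A(x_* )|}{A(x_* )}A(z)$. The functions $T_{n,x_*}B_{x_*}^n$ are understood as extended analytically to $z=\infty$. *)

theory Defs
  imports "HOL-Analysis.Analysis" "HOL-Computational_Algebra.Polynomial" "HOL-Library.Landau_Symbols"
begin

text \<open>
  The Riemann sphere is the one-point compactification of the complex plane, with
  \<^term>\<open>None\<close> as the point at infinity; likewise a point of the extended real line
  (real line plus one point at infinity) is a \<^typ>\<open>real option\<close>.
\<close>

abbreviation riemann_sphere :: "complex option topology"
  where "riemann_sphere \<equiv> Alexandroff_compactification (euclidean :: complex topology)"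

definition Omega :: "real \<Rightarrow> real \<Rightarrow> complex option set"
  where "Omega a b = topspace riemann_sphere - Some ` complex_of_real ` {a..b}"

text \<open>
  If \<^term>\<open>f\<close> is analytic in a punctured neighbourhood of infinity with a removable
  singularity there, the value of its analytic extension at infinity is the limit.
\<close>

definition extend_to_infinity :: "(complex \<Rightarrow> complex) \<Rightarrow> complex option \<Rightarrow> complex"
  where "extend_to_infinity f w = (case w of None \<Rightarrow> Lim at_infinity f | Some z \<Rightarrow> f z)"


subsection \<open>Extremal polynomials\<close>

definition sup_norm_on :: "real set \<Rightarrow> complex poly \<Rightarrow> real"
  where "sup_norm_on E P = (SUP t\<in>E. norm (poly P (complex_of_real t)))"

definition admissible_poly :: "nat \<Rightarrow> real option \<Rightarrow> complex poly \<Rightarrow> bool"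
  where "admissible_poly n xs P = (case xs of
           None \<Rightarrow> degree P = n \<and> lead_coeff P = 1
         | Some y \<Rightarrow> degree P \<le> n \<and> poly P (complex_of_real y) = 1)"

definition extremal_poly :: "real set \<Rightarrow> nat \<Rightarrow> real option \<Rightarrow> complex poly"
  where "extremal_poly E n xs = (THE P. admissible_poly n xs P \<and>
           (\<forall>Q. admissible_poly n xs Q \<longrightarrow> sup_norm_on E P \<le> sup_norm_on E Q))"


subsection \<open>The functions built from the conformal map onto the disk\<close>

text \<open>
  With the principal square root, the following is the branch of the square root of
  \<open>(z - a) (z - b)\<close> off the interval that behaves like \<open>z - (a + b) / 2 + O(1 / z)\<close>
  at infinity: \<open>(z - a) / (z - b)\<close> lies on the cut of the principal root only for \<open>z\<close>
  in the interval. The three lemmas below confirm this.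
\<close>

definition sqrt_branch :: "real \<Rightarrow> real \<Rightarrow> complex \<Rightarrow> complex"
  where "sqrt_branch a b z = (z - of_real b) * csqrt ((z - of_real a) / (z - of_real b))"

lemma sqrt_branch_squared: "(sqrt_branch a b z)\<^sup>2 = (z - of_real a) * (z - of_real b)"
  by (cases "z = of_real b") (simp_all add: sqrt_branch_def power_mult_distrib power2_eq_square[of "z - of_real b"])

lemma sqrt_branch_holomorphic:
  assumes "a < b"
  shows "sqrt_branch a b holomorphic_on - (complex_of_real ` {a..b})"
proof -
  have nb: "z \<noteq> of_real b" if "z \<notin> complex_of_real ` {a..b}" for z
    using that assms by auto
  have "(z - of_real a) / (z - of_real b) \<notin> \<real>\<^sub>\<le>\<^sub>0" if z: "z \<notin> complex_of_real ` {a..b}" for z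
  proof
    assume "(z - of_real a) / (z - of_real b) \<in> \<real>\<^sub>\<le>\<^sub>0"
    then obtain r where r: "r \<le> 0" "(z - of_real a) / (z - of_real b) = of_real r"
      by (auto elim!: nonpos_Reals_cases)
    then have "z - of_real a = of_real r * (z - of_real b)"
      using nb[OF z] by (simp add: field_simps)
    then have "z * of_real (1 - r) = of_real (a - r * b)"
      by (simp add: algebra_simps)
    moreover have "1 - r > 0"
      using r by simp
    ultimately have zeq: "z = of_real ((a - r * b) / (1 - r))"
      by (metis less_irrefl nonzero_mult_div_cancel_right of_real_divide of_real_eq_0_iff)
    have "0 \<le> - (r * (b - a))"
      using r assms by (simp add: mult_nonpos_nonneg)
    then have "(a - r * b) / (1 - r) \<in> {a..b}"
      using \<open>1 - r > 0\<close> assms by (simp add: field_simps)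
    with zeq z show False by blast
  qed
  with nb show ?thesis
    unfolding sqrt_branch_def by (intro holomorphic_intros) auto
qed

lemma sqrt_branch_at_infinity:
  "(\<lambda>z. sqrt_branch a b z - (z - of_real ((a + b) / 2))) \<in> O[at_infinity](\<lambda>z. 1 / z)"
proof -
  define h where "h = complex_of_real ((b - a) / 2)"
  define c where "c = (\<lambda>z. z - complex_of_real ((a + b) / 2))"
  define S where "S = sqrt_branch a b"
  have inv0: "((\<lambda>z::complex. k / z) \<longlongrightarrow> 0) at_infinity" for k
    by (rule tendsto_divide_0[OF tendsto_const]) (simp add: filterlim_ident)
  have "((\<lambda>z. (1 - of_real a / z) / (1 - of_real b / z)) \<longlongrightarrow> (1 - 0) / (1 - 0 :: complex)) at_infinity"
    by (intro tendsto_intros inv0) auto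
  then have "((\<lambda>z. csqrt ((1 - of_real a / z) / (1 - of_real b / z))) \<longlongrightarrow> csqrt 1) at_infinity"
    by (intro isCont_tendsto_compose[of 1 csqrt] continuous_at_csqrt) auto
  then have "((\<lambda>z. (1 - of_real b / z) * csqrt ((1 - of_real a / z) / (1 - of_real b / z))
                + (1 - of_real ((a + b) / 2) / z)) \<longlongrightarrow> (1 - 0) * 1 + (1 - 0)) at_infinity" (is "(?F \<longlongrightarrow> _) _")
    by (intro tendsto_intros inv0) auto
  then have "(?F \<longlongrightarrow> 2) at_infinity"
    by simp
  then have "((\<lambda>z. (S z + c z) / z) \<longlongrightarrow> 2) at_infinity"
  proof (rule Lim_transform_eventually)
    have e: "(1 - of_real b / z) * csqrt ((1 - of_real a / z) / (1 - of_real b / z))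
                + (1 - of_real ((a + b) / 2) / z) = (S z + c z) / z" if "z \<noteq> 0" for z
    proof -
      have "1 - of_real k / z = (z - of_real k) / z" for k
        using that by (simp add: field_simps)
      then show ?thesis
        using that by (simp add: S_def c_def sqrt_branch_def add_divide_distrib del: of_real_add of_real_divide)
    qed
    show "\<forall>\<^sub>F z in at_infinity. (1 - of_real b / z) * csqrt ((1 - of_real a / z) / (1 - of_real b / z))
                + (1 - of_real ((a + b) / 2) / z) = (S z + c z) / z"
      using e eventually_not_equal_at_infinity[of 0] by (auto elim: eventually_mono)
  qed
  note lim = this
  have ne: "\<forall>\<^sub>F z in at_infinity. (S z + c z) / z \<noteq> 0"
    using lim by (rule tendsto_imp_eventually_ne) simp
  have lim2: "((\<lambda>z. - h\<^sup>2 / ((S z + c z) / z)) \<longlongrightarrow> - h\<^sup>2 / 2) at_infinity"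
    by (rule tendsto_divide[OF tendsto_const lim]) simp
  have prod: "(S z - c z) * (S z + c z) = - h\<^sup>2" for z
  proof -
    have "(S z - c z) * (S z + c z) = (S z)\<^sup>2 - (c z)\<^sup>2"
      by (simp add: power2_eq_square algebra_simps)
    moreover have "(c z)\<^sup>2 = (z - of_real a) * (z - of_real b) + h\<^sup>2"
      by (simp add: c_def h_def power2_eq_square field_simps)
    moreover have "(S z)\<^sup>2 = (z - of_real a) * (z - of_real b)"
      by (simp add: S_def sqrt_branch_squared)
    ultimately show ?thesis
      by simp
  qed
  have "- h\<^sup>2 / ((S z + c z) / z) = (S z - c z) / (1 / z)" if "(S z + c z) / z \<noteq> 0" for z
    unfolding prod[of z, symmetric] using that by simp
  then have "\<forall>\<^sub>F z in at_infinity. - h\<^sup>2 / ((S z + c z) / z) = (S z - c z) / (1 / z)"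
    using ne by (rule eventually_mono[rotated])
  with lim2 have "((\<lambda>z. (S z - c z) / (1 / z)) \<longlongrightarrow> - h\<^sup>2 / 2) at_infinity"
    by (rule Lim_transform_eventually)
  then have "(\<lambda>z. S z - c z) \<in> O[at_infinity](\<lambda>z. 1 / z)"
    by (rule bigoI_tendsto) (use eventually_not_equal_at_infinity[of 0] in \<open>auto elim: eventually_mono\<close>)
  then show ?thesis
    by (simp add: S_def c_def)
qed

definition B_map :: "real \<Rightarrow> real \<Rightarrow> complex option \<Rightarrow> complex"
  where "B_map a b w = (case w of
           None \<Rightarrow> 0
         | Some z \<Rightarrow> (z - of_real ((a + b) / 2) - sqrt_branch a b z) / of_real ((b - a) / 2))"

definition blaschke_factor :: "real \<Rightarrow> real \<Rightarrow> real \<Rightarrow> complex option \<Rightarrow> complex"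
  where "blaschke_factor a b y w =
           (let \<beta> = B_map a b (Some (of_real y)) in
             of_real (norm \<beta>) / \<beta> * ((\<beta> - B_map a b w) / (1 - cnj \<beta> * B_map a b w)))"

definition A_prod :: "real \<Rightarrow> real \<Rightarrow> (nat \<Rightarrow> real) \<Rightarrow> complex option \<Rightarrow> complex"
  where "A_prod a b x w = (\<Prod>k. blaschke_factor a b (x k) w)"

definition normalized_at :: "real option \<Rightarrow> (complex option \<Rightarrow> complex) \<Rightarrow> complex option \<Rightarrow> complex"
  where "normalized_at xs f w = (case xs of
           None \<Rightarrow> f w
         | Some y \<Rightarrow> of_real (norm (f (Some (of_real y)))) / f (Some (of_real y)) * f w)"

end

theory Submission
  imports Defs "HOL-Complex_Analysis.Complex_Analysis" "HOL-Real_Asymp.Real_Asymp"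
begin

text \<open>
  Normalize the extremal polynomial to have norm 1 on \<open>E\<close> and transplant it to the unit disk:
  \<open>H w = w ^ n * p (J w)\<close> with the Joukowski map \<open>J w = (w + 1 / w) / 2\<close>. A zero count for
  real trigonometric polynomials gives \<open>norm (H w) \<le> (1 + norm w ^ (2 * n)) / 2\<close>, and
  \<open>norm (H w) \<le> norm w ^ n\<close> at the images of the points \<open>x k\<close>. Hence every locally uniform limit
  vanishes at these images and is bounded by \<open>norm A / 2\<close>. Conversely, truncated Taylor series of
  finite Blaschke products, placed on a slightly dilated interval that absorbs the tail of the
  points, yield competitors whose value at \<open>x\<^sub>*\<close> tends to \<open>norm A / 2\<close>. By extremality the
  limit attains the bound at the interior point corresponding to \<open>x\<^sub>*\<close>, so by the maximum
  principle it is a constant multiple of \<open>A\<close>, and the normalization fixes the constant.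
\<close>

subsection \<open>Polynomials on an interval and the Joukowski map\<close>

text \<open>For a polynomial of norm 1 on the interval the maximum principle alone gives only
  \<open>norm (H w) \<le> 1\<close>. The factor 1/2 comes from the values on the interval being
  real; Chebyshev polynomials, for which \<open>H w = (1 + w ^ (2 * n)) / 2\<close>, attain the
  refined bound at real \<open>w\<close>. The lower bound meets another obstacle: the zeros of
  \<open>A\<close> accumulate at 1 or -1, so \<open>A\<close> does not extend analytically to a
  larger disk and its Taylor polynomials cannot be controlled directly. Only the zeros of points
  beyond a threshold \<open>t\<close> outside the interval are kept, and the radius
  \<open>1 + \<rho>\<close> on which the finite product is estimated depends on \<open>n\<close>.
  Three demands compete. The product \<open>n * t\<close> must be small, or the dilation costs too
  much. The sum of \<open>1 / sqrt (y k - t)\<close> must be a small multiple of \<open>n\<close>,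
  so that the growth of the product on the larger circle is beaten by
  \<open>(1 + \<rho>) ^ n\<close>. Finally \<open>n * \<rho>\<close> must tend to infinity although
  \<open>\<rho>\<close> stays below the distance of the zeros to the circle. Gaps
  \<open>y k - t\<close> of order at least \<open>n powr (-3/2)\<close> permit \<open>\<rho>\<close>
  of order \<open>n powr (-3/4)\<close>, which meets all demands.\<close>

definition joukowski :: "'a::field \<Rightarrow> 'a"
  where "joukowski w = (w + 1 / w) / 2"

lemma joukowski_cis: "joukowski (cis t) = of_real (cos t)"
  by (simp add: joukowski_def complex_eq_iff flip: cis_inverse inverse_eq_divide)

lemma of_real_joukowski: "of_real (joukowski w) = joukowski (of_real w :: complex)"
  by (simp add: joukowski_def)

lemma joukowski_minus: "joukowski (- w) = - joukowski w"
  by (simp add: joukowski_def field_simps)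

lemma joukowski_divide:
  fixes p q :: "'a::field_char_0"
  assumes "p \<noteq> 0" "q \<noteq> 0"
  shows "joukowski (p / q) = (p * p + q * q) / (2 * (p * q))"
  using assms by (simp add: joukowski_def field_simps)

text \<open>The function \<open>w ^ n * p (J w)\<close> as a genuine polynomial, using
  \<open>w * J w = (w ^ 2 + 1) / 2\<close>. This gives it a meaningful value at
  \<open>w = 0\<close>, the image of infinity, where the coefficient of degree \<open>n\<close> is
  read off.\<close>

definition disk_poly :: "nat \<Rightarrow> complex poly \<Rightarrow> complex poly"
  where "disk_poly n p = (\<Sum>i\<le>n. smult (coeff p i) (monom 1 (n - i) * [:1/2, 0, 1/2:] ^ i))"

lemma degree_disk_poly: "degree (disk_poly n p) \<le> 2 * n"
  unfolding disk_poly_def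
proof (rule degree_sum_le)
  fix i assume "i \<in> {..n}"
  have "degree ([:1/2, 0, 1/2:] ^ i :: complex poly) \<le> 2 * i"
    by (rule order_trans[OF degree_power_le]) simp
  then have "degree (monom 1 (n - i) * [:1/2, 0, 1/2:] ^ i :: complex poly) \<le> (n - i) + 2 * i"
    by (intro order_trans[OF degree_mult_le] add_mono degree_monom_le)
  then show "degree (smult (coeff p i) (monom 1 (n - i) * [:1/2, 0, 1/2:] ^ i)) \<le> 2 * n"
    using \<open>i \<in> {..n}\<close> by (intro order_trans[OF degree_smult_le]) simp
qed simp

lemma poly_eq_sum_atMost:
  fixes p :: "'a::{comm_semiring_0, semiring_1} poly"
  assumes "degree p \<le> n"
  shows "poly p x = (\<Sum>i\<le>n. coeff p i * x ^ i)"
  unfolding poly_altdef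
  by (rule sum.mono_neutral_left) (use assms in \<open>auto simp: coeff_eq_0\<close>)

lemma poly_disk_poly:
  assumes "degree p \<le> n" "w \<noteq> 0"
  shows "poly (disk_poly n p) w = w ^ n * poly p (joukowski w)"
proof -
  have "poly (monom 1 (n - i) * [:1/2, 0, 1/2:] ^ i) w = w ^ n * joukowski w ^ i" if "i \<le> n" for i
  proof -
    have *: "poly [:1/2, 0, 1/2:] w = w * joukowski w"
      using assms(2) by (simp add: joukowski_def field_simps)
    show ?thesis
      using that by (simp only: poly_mult poly_power poly_monom * power_mult_distrib mult_1
          mult.assoc[symmetric] power_add[symmetric] le_add_diff_inverse2)
  qed
  then show ?thesis
    using assms(1) by (simp add: disk_poly_def poly_sum poly_eq_sum_atMost[of p n] sum_distrib_left mult_ac)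
qed

lemma poly_disk_poly_0: "poly (disk_poly n p) 0 = coeff p n / 2 ^ n"
proof -
  have "poly (disk_poly n p) 0 = (\<Sum>i\<le>n. if i = n then coeff p n * (1/2) ^ n else 0)"
    unfolding disk_poly_def poly_sum by (rule sum.cong) (auto simp: poly_monom)
  then show ?thesis
    by (simp add: power_divide)
qed

text \<open>With \<open>norm s < 1\<close> the real-linear map sending \<open>u\<close> to
  \<open>u + s * cnj u\<close> is invertible, and it stretches lengths by at most
  \<open>1 + norm s\<close>. So the preimage \<open>u\<close> of \<open>2 * q\<close> lies outside
  the closed unit disk, and \<open>\<omega> = u / norm u\<close>, \<open>r = 1 / norm u\<close>
  solve the equation.\<close>

lemma exists_unimodular_on_ellipse:
  fixes q s :: complex
  assumes "norm s < 1" "norm q > (1 + norm s) / 2"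
  obtains \<omega> r where "norm \<omega> = 1" "0 < r" "r < 1" "\<omega> + s * cnj \<omega> = 2 * of_real r * q"
proof -
  define u where "u = (2 * q - s * cnj (2 * q)) / of_real (1 - (norm s)\<^sup>2)"
  have ne: "1 - (norm s)\<^sup>2 \<noteq> 0"
    using assms(1) by (smt (verit) norm_ge_zero power2_eq_1_iff)
  have ss: "s * cnj s = of_real ((norm s)\<^sup>2)"
    by (metis complex_norm_square)
  have u: "of_real (1 - (norm s)\<^sup>2) * u = 2 * q - s * cnj (2 * q)"
    unfolding u_def using ne by (metis nonzero_mult_div_cancel_left of_real_eq_0_iff times_divide_eq_right)
  have "of_real (1 - (norm s)\<^sup>2) * cnj u = cnj (of_real (1 - (norm s)\<^sup>2) * u)"
    by simp
  also have "\<dots> = cnj (2 * q) - cnj s * (2 * q)"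
    unfolding u by simp
  finally have cu: "of_real (1 - (norm s)\<^sup>2) * cnj u = cnj (2 * q) - cnj s * (2 * q)" .
  have "of_real (1 - (norm s)\<^sup>2) * (u + s * cnj u) = of_real (1 - (norm s)\<^sup>2) * u + s * (of_real (1 - (norm s)\<^sup>2) * cnj u)"
    by (simp add: algebra_simps)
  also have "\<dots> = of_real (1 - (norm s)\<^sup>2) * (2 * q)"
    unfolding u cu by (simp add: algebra_simps ss[simplified])
  finally have eq: "u + s * cnj u = 2 * q"
    using ne by (metis mult_cancel_left of_real_eq_0_iff)
  have "2 * norm q \<le> norm u + norm s * norm u"
    using norm_triangle_ineq[of u "s * cnj u"] by (simp add: eq norm_mult)
  then have "norm u * (1 + norm s) > 1 * (1 + norm s)"
    using assms(2) by (simp add: algebra_simps)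
  then have u1: "norm u > 1"
    using norm_ge_zero[of s] by (simp add: mult_less_cancel_right del: norm_ge_zero)
  show ?thesis
  proof
    show "norm (u / of_real (norm u)) = 1" "0 < 1 / norm u"
      using u1 by (auto simp: norm_divide)
    show "1 / norm u < 1"
      using u1 by (subst divide_less_eq_1_pos) auto
    show "u / of_real (norm u) + s * cnj (u / of_real (norm u)) = 2 * of_real (1 / norm u) * q"
      using eq by (simp add: add_divide_distrib[symmetric] mult.commute)
  qed
qed

text \<open>
  A value outside the ellipse yields a function \<open>cos (n \<theta> - \<alpha>) - r \<tau> \<theta>\<close>
  whose \<open>2 n\<close> zeros on the circle exhaust the roots of the polynomial attached to it,
  although that polynomial also vanishes at \<open>w\<close>.
\<close>

lemma norm_poly_real_trig_le:
  fixes q :: "complex poly" and \<tau> :: "real \<Rightarrow> real"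
  assumes deg: "degree q \<le> 2 * n" and n: "n > 0"
    and q: "\<And>t. poly q (cis t) = cis (of_nat n * t) * of_real (\<tau> t)"
    and \<tau>: "\<And>t. \<bar>\<tau> t\<bar> \<le> 1" "continuous_on UNIV \<tau>"
    and w: "norm w < 1"
  shows "norm (poly q w) \<le> (1 + norm w ^ (2 * n)) / 2"
proof (rule ccontr)
  assume "\<not> ?thesis"
  then have "norm (poly q w) > (1 + norm (w ^ (2 * n))) / 2"
    by (simp add: norm_power)
  moreover have "norm (w ^ (2 * n)) < 1"
    using w n by (simp add: norm_power power_less_one_iff)
  ultimately obtain \<omega> r where \<omega>: "norm \<omega> = 1" "0 < r" "r < 1"
    "\<omega> + w ^ (2 * n) * cnj \<omega> = 2 * of_real r * poly q w"
    using exists_unimodular_on_ellipse by blast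
  define \<alpha> where "\<alpha> = Arg \<omega>"
  have cis\<alpha>: "\<omega> = cis \<alpha>"
    using \<omega>(1) unfolding \<alpha>_def by (subst cis_Arg) (auto simp: sgn_eq)
  \<comment> \<open>On the circle the first two terms add up to
    \<open>2 * cis (n * t) * cos (n * t - \<alpha>)\<close>, while the choice of
    \<open>\<omega>\<close> and \<open>r\<close> says exactly that \<open>G\<close> vanishes at
    \<open>w\<close>.\<close>
  define G where "G = monom (cnj \<omega>) (2 * n) + [:\<omega>:] - smult (2 * of_real r) q"
  define f where "f = (\<lambda>t. 2 * (cos (of_nat n * t - \<alpha>) - r * \<tau> t))"
  have Gcis: "poly G (cis t) = cis (of_nat n * t) * of_real (f t)" for t
  proof -
    have c: "of_real (2 * cos (of_nat n * t - \<alpha>)) = cis (of_nat n * t - \<alpha>) + cis (- (of_nat n * t - \<alpha>))"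
      by (simp add: complex_eq_iff cos_diff sin_diff)
    have "cis (of_nat n * t) * of_real (f t) =
      cis (of_nat n * t) * of_real (2 * cos (of_nat n * t - \<alpha>)) - 2 * of_real r * (cis (of_nat n * t) * of_real (\<tau> t))"
      by (simp add: f_def algebra_simps)
    also have "\<dots> = cis (2 * of_nat n * t - \<alpha>) + cis \<alpha> - 2 * of_real r * poly q (cis t)"
      unfolding c by (simp add: q distrib_left cis_mult algebra_simps)
    also have "\<dots> = poly G (cis t)"
      by (simp add: G_def poly_monom cis\<alpha> cis_cnj Complex.DeMoivre cis_mult)
    finally show ?thesis ..
  qed
  \<comment> \<open>Here the cosine equals 1 and -1 alternately. Since \<open>r < 1\<close> it
    dominates \<open>r * \<tau>\<close> strictly, so \<open>f\<close> changes sign between any two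
    neighbours, \<open>2 * n\<close> times per period.\<close>
  define \<theta> where "\<theta> = (\<lambda>j::nat. (of_nat j * pi + \<alpha>) / of_nat n)"
  have f\<theta>: "f (\<theta> j) = 2 * ((-1) ^ j - r * \<tau> (\<theta> j))" for j
  proof -
    have "of_nat n * \<theta> j - \<alpha> = of_nat j * pi"
      using n by (simp add: \<theta>_def)
    then show ?thesis
      by (simp add: f_def)
  qed
  have r\<tau>: "\<bar>r * \<tau> t\<bar> < 1" for t
    using \<tau>(1)[of t] \<omega>(2,3) mult_left_mono[of "\<bar>\<tau> t\<bar>" 1 r]
    unfolding abs_mult by linarith
  have sgnf: "(-1) ^ j * f (\<theta> j) > 0" for j
    using r\<tau>[of "\<theta> j"] by (cases "even j") (auto simp: f\<theta>)
  have \<theta>less: "\<theta> j < \<theta> (Suc j)" for j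
    using n by (simp add: \<theta>_def divide_strict_right_mono algebra_simps)
  have contf: "continuous_on S f" for S
    unfolding f_def using continuous_on_subset[OF \<tau>(2)] by (intro continuous_intros) auto
  have "\<exists>t. \<theta> j < t \<and> t < \<theta> (Suc j) \<and> f t = 0" for j
  proof -
    have "\<exists>t\<ge>\<theta> j. t \<le> \<theta> (Suc j) \<and> (-1) ^ Suc j * f t = 0"
      using sgnf[of j] sgnf[of "Suc j"] \<theta>less[of j]
      by (intro IVT') (auto intro!: continuous_intros contf)
    then obtain t where t: "\<theta> j \<le> t" "t \<le> \<theta> (Suc j)" "f t = 0"
      by auto
    moreover have "t \<noteq> \<theta> j" "t \<noteq> \<theta> (Suc j)"
      using t(3) sgnf[of j] sgnf[of "Suc j"] by auto
    ultimately show ?thesis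
      by (intro exI[of _ t]) auto
  qed
  then obtain \<psi> where \<psi>: "\<And>j. \<theta> j < \<psi> j" "\<And>j. \<psi> j < \<theta> (Suc j)" "\<And>j. f (\<psi> j) = 0"
    by metis
  have \<theta>mono: "\<theta> i \<le> \<theta> j" if "i \<le> j" for i j
    using that n by (simp add: \<theta>_def divide_right_mono mult_right_mono)
  have inj: "inj_on (\<lambda>j. cis (\<psi> j)) {..<2*n}"
  proof (rule linorder_inj_onI')
    fix i j assume ij: "i \<in> {..<2*n}" "j \<in> {..<2*n}" "i < j"
    have "\<psi> i < \<psi> j"
      using \<psi>(2)[of i] \<psi>(1)[of j] \<theta>mono[of "Suc i" j] ij by simp
    moreover have "\<psi> j - \<psi> i < 2 * pi"
    proof -
      have "\<psi> j - \<psi> i < \<theta> (2 * n) - \<theta> 0"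
        using \<psi>(1)[of i] \<psi>(2)[of j] \<theta>mono[of 0 i] \<theta>mono[of "Suc j" "2*n"] ij by simp
      also have "\<dots> = 2 * pi"
        using n by (simp add: \<theta>_def field_simps)
      finally show ?thesis .
    qed
    ultimately show "cis (\<psi> i) \<noteq> cis (\<psi> j)"
    proof -
      assume lt: "\<psi> i < \<psi> j" "\<psi> j - \<psi> i < 2 * pi"
      show ?thesis
      proof
        assume "cis (\<psi> i) = cis (\<psi> j)"
        then have "cis (\<psi> j - \<psi> i) = 1"
          by (metis cis_divide cis_neq_zero divide_self)
        then have "cos (\<psi> j - \<psi> i) = 1"
          by (metis cis.sel(1) one_complex.sel(1))
        then obtain k :: int where "\<psi> j - \<psi> i = of_int k * (2 * pi)"
          by (auto simp: cos_one_2pi_int)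
        with lt have "0 < of_int k * (2 * pi)" "of_int k * (2 * pi) < 1 * (2 * pi)"
          by linarith+
        then have "0 < k" "k < 1"
          using pi_gt_zero by (simp_all only: zero_less_mult_iff mult_less_cancel_right of_int_0_less_iff of_int_less_1_iff) auto
        then show False
          by simp
      qed
    qed
  qed
  let ?R = "insert w ((\<lambda>j. cis (\<psi> j)) ` {..<2*n})"
  have "poly G w = 0"
    using \<omega>(4) by (simp add: G_def poly_monom algebra_simps)
  then have R: "?R \<subseteq> {z. poly G z = 0}"
    using \<psi>(3) by (auto simp: Gcis)
  have "w \<notin> (\<lambda>j. cis (\<psi> j)) ` {..<2*n}"
    using w by auto
  then have cardR: "card ?R = Suc (2 * n)"
    using inj by (simp add: card_image)
  have G0: "G \<noteq> 0"
  proof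
    assume "G = 0"
    then have "f (\<theta> 0) = 0"
      using Gcis[of "\<theta> 0"] by simp
    with sgnf[of 0] show False
      by simp
  qed
  have "Suc (2 * n) \<le> card {z. poly G z = 0}"
    using card_mono[OF poly_roots_finite[OF G0] R] cardR by simp
  also have "\<dots> \<le> degree G"
    by (rule card_poly_roots_bound) (rule G0)
  also have "\<dots> \<le> 2 * n"
    unfolding G_def by (intro degree_diff_le degree_add_le degree_monom_le order_trans[OF degree_smult_le deg]) simp
  finally show False
    by simp
qed

lemma norm_disk_poly_le:
  fixes p :: "complex poly"
  assumes deg: "degree p \<le> n" and n: "n > 0"
    and real: "\<And>x. x \<in> {-1..1} \<Longrightarrow> poly p (of_real x) \<in> \<real>"
    and bound: "\<And>x. x \<in> {-1..1} \<Longrightarrow> norm (poly p (of_real x)) \<le> 1"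
    and w: "norm w < 1"
  shows "norm (poly (disk_poly n p) w) \<le> (1 + norm w ^ (2 * n)) / 2"
proof (rule norm_poly_real_trig_le[OF degree_disk_poly n _ _ _ w])
  let ?\<tau> = "\<lambda>t. Re (poly p (of_real (cos t)))"
  show "poly (disk_poly n p) (cis t) = cis (of_nat n * t) * of_real (?\<tau> t)" for t
    using real[of "cos t"] by (simp add: poly_disk_poly[OF deg] joukowski_cis Complex.DeMoivre)
  show "\<bar>?\<tau> t\<bar> \<le> 1" for t
    using order_trans[OF abs_Re_le_cmod bound[of "cos t"]] by simp
  show "continuous_on UNIV ?\<tau>"
    by (intro continuous_intros)
qed

subsection \<open>Extremal polynomials\<close>

lemma norm_poly_le_sup_norm_on:
  assumes "compact E" "t \<in> E"
  shows "norm (poly P (of_real t)) \<le> sup_norm_on E P"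
proof -
  have "compact ((\<lambda>t. norm (poly P (complex_of_real t))) ` E)"
    by (intro compact_continuous_image continuous_intros assms)
  then show ?thesis
    unfolding sup_norm_on_def using assms(2)
    by (intro cSUP_upper compact_imp_bounded bounded_imp_bdd_above)
qed

lemma sup_norm_on_le:
  assumes "E \<noteq> {}" "\<And>t. t \<in> E \<Longrightarrow> norm (poly P (of_real t)) \<le> M"
  shows "sup_norm_on E P \<le> M"
  unfolding sup_norm_on_def by (rule cSUP_least) (use assms in auto)

lemma sup_norm_on_smult:
  assumes "E \<noteq> {}" "compact E"
  shows "sup_norm_on E (smult c P) = norm c * sup_norm_on E P"
proof (cases "c = 0")
  case True
  then show ?thesis
    using assms(1) by (simp add: sup_norm_on_def)
next
  case False
  show ?thesis
  proof (rule antisym)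
    show "sup_norm_on E (smult c P) \<le> norm c * sup_norm_on E P"
      using assms by (intro sup_norm_on_le) (auto simp: norm_mult intro!: mult_left_mono norm_poly_le_sup_norm_on)
    have "sup_norm_on E P \<le> sup_norm_on E (smult c P) / norm c"
    proof (rule sup_norm_on_le[OF assms(1)])
      fix t assume "t \<in> E"
      from norm_poly_le_sup_norm_on[OF assms(2) this, of "smult c P"]
      show "norm (poly P (of_real t)) \<le> sup_norm_on E (smult c P) / norm c"
        using False by (simp add: norm_mult field_simps)
    qed
    then show "norm c * sup_norm_on E P \<le> sup_norm_on E (smult c P)"
      using False by (simp add: field_simps)
  qed
qed

section \<open>Lagrange interpolation, existence and uniqueness of minimizers\<close>

definition lagrange_basis :: "'a::field set \<Rightarrow> 'a \<Rightarrow> 'a poly"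
  where "lagrange_basis A x = (\<Prod>y\<in>A - {x}. smult (1 / (x - y)) [:- y, 1:])"

lemma poly_lagrange_basis:
  assumes "finite A" "x \<in> A" "z \<in> A"
  shows "poly (lagrange_basis A x) z = (if z = x then 1 else 0)"
proof (cases "z = x")
  case True
  then show ?thesis
    by (auto simp: lagrange_basis_def poly_prod diff_divide_distrib[symmetric] intro!: prod.neutral split: if_splits)
next
  case False
  then have "(\<Prod>y\<in>A - {x}. poly (smult (1 / (x - y)) [:- y, 1:]) z) = 0"
    using assms by (intro prod_zero bexI[of _ z]) auto
  then show ?thesis
    using False by (simp only: lagrange_basis_def poly_prod if_False)
qed

lemma degree_lagrange_basis:
  assumes "finite A" "x \<in> A"
  shows "degree (lagrange_basis A x) < card A"
proof -
  have "degree (lagrange_basis A x) \<le> (\<Sum>y\<in>A - {x}. degree (smult (1 / (x - y)) [:- y, 1:]))"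
    unfolding lagrange_basis_def using degree_prod_sum_le[of "A - {x}" "\<lambda>y. smult (1 / (x - y)) [:- y, 1:]"] assms(1)
    by (simp add: o_def)
  also have "\<dots> \<le> (\<Sum>y\<in>A - {x}. 1)"
    by (intro sum_mono order_trans[OF degree_smult_le]) simp
  also have "\<dots> < card A"
    using card_Diff1_less[OF assms] by simp
  finally show ?thesis .
qed

lemma lagrange_interpolation:
  fixes f :: "'a::field \<Rightarrow> 'a"
  assumes "finite A" "card A \<le> n" "n > 0"
  obtains Q where "degree Q < n" "\<And>x. x \<in> A \<Longrightarrow> poly Q x = f x"
proof
  show "degree (\<Sum>x\<in>A. smult (f x) (lagrange_basis A x)) < n"
    using assms degree_lagrange_basis[OF assms(1)]
    by (intro degree_sum_less order_le_less_trans[OF degree_smult_le]) (auto intro: less_le_trans)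
  show "poly (\<Sum>x\<in>A. smult (f x) (lagrange_basis A x)) x = f x" if "x \<in> A" for x
    using assms that by (simp add: poly_sum poly_lagrange_basis if_distrib[of "(*) _"] cong: if_cong)
qed

lemma lagrange_expansion:
  fixes Q :: "'a::field poly"
  assumes "finite A" "degree Q < card A"
  shows "Q = (\<Sum>x\<in>A. smult (poly Q x) (lagrange_basis A x))"
proof (rule poly_eqI_degree)
  show "degree (\<Sum>x\<in>A. smult (poly Q x) (lagrange_basis A x)) < card A"
    using assms degree_lagrange_basis[OF assms(1)]
    by (intro degree_sum_less order_le_less_trans[OF degree_smult_le]) auto
  show "poly Q x = poly (\<Sum>x\<in>A. smult (poly Q x) (lagrange_basis A x)) x" if "x \<in> A" for x
    using assms that by (simp add: poly_sum poly_lagrange_basis if_distrib[of "(*) _"] cong: if_cong)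
qed (use assms in auto)

lemma simultaneous_convergent_subsequence:
  fixes v :: "nat \<Rightarrow> 'i \<Rightarrow> complex"
  assumes "finite A" "\<And>i. i \<in> A \<Longrightarrow> bounded (range (\<lambda>j. v j i))"
  shows "\<exists>s l. strict_mono (s :: nat \<Rightarrow> nat) \<and> (\<forall>i\<in>A. (\<lambda>j. v (s j) i) \<longlonglongrightarrow> l i)"
  using assms
proof (induction A)
  case empty
  then show ?case
    by (intro exI[of _ id]) (auto simp: strict_mono_def)
next
  case (insert i A)
  then obtain s l where s: "strict_mono (s :: nat \<Rightarrow> nat)" "\<forall>k\<in>A. (\<lambda>j. v (s j) k) \<longlonglongrightarrow> l k"
    by auto
  have "bounded (range (\<lambda>j. v (s j) i))"
    by (rule bounded_subset[OF insert.prems(1)[of i]]) auto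
  then obtain m s' where s': "strict_mono s'" "((\<lambda>j. v (s j) i) \<circ> s') \<longlonglongrightarrow> m"
    using bounded_imp_convergent_subsequence by blast
  have "(\<lambda>j. v (s (s' j)) k) \<longlonglongrightarrow> (l(i := m)) k" if "k \<in> insert i A" for k
    using that s'(2) s(2) s'(1) LIMSEQ_subseq_LIMSEQ[of "\<lambda>j. v (s j) k" "l k" s'] by (auto simp: o_def)
  then show ?case
    using strict_mono_o[OF s(1) s'(1)] by (intro exI[of _ "s \<circ> s'"] exI[of _ "l(i := m)"]) (simp add: o_def)
qed

text \<open>Treats both extremal problems as one affine family \<open>p0 + r * Q\<close> with
  \<open>degree Q < n\<close>: the monic problem is \<open>p0 = monom 1 n\<close>,
  \<open>r = 1\<close>, and the problem normalized at a real point \<open>y\<close> is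
  \<open>p0 = 1\<close>, \<open>r = [:- y, 1:]\<close>.\<close>

locale min_sup_norm =
  fixes E :: "real set" and n :: nat and p0 r :: "complex poly"
  assumes compact_E: "compact E" and infinite_E: "infinite E" and n_pos: "n > 0"
    and r_nonzero: "\<And>t. t \<in> E \<Longrightarrow> poly r (of_real t) \<noteq> 0"
begin

definition C :: "complex poly set"
  where "C = {p0 + r * Q |Q. degree Q < n}"

lemma E_nonempty: "E \<noteq> {}"
  using infinite_E by auto

lemma sup_norm_nonneg: "0 \<le> sup_norm_on E P"
proof -
  obtain t where "t \<in> E"
    using E_nonempty by blast
  then show ?thesis
    using norm_poly_le_sup_norm_on[OF compact_E, of t P] norm_ge_zero order_trans by blast
qed

lemma exists_min: "\<exists>P\<in>C. \<forall>P'\<in>C. sup_norm_on E P \<le> sup_norm_on E P'"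
proof -
  define m where "m = Inf (sup_norm_on E ` C)"
  have ne: "C \<noteq> {}"
    using n_pos by (auto simp: C_def intro: exI[of _ 0])
  have bdd: "bdd_below (sup_norm_on E ` C)"
    using sup_norm_nonneg by (intro bdd_belowI[of _ 0]) auto
  have "\<exists>P\<in>C. sup_norm_on E P < m + 1 / Suc j" for j
    using cInf_lessD[of "sup_norm_on E ` C" "m + 1 / Suc j"] ne by (auto simp: m_def)
  then have "\<forall>j. \<exists>Q. degree Q < n \<and> sup_norm_on E (p0 + r * Q) < m + 1 / Suc j"
    by (auto simp: C_def)
  then obtain Q where Q: "\<And>j. degree (Q j) < n" "\<And>j. sup_norm_on E (p0 + r * Q j) < m + 1 / Suc j"
    by metis
  \<comment> \<open>Bounded values of \<open>p0 + r * Q j\<close> bound \<open>Q j\<close> at these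
    \<open>n\<close> nodes because \<open>r\<close> does not vanish there. A polynomial of degree
    below \<open>n\<close> depends linearly on its values at the nodes, so convergence at the nodes
    gives convergence everywhere.\<close>
  obtain A where A: "A \<subseteq> E" "finite A" "card A = n"
    using infinite_arbitrarily_large[OF infinite_E] by blast
  have bnd: "norm (poly p0 (of_real t) + poly r (of_real t) * poly (Q j) (of_real t)) \<le> m + 1" if "t \<in> E" for t j
  proof -
    have "norm (poly (p0 + r * Q j) (of_real t)) \<le> m + 1 / Suc j"
      using norm_poly_le_sup_norm_on[OF compact_E that, of "p0 + r * Q j"] Q(2)[of j] by linarith
    also have "1 / real (Suc j) \<le> 1"
      by simp
    finally show ?thesis
      by simp
  qed
  have "bounded (range (\<lambda>j. poly (Q j) (of_real t)))" if "t \<in> A" for t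
  proof (rule boundedI)
    have t: "t \<in> E" "poly r (of_real t) \<noteq> 0"
      using that A r_nonzero by auto
    fix z assume "z \<in> range (\<lambda>j. poly (Q j) (of_real t))"
    then obtain j where z: "z = poly (Q j) (of_real t)"
      by auto
    have "norm (poly r (of_real t) * z) \<le> norm (poly p0 (of_real t) + poly r (of_real t) * z) + norm (poly p0 (of_real t))"
      by norm
    also have "\<dots> \<le> m + 1 + norm (poly p0 (of_real t))"
      using bnd[OF t(1), of j] by (simp add: z)
    finally show "norm z \<le> (m + 1 + norm (poly p0 (of_real t))) / norm (poly r (of_real t))"
      using t(2) by (simp add: norm_mult field_simps)
  qed
  then obtain s l where s: "strict_mono (s :: nat \<Rightarrow> nat)" "\<forall>t\<in>A. (\<lambda>j. poly (Q (s j)) (of_real t)) \<longlonglongrightarrow> l t"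
    using simultaneous_convergent_subsequence[of A "\<lambda>j t. poly (Q j) (complex_of_real t)"] A(2) by blast
  let ?A = "complex_of_real ` A"
  have cA: "card ?A = n" "finite ?A"
    using A by (auto simp: card_image inj_on_def)
  define L where "L = (\<Sum>x\<in>?A. smult (l (Re x)) (lagrange_basis ?A x))"
  have degL: "degree L < n"
    unfolding L_def using degree_lagrange_basis[of ?A] cA n_pos
    by (intro degree_sum_less order_le_less_trans[OF degree_smult_le]) auto
  have lim: "(\<lambda>j. poly (Q (s j)) z) \<longlonglongrightarrow> poly L z" for z
  proof -
    have "poly (Q (s j)) z = (\<Sum>x\<in>?A. poly (Q (s j)) (of_real (Re x)) * poly (lagrange_basis ?A x) z)" for j
    proof -
      have "poly (Q (s j)) z = poly (\<Sum>x\<in>?A. smult (poly (Q (s j)) x) (lagrange_basis ?A x)) z"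
        using lagrange_expansion[of ?A "Q (s j)"] cA Q(1) by simp
      also have "\<dots> = (\<Sum>x\<in>?A. poly (Q (s j)) (of_real (Re x)) * poly (lagrange_basis ?A x) z)"
        by (auto simp: poly_sum intro!: sum.cong)
      finally show ?thesis .
    qed
    moreover have "(\<lambda>j. \<Sum>x\<in>?A. poly (Q (s j)) (of_real (Re x)) * poly (lagrange_basis ?A x) z)
        \<longlonglongrightarrow> (\<Sum>x\<in>?A. l (Re x) * poly (lagrange_basis ?A x) z)"
      using s(2) by (intro tendsto_intros) auto
    ultimately show ?thesis
      by (simp add: L_def poly_sum)
  qed
  have "sup_norm_on E (p0 + r * L) \<le> m"
  proof (rule sup_norm_on_le[OF E_nonempty])
    fix t assume t: "t \<in> E"
    have "(\<lambda>j. norm (poly p0 (of_real t) + poly r (of_real t) * poly (Q (s j)) (of_real t)))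
      \<longlonglongrightarrow> norm (poly p0 (of_real t) + poly r (of_real t) * poly L (of_real t))"
      by (intro tendsto_intros lim)
    moreover have "(\<lambda>j. m + 1 / Suc (s j)) \<longlonglongrightarrow> m + 0"
      by (intro tendsto_intros LIMSEQ_subseq_LIMSEQ[OF LIMSEQ_inverse_real_of_nat s(1), unfolded o_def inverse_eq_divide])
    moreover have "norm (poly p0 (of_real t) + poly r (of_real t) * poly (Q (s j)) (of_real t)) \<le> m + 1 / Suc (s j)" for j
      using norm_poly_le_sup_norm_on[OF compact_E t, of "p0 + r * Q (s j)"] Q(2)[of "s j"] by simp
    ultimately have "norm (poly p0 (of_real t) + poly r (of_real t) * poly L (of_real t)) \<le> m + 0"
      by (intro LIMSEQ_le) auto
    then show "norm (poly (p0 + r * L) (of_real t)) \<le> m"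
      by simp
  qed
  moreover have "m \<le> sup_norm_on E P'" if "P' \<in> C" for P'
    unfolding m_def using that bdd by (intro cInf_lower) auto
  ultimately show ?thesis
    using degL by (intro bexI[of _ "p0 + r * L"]) (auto simp: C_def intro: order_trans)
qed

text \<open>Kolmogorov's argument: with at most \<open>n\<close> extreme points some
  \<open>Q\<close> of degree below \<open>n\<close> makes \<open>r * Q\<close> agree with
  \<open>P\<close> at all of them, and subtracting a small multiple of \<open>r * Q\<close> lowers
  the norm.\<close>

lemma card_extreme_points:
  assumes P: "P \<in> C" and min: "\<And>P'. P' \<in> C \<Longrightarrow> sup_norm_on E P \<le> sup_norm_on E P'"
    and pos: "sup_norm_on E P > 0"
    and fin: "finite {t\<in>E. norm (poly P (of_real t)) = sup_norm_on E P}"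
  shows "card {t\<in>E. norm (poly P (of_real t)) = sup_norm_on E P} > n"
proof (rule ccontr)
  define M where "M = sup_norm_on E P"
  define X where "X = {t\<in>E. norm (poly P (of_real t)) = M}"
  assume "\<not> ?thesis"
  then have cX: "card X \<le> n" "finite X"
    using fin by (auto simp: X_def M_def)
  let ?X = "complex_of_real ` X"
  have "card ?X \<le> n" "finite ?X"
    using cX by (auto simp: card_image inj_on_def)
  then obtain Q where Q: "degree Q < n" "\<And>x. x \<in> ?X \<Longrightarrow> poly Q x = poly P x / poly r x"
    using lagrange_interpolation[of ?X n "\<lambda>x. poly P x / poly r x"] n_pos by blast
  define D where "D = (\<lambda>t. poly (r * Q) (complex_of_real t))"
  define p where "p = (\<lambda>t. poly P (complex_of_real t))"
  have DX: "D t = p t" if "t \<in> X" for t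
    using that Q(2)[of "of_real t"] r_nonzero[of t] by (auto simp: D_def p_def X_def)
  \<comment> \<open>Off \<open>S\<close> the correction points sufficiently in the direction of
    \<open>P\<close>. The compact set \<open>S\<close> contains no extreme point, since at those the
    real part is \<open>M\<^sup>2\<close>; so \<open>P\<close> stays below some
    \<open>M' < M\<close> on it.\<close>
  define S where "S = {t\<in>E. Re (cnj (p t) * D t) \<le> M\<^sup>2 / 2}"
  have M: "M > 0"
    using pos by (simp add: M_def)
  have contp: "continuous_on A p" "continuous_on A D" for A
    unfolding p_def D_def by (intro continuous_intros)+
  have pM: "norm (p t) \<le> M" if "t \<in> E" for t
    unfolding p_def M_def using norm_poly_le_sup_norm_on[OF compact_E that] .
  have "closedin (top_of_set E) (E \<inter> (\<lambda>t. Re (cnj (p t) * D t)) -` {..M\<^sup>2 / 2})"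
    by (intro continuous_closedin_preimage continuous_intros contp)
  then have compS: "compact S"
    using compact_E closedin_compact by (auto simp: S_def vimage_def Int_def)
  obtain M' where M': "M' < M" "\<And>t. t \<in> S \<Longrightarrow> norm (p t) \<le> M'"
  proof (cases "S = {}")
    case True
    then show ?thesis
      using that[of "M - 1"] by auto
  next
    case False
    have "\<exists>t\<in>S. \<forall>u\<in>S. norm (p u) \<le> norm (p t)"
      by (intro continuous_attains_sup compS False continuous_intros contp)
    then obtain t where t: "t \<in> S" "\<And>u. u \<in> S \<Longrightarrow> norm (p u) \<le> norm (p t)"
      by blast
    have "t \<notin> X"
    proof
      assume "t \<in> X"
      then have "cnj (p t) * D t = of_real (M\<^sup>2)"
        using DX complex_norm_square[of "p t"] by (simp add: X_def p_def mult.commute)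
      then have "Re (cnj (p t) * D t) = M\<^sup>2"
        by (simp only: Re_complex_of_real)
      moreover have "Re (cnj (p t) * D t) \<le> M\<^sup>2 / 2"
        using t(1) unfolding S_def by blast
      moreover have "M\<^sup>2 > 0"
        using M by simp
      ultimately show False
        by linarith
    qed
    then have "norm (p t) < M"
      using t(1) pM[of t] by (auto simp: S_def X_def p_def)
    with t(2) show ?thesis
      by (intro that[of "norm (p t)"])
  qed
  obtain B where B: "B > 0" "\<And>t. t \<in> E \<Longrightarrow> norm (D t) \<le> B"
    using compact_imp_bounded[OF compact_continuous_image[OF contp(2) compact_E]]
    by (auto simp: bounded_pos)
  \<comment> \<open>The first bound lets the norm on \<open>S\<close> rise at most to
    \<open>(M + M') / 2\<close>. The second keeps the quadratic term
    \<open>\<epsilon>\<^sup>2 * B\<^sup>2\<close> below half of the gain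
    \<open>\<epsilon> * M\<^sup>2\<close> made off \<open>S\<close>.\<close>
  define \<epsilon> where "\<epsilon> = min ((M - M') / (2 * B)) (M\<^sup>2 / (2 * B\<^sup>2))"
  have \<epsilon>: "\<epsilon> > 0" "\<epsilon> * B \<le> (M - M') / 2" "\<epsilon> * B\<^sup>2 \<le> M\<^sup>2 / 2"
  proof -
    show "\<epsilon> > 0"
      using M M' B by (auto simp: \<epsilon>_def)
    have "\<epsilon> \<le> (M - M') / (2 * B)" "\<epsilon> \<le> M\<^sup>2 / (2 * B\<^sup>2)"
      by (auto simp: \<epsilon>_def)
    then show "\<epsilon> * B \<le> (M - M') / 2" "\<epsilon> * B\<^sup>2 \<le> M\<^sup>2 / 2"
      using B(1) by (simp_all add: field_simps)
  qed
  define N where "N = max ((M + M') / 2) (sqrt (M\<^sup>2 - \<epsilon> * M\<^sup>2 / 2))"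
  have small: "norm (p t - of_real \<epsilon> * D t) \<le> N" if t: "t \<in> E" for t
  proof (cases "t \<in> S")
    case True
    have "norm (p t - of_real \<epsilon> * D t) \<le> norm (p t) + \<epsilon> * norm (D t)"
      using norm_triangle_ineq4[of "p t" "of_real \<epsilon> * D t"] \<epsilon>(1) by (simp add: norm_mult)
    also have "\<dots> \<le> M' + \<epsilon> * B"
      using M'(2)[OF True] B(2)[OF t] \<epsilon>(1) by (intro add_mono mult_left_mono) auto
    also have "\<dots> \<le> (M + M') / 2"
      using \<epsilon>(2) by argo
    finally show ?thesis
      unfolding N_def by (rule max.coboundedI1)
  next
    case False
    then have re: "Re (cnj (p t) * D t) > M\<^sup>2 / 2"
      using t by (simp add: S_def)
    have "(norm (p t - of_real \<epsilon> * D t))\<^sup>2 = (norm (p t))\<^sup>2 - 2 * \<epsilon> * Re (cnj (p t) * D t) + \<epsilon>\<^sup>2 * (norm (D t))\<^sup>2"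
      by (simp only: cmod_power2) (simp add: power2_eq_square algebra_simps)
    also have "\<dots> \<le> M\<^sup>2 - 2 * \<epsilon> * (M\<^sup>2 / 2) + \<epsilon>\<^sup>2 * B\<^sup>2"
      using re \<epsilon>(1) B(2)[OF t] pM[OF t] by (intro add_mono diff_mono power_mono mult_left_mono) auto
    also have "\<epsilon>\<^sup>2 * B\<^sup>2 = \<epsilon> * (\<epsilon> * B\<^sup>2)"
      by (simp add: power2_eq_square)
    also have "\<epsilon> * (\<epsilon> * B\<^sup>2) \<le> \<epsilon> * (M\<^sup>2 / 2)"
      using \<epsilon> by (intro mult_left_mono) auto
    finally have "(norm (p t - of_real \<epsilon> * D t))\<^sup>2 \<le> M\<^sup>2 - \<epsilon> * M\<^sup>2 / 2"
      by (simp add: algebra_simps)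
    then show ?thesis
      unfolding N_def by (meson le_max_iff_disj real_le_rsqrt)
  qed
  have "sqrt (M\<^sup>2 - \<epsilon> * M\<^sup>2 / 2) < sqrt (M\<^sup>2)"
    using M \<epsilon>(1) by (intro real_sqrt_less_mono) simp
  then have NM: "N < M"
    using M M'(1) by (simp add: N_def)
  obtain Q0 where Q0: "degree Q0 < n" "P = p0 + r * Q0"
    using P by (auto simp: C_def)
  let ?P' = "P - smult (of_real \<epsilon>) (r * Q)"
  have "?P' = p0 + r * (Q0 - smult (of_real \<epsilon>) Q)"
    by (simp add: Q0 algebra_simps)
  moreover have "degree (Q0 - smult (of_real \<epsilon>) Q) < n"
    by (intro degree_diff_less Q0 order_le_less_trans[OF degree_smult_le] Q)
  ultimately have "?P' \<in> C"
    by (auto simp: C_def)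
  then have "M \<le> sup_norm_on E ?P'"
    unfolding M_def by (rule min)
  also have "\<dots> \<le> N"
    using small by (intro sup_norm_on_le E_nonempty) (simp add: p_def D_def)
  finally show False
    using NM by simp
qed

text \<open>The midpoint of two minimizers is again a minimizer. At each of its extreme points the
  parallelogram law forces the two values to coincide, and there are more than \<open>n\<close> such
  points, which determines \<open>Q\<close>.\<close>

lemma unique_min:
  assumes P1: "P1 \<in> C" "\<And>P'. P' \<in> C \<Longrightarrow> sup_norm_on E P1 \<le> sup_norm_on E P'"
    and P2: "P2 \<in> C" "\<And>P'. P' \<in> C \<Longrightarrow> sup_norm_on E P2 \<le> sup_norm_on E P'"
  shows "P1 = P2"
proof -
  obtain Q1 Q2 where Q: "degree Q1 < n" "P1 = p0 + r * Q1" "degree Q2 < n" "P2 = p0 + r * Q2"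
    using P1(1) P2(1) by (auto simp: C_def)
  define P where "P = p0 + r * (smult (1/2) (Q1 + Q2))"
  have PC: "P \<in> C"
    unfolding C_def P_def using degree_add_less[of Q1 n Q2] Q
    by (blast intro: order_le_less_trans[OF degree_smult_le])
  define M where "M = sup_norm_on E P1"
  have M2: "sup_norm_on E P2 = M"
    using P1 P2 by (simp add: M_def antisym)
  have pe: "poly P z = (poly P1 z + poly P2 z) / 2" for z
    by (simp add: P_def Q field_simps)
  have b: "norm (poly P1 (of_real t)) \<le> M" "norm (poly P2 (of_real t)) \<le> M" if "t \<in> E" for t
    using norm_poly_le_sup_norm_on[OF compact_E that, of P1] norm_poly_le_sup_norm_on[OF compact_E that, of P2] M2
    by (simp_all add: M_def)
  have "sup_norm_on E P \<le> M"
  proof (rule sup_norm_on_le[OF E_nonempty])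
    fix t assume "t \<in> E"
    then show "norm (poly P (of_real t)) \<le> M"
      using b[of t] norm_triangle_ineq[of "poly P1 (of_real t)" "poly P2 (of_real t)"]
      by (simp add: pe norm_divide)
  qed
  then have MP: "sup_norm_on E P = M"
    using P1(2)[OF PC] by (simp add: M_def)
  define X where "X = {t\<in>E. norm (poly P (of_real t)) = M}"
  have eqX: "poly Q1 (of_real t) = poly Q2 (of_real t)" if "t \<in> X" for t
  proof -
    define u v where "u = poly P1 (of_real t)" and "v = poly P2 (of_real t)"
    have uv: "norm u \<le> M" "norm v \<le> M" "norm (u + v) = 2 * M"
      using that b[of t] by (auto simp: X_def pe u_def v_def norm_divide)
    have "(norm (u - v))\<^sup>2 = 2 * (norm u)\<^sup>2 + 2 * (norm v)\<^sup>2 - (norm (u + v))\<^sup>2"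
      by (simp only: cmod_power2) (simp add: power2_eq_square algebra_simps)
    also have "\<dots> \<le> 2 * M\<^sup>2 + 2 * M\<^sup>2 - (2 * M)\<^sup>2"
      unfolding uv(3) using uv by (intro diff_right_mono add_mono mult_left_mono power_mono) auto
    finally have "u = v"
      by (simp add: power_mult_distrib)
    then show ?thesis
      using that r_nonzero[of t] by (auto simp: u_def v_def Q X_def)
  qed
  have "\<exists>Y. finite Y \<and> Y \<subseteq> X \<and> card Y = n"
  proof (cases "finite X")
    case True
    have "M > 0"
    proof (rule ccontr)
      assume "\<not> M > 0"
      then have "X = E"
        using b sup_norm_nonneg[of P] MP by (auto simp: X_def pe)
      with True infinite_E show False
        by simp
    qed
    then have "card X > n"
      using card_extreme_points[OF PC _ _] P1(2) True by (simp add: MP M_def X_def)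
    then obtain Y where "Y \<subseteq> X" "card Y = n"
      using obtain_subset_with_card_n[of n X] by auto
    then show ?thesis
      using True finite_subset by blast
  next
    case False
    then show ?thesis
      using infinite_arbitrarily_large by blast
  qed
  then obtain Y where Y: "finite Y" "Y \<subseteq> X" "card Y = n"
    by blast
  have "Q1 = Q2"
  proof (rule poly_eqI_degree)
    show "degree Q1 < card (complex_of_real ` Y)" "degree Q2 < card (complex_of_real ` Y)"
      using Y Q by (simp_all add: card_image inj_on_def)
    show "poly Q1 z = poly Q2 z" if "z \<in> complex_of_real ` Y" for z
      using that Y eqX by auto
  qed
  then show ?thesis
    by (simp add: Q)
qed

end

lemma poly_map_poly_cnj_of_real: "poly (map_poly cnj p) (of_real t) = cnj (poly p (of_real t))"
  by (induction p) (simp_all add: map_poly_pCons)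

text \<open>Real values follow from uniqueness: conjugating the coefficients preserves both
  admissibility and the norm. The zero count for trigonometric polynomials depends on this.\<close>

lemma extremal_poly:
  assumes E: "compact E" "infinite E" and n: "n > 0" and xs: "xs \<notin> Some ` E"
  defines "P \<equiv> extremal_poly E n xs"
  shows "admissible_poly n xs P" (is ?A)
    and "admissible_poly n xs Q \<Longrightarrow> sup_norm_on E P \<le> sup_norm_on E Q"
    and "poly P (of_real t) \<in> \<real>"
proof -
  define p0 where "p0 = (case xs of None \<Rightarrow> monom 1 n | Some y \<Rightarrow> (1 :: complex poly))"
  define r where "r = (case xs of None \<Rightarrow> 1 | Some y \<Rightarrow> [:- complex_of_real y, 1:])"
  interpret min_sup_norm E n p0 r
    by standard (use E n xs in \<open>auto simp: r_def split: option.splits\<close>)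
  have adm: "admissible_poly n xs P \<longleftrightarrow> P \<in> C" for P
  proof (cases xs)
    case None
    have "degree P = n \<and> lead_coeff P = 1 \<longleftrightarrow> degree (P - monom 1 n) < n"
    proof
      assume "degree P = n \<and> lead_coeff P = 1"
      then show "degree (P - monom 1 n) < n"
        using n by (intro degree_lessI) (auto simp: coeff_eq_0 le_less)
    next
      assume d: "degree (P - monom 1 n) < n"
      have "degree (monom 1 n + (P - monom 1 n)) = n"
        using d by (subst degree_add_eq_left) (auto simp: degree_monom_eq)
      moreover have "coeff (P - monom 1 n) n = 0"
        using d by (rule coeff_eq_0)
      ultimately show "degree P = n \<and> lead_coeff P = 1"
        by simp
    qed
    also have "\<dots> \<longleftrightarrow> P \<in> C"
      unfolding C_def unfolding p0_def r_def None by (auto intro!: exI[of _ "P - monom 1 n"])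
    finally show ?thesis
      using None by (simp add: admissible_poly_def)
  next
    case (Some y)
    have "degree P \<le> n \<and> poly P (of_real y) = 1 \<longleftrightarrow> (\<exists>Q. P = 1 + [:- of_real y, 1:] * Q \<and> degree Q < n)"
    proof safe
      assume d: "degree P \<le> n" "poly P (of_real y) = 1"
      then have "poly (P - 1) (of_real y) = 0"
        by simp
      then obtain Q where Q: "P - 1 = [:- of_real y, 1:] * Q"
        unfolding poly_eq_0_iff_dvd by (auto elim: dvdE)
      have "degree Q < n"
      proof (cases "Q = 0")
        case False
        then have "degree (P - 1) = 1 + degree Q"
          unfolding Q by (subst degree_mult_eq) auto
        moreover have "degree (P - 1) \<le> n"
          using d(1) by (intro degree_diff_le) auto
        ultimately show ?thesis
          by simp
      qed (use n in simp)
      then show "\<exists>Q. P = 1 + [:- of_real y, 1:] * Q \<and> degree Q < n"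
        using Q by (intro exI[of _ Q]) (simp add: algebra_simps)
    next
      fix Q :: "complex poly" assume "degree Q < n"
      then show "degree (1 + [:- of_real y, 1:] * Q) \<le> n"
        by (intro degree_add_le order_trans[OF degree_mult_le]) auto
    qed simp
    then show ?thesis
      unfolding C_def unfolding p0_def r_def admissible_poly_def Some by auto
  qed
  obtain P' where P': "P' \<in> C" "\<And>Q. Q \<in> C \<Longrightarrow> sup_norm_on E P' \<le> sup_norm_on E Q"
    using exists_min by blast
  have "P = P'"
    unfolding P_def extremal_poly_def adm
    by (rule the_equality) (use P' unique_min in blast)+
  then show A: ?A and min: "\<And>Q. admissible_poly n xs Q \<Longrightarrow> sup_norm_on E P \<le> sup_norm_on E Q"
    using P' by (auto simp: adm)
  have nrm: "sup_norm_on E (map_poly cnj P) = sup_norm_on E P"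
    unfolding sup_norm_on_def poly_map_poly_cnj_of_real by simp
  have "admissible_poly n xs (map_poly cnj P)"
    using A by (cases xs)
      (auto simp: admissible_poly_def poly_map_poly_cnj_of_real coeff_map_poly degree_map_poly)
  then have "map_poly cnj P = P"
    using P' nrm \<open>P = P'\<close> by (intro unique_min) (auto simp: adm)
  then show "poly P (of_real t) \<in> \<real>"
    using poly_map_poly_cnj_of_real[of P t] by (simp add: Reals_cnj_iff)
qed

subsection \<open>Choice of a threshold\<close>

text \<open>For distinct values the sum is that of \<open>1 / sqrt j\<close> over \<open>j\<close>
  from 1 to \<open>card K\<close>; ties only raise ranks. The induction removes a maximal element,
  whose rank is \<open>card K\<close>, and the step
  \<open>1 / sqrt (n + 1) \<le> 2 * (sqrt (n + 1) - sqrt n)\<close> is the inequality of arithmetic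
  and geometric means.\<close>

lemma sum_inverse_sqrt_rank_le:
  fixes y :: "'i \<Rightarrow> real"
  assumes "finite K"
  shows "(\<Sum>k\<in>K. 1 / sqrt (real (card {i\<in>K. y i \<le> y k}))) \<le> 2 * sqrt (real (card K))"
  using assms
proof (induction "card K" arbitrary: K)
  case 0
  then show ?case by simp
next
  case (Suc n)
  then have "K \<noteq> {}"
    by auto
  then obtain m where m: "m \<in> K" "\<And>i. i \<in> K \<Longrightarrow> y i \<le> y m"
  proof -
    have "Max (y ` K) \<in> y ` K"
      using Suc.prems \<open>K \<noteq> {}\<close> by (intro Max_in) auto
    then obtain m where "m \<in> K" "y m = Max (y ` K)"
      by auto
    then show ?thesis
      using that[of m] Suc.prems by simp
  qed
  let ?K = "K - {m}"
  have card: "card ?K = n"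
    using Suc m by simp
  have rm: "{i\<in>K. y i \<le> y m} = K"
    using m by auto
  have "(\<Sum>k\<in>K. 1 / sqrt (real (card {i\<in>K. y i \<le> y k})))
      = 1 / sqrt (real (card K)) + (\<Sum>k\<in>?K. 1 / sqrt (real (card {i\<in>K. y i \<le> y k})))"
    using m Suc.prems by (subst sum.remove[of _ m]) (simp_all only: rm)
  also have "(\<Sum>k\<in>?K. 1 / sqrt (real (card {i\<in>K. y i \<le> y k})))
      \<le> (\<Sum>k\<in>?K. 1 / sqrt (real (card {i\<in>?K. y i \<le> y k})))"
  proof (rule sum_mono)
    fix k assume k: "k \<in> ?K"
    have "card {i\<in>?K. y i \<le> y k} \<le> card {i\<in>K. y i \<le> y k}"
      using Suc.prems by (intro card_mono) auto
    moreover have "card {i\<in>?K. y i \<le> y k} > 0"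
      using Suc.prems k by (auto simp: card_gt_0_iff)
    ultimately show "1 / sqrt (real (card {i\<in>K. y i \<le> y k})) \<le> 1 / sqrt (real (card {i\<in>?K. y i \<le> y k}))"
      by (intro divide_left_mono) auto
  qed
  also have "\<dots> \<le> 2 * sqrt (real n)"
    using Suc.hyps(1)[of ?K] card Suc.prems by simp
  also have "1 / sqrt (real (card K)) + 2 * sqrt (real n) \<le> 2 * sqrt (real (card K))"
  proof -
    have c: "real (card K) = real n + 1"
      using Suc.hyps(2) by simp
    have s: "sqrt (real n + 1) > 0"
      by simp
    have "sqrt (real n) * sqrt (real n + 1) \<le> (real n + (real n + 1)) / 2"
      using arith_geo_mean_sqrt[of "real n" "real n + 1"] by (simp add: real_sqrt_mult)
    then have "1 + 2 * (sqrt (real n) * sqrt (real n + 1)) \<le> 2 * (real n + 1)"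
      by argo
    also have "\<dots> = 2 * (sqrt (real n + 1) * sqrt (real n + 1))"
      by simp
    finally have "1 + 2 * sqrt (real n) * sqrt (real n + 1) \<le> 2 * sqrt (real n + 1) * sqrt (real n + 1)"
      by (simp only: mult.assoc)
    then have "(1 + 2 * sqrt (real n) * sqrt (real n + 1)) / sqrt (real n + 1) \<le> 2 * sqrt (real n + 1)"
      using s by (subst pos_divide_le_eq) auto
    then show ?thesis
      unfolding c using s by (simp add: add_divide_distrib)
  qed
  finally show ?case
    by simp
qed

lemma finite_above:
  fixes y :: "nat \<Rightarrow> real"
  assumes sm: "summable (\<lambda>k. sqrt (y k))" and T: "T > 0"
  shows "finite {k. y k > T}"
proof -
  have "(\<lambda>k. sqrt (y k)) \<longlonglongrightarrow> 0"
    by (rule summable_LIMSEQ_zero[OF sm])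
  then have "\<forall>\<^sub>F k in sequentially. sqrt (y k) < sqrt T"
    using T by (intro order_tendstoD) auto
  then have "\<forall>\<^sub>F k in cofinite. \<not> y k > T"
    unfolding cofinite_eq_sequentially by eventually_elim auto
  then show ?thesis
    by (simp add: eventually_cofinite)
qed

text \<open>The Markov bound, count times \<open>sqrt T\<close> at most the sum of
  \<open>sqrt (y k)\<close>, is applied to a tail whose sum is below \<open>\<eta> / 2\<close>; the
  first \<open>N\<close> indices contribute at most \<open>N * sqrt T\<close>, which tends to
  0.\<close>

lemma card_times_sqrt_tendsto_0:
  fixes y :: "nat \<Rightarrow> real"
  assumes pos: "\<And>k. y k > 0" and sm: "summable (\<lambda>k. sqrt (y k))" and "\<eta> > 0"
  shows "\<forall>\<^sub>F T in at_right 0. real (card {k. y k > T}) * sqrt T \<le> \<eta>"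
proof -
  note fin = finite_above[OF sm]
  obtain N where N: "(\<Sum>k. sqrt (y (k + N))) < \<eta> / 2"
    using order_tendstoD(2)[OF suminf_exist_split2[OF sm], of "\<eta> / 2"] \<open>\<eta> > 0\<close>
    by (auto simp: eventually_sequentially)
  have smN: "summable (\<lambda>k. sqrt (y (k + N)))"
    using sm by (rule summable_ignore_initial_segment)
  have "((\<lambda>T. real N * sqrt T) \<longlongrightarrow> real N * sqrt 0) (at_right 0)"
    by (intro tendsto_intros)
  then have "\<forall>\<^sub>F T in at_right 0. real N * sqrt T < \<eta> / 2"
    using \<open>\<eta> > 0\<close> by (intro order_tendstoD) auto
  moreover have "\<forall>\<^sub>F T in at_right 0. (T::real) > 0"
    by (simp add: eventually_at_right_less)
  ultimately show ?thesis
  proof eventually_elim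
    case (elim T)
    let ?S = "{k. y k > T}"
    have "card ?S \<le> card ({..<N} \<union> (?S - {..<N}))"
      using fin[OF elim(2)] by (intro card_mono) auto
    also have "\<dots> \<le> N + card (?S - {..<N})"
      using card_Un_le[of "{..<N}" "?S - {..<N}"] by simp
    finally have c: "real (card ?S) \<le> real N + real (card (?S - {..<N}))"
      by linarith
    have "real (card (?S - {..<N})) * sqrt T = (\<Sum>k\<in>?S - {..<N}. sqrt T)"
      by simp
    also have "\<dots> \<le> (\<Sum>k\<in>?S - {..<N}. sqrt (y k))"
      by (rule sum_mono) auto
    also have "\<dots> = (\<Sum>k\<in>(\<lambda>k. k - N) ` (?S - {..<N}). sqrt (y (k + N)))"
      by (subst sum.reindex) (auto simp: inj_on_def intro!: sum.cong)
    also have "\<dots> \<le> (\<Sum>k. sqrt (y (k + N)))"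
      by (rule sum_le_suminf[OF smN]) (use fin[OF elim(2)] pos in \<open>auto intro: less_imp_le\<close>)
    finally have "real (card (?S - {..<N})) * sqrt T \<le> \<eta> / 2"
      using N by linarith
    moreover have "real (card ?S) * sqrt T \<le> real N * sqrt T + real (card (?S - {..<N})) * sqrt T"
      using mult_right_mono[OF c, of "sqrt T"] elim(2) by (simp add: algebra_simps)
    ultimately show ?case
      using elim(1) by linarith
  qed
qed

text \<open>
  The threshold minimizes \<open>t + \<kappa> card {k. y k > t}\<close>: by minimality
  the points above it are spaced at least linearly, which keeps \<open>\<Sum> 1 / sqrt (y k - t)\<close> small.
\<close>

lemma exists_threshold:
  fixes y :: "nat \<Rightarrow> real"
  assumes pos: "\<And>k. y k > 0" and sm: "summable (\<lambda>k. sqrt (y k))" and \<sigma>: "\<sigma> > 0" and \<delta>: "\<delta> > 0"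
  obtains c where "c > 0" "\<forall>\<^sub>F n in sequentially. \<exists>t>0. real n * t \<le> \<sigma> \<and> finite {k. y k > t} \<and>
      (\<forall>k. y k > t \<longrightarrow> y k - t \<ge> c / real n powr (3/2)) \<and>
      (\<Sum>k | y k > t. 1 / sqrt (y k - t)) \<le> \<delta> * real n"
proof -
  \<comment> \<open>Chosen for the end of the proof: with \<open>T = \<sigma> / (2 * n)\<close> the
    sum is bounded by \<open>2 * sqrt 2 * \<eta> / T = sqrt 2 / 2 * \<delta> * n\<close>.\<close>
  define \<eta> where "\<eta> = \<delta> * \<sigma> / 8"
  have \<eta>: "\<eta> > 0"
    using \<sigma> \<delta> by (simp add: \<eta>_def)
  note fin = finite_above[OF sm]
  have "filterlim (\<lambda>n. \<sigma> / (2 * real n)) (at_right 0) sequentially"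
    using \<sigma> by real_asymp
  then have ev: "\<forall>\<^sub>F n in sequentially. real (card {k. y k > \<sigma> / (2 * real n)}) * sqrt (\<sigma> / (2 * real n)) \<le> \<eta>"
    using card_times_sqrt_tendsto_0[OF pos sm \<eta>] by (rule eventually_compose_filterlim[rotated])
  show ?thesis
  proof
    show "(\<sigma> / 2) powr (3/2) / \<eta> > 0"
      using \<sigma> \<eta> by simp
    show "\<forall>\<^sub>F n in sequentially. \<exists>t>0. real n * t \<le> \<sigma> \<and> finite {k. y k > t} \<and>
      (\<forall>k. y k > t \<longrightarrow> y k - t \<ge> (\<sigma> / 2) powr (3/2) / \<eta> / real n powr (3/2)) \<and>
      (\<Sum>k | y k > t. 1 / sqrt (y k - t)) \<le> \<delta> * real n"
      using ev eventually_gt_at_top[of 0]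
    proof eventually_elim
      case (elim n)
      define T where "T = \<sigma> / (2 * real n)"
      have T: "T > 0"
        using \<sigma> elim by (simp add: T_def)
      \<comment> \<open>The largest weight for which \<open>card_times_sqrt_tendsto_0\<close> still
        yields \<open>\<kappa> * card {k. y k > T} \<le> T\<close>. Then the minimum is at most
        \<open>2 * T\<close>, which bounds both \<open>t\<close> and
        \<open>\<kappa> * card {k. y k > t}\<close>.\<close>
      define \<kappa> where "\<kappa> = T * sqrt T / \<eta>"
      have \<kappa>: "\<kappa> > 0"
        using T \<eta> by (simp add: \<kappa>_def)
      define \<Psi> where "\<Psi> = (\<lambda>t. t + \<kappa> * real (card {k. y k > t}))"
      \<comment> \<open>Finitely many candidates suffice, because \<open>gap\<close> compares
        \<open>t\<close> only with values \<open>y j\<close> above it.\<close>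
      define F where "F = insert T (y ` {k. y k > T})"
      have F: "finite F" "F \<noteq> {}"
        using fin[OF T] by (auto simp: F_def)
      define t where "t = arg_min_on \<Psi> F"
      have tF: "t \<in> F" and tmin: "\<And>s. s \<in> F \<Longrightarrow> \<Psi> t \<le> \<Psi> s"
        unfolding t_def using F by (auto intro: arg_min_if_finite arg_min_least)
      have tT: "t \<ge> T"
        using tF by (auto simp: F_def)
      then have t: "t > 0"
        using T by linarith
      let ?K = "{k. y k > t}"
      note finK = fin[OF t]
      have "\<kappa> * real (card {k. y k > T}) \<le> T"
      proof -
        have "\<kappa> * real (card {k. y k > T}) = T / \<eta> * (real (card {k. y k > T}) * sqrt T)"
          by (simp add: \<kappa>_def)
        also have "\<dots> \<le> T / \<eta> * \<eta>"
          using elim(1) T \<eta> by (intro mult_left_mono divide_nonneg_pos) (simp_all only: T_def less_imp_le)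
        finally show ?thesis
          using \<eta> by simp
      qed
      moreover have "\<Psi> t \<le> \<Psi> T"
        by (rule tmin) (simp add: F_def)
      ultimately have \<Psi>t: "t + \<kappa> * real (card ?K) \<le> 2 * T"
        by (simp add: \<Psi>_def)
      then have t2T: "t \<le> 2 * T" and cK: "\<kappa> * real (card ?K) \<le> 2 * T"
        using \<kappa> t mult_nonneg_nonneg[of \<kappa> "real (card ?K)"] by linarith+
      \<comment> \<open>Raising the threshold from \<open>t\<close> to \<open>y j\<close> costs
        \<open>y j - t\<close> and saves \<open>\<kappa>\<close> for each point in between,
        \<open>y j\<close> included; minimality says that the cost is at least the saving.\<close>
      have gap: "y j - t \<ge> \<kappa> * real (card {i\<in>?K. y i \<le> y j})" if j: "y j > t" for j
      proof -
        have "\<Psi> t \<le> \<Psi> (y j)"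
          using j tT by (intro tmin) (auto simp: F_def)
        moreover have "card ?K = card {i\<in>?K. y i \<le> y j} + card {i. y i > y j}"
          using finK j by (subst card_Un_disjoint[symmetric]) (auto intro!: arg_cong[of _ _ card] intro: finite_subset[OF _ finK])
        ultimately show ?thesis
          by (simp add: \<Psi>_def algebra_simps)
      qed
      have rank: "card {i\<in>?K. y i \<le> y j} \<ge> 1" if "y j > t" for j
        using that finK by (auto simp: Suc_le_eq card_gt_0_iff)
      have gap\<kappa>: "y j - t \<ge> \<kappa>" if "y j > t" for j
      proof -
        have "\<kappa> * 1 \<le> \<kappa> * real (card {i\<in>?K. y i \<le> y j})"
          using rank[OF that] \<kappa> by (intro mult_left_mono) auto
        with gap[OF that] show ?thesis
          by linarith
      qed
      have \<kappa>n: "\<kappa> = (\<sigma> / 2) powr (3/2) / \<eta> / real n powr (3/2)"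
      proof -
        have "T * sqrt T = T powr 1 * T powr (1/2)"
          using T by (simp add: powr_half_sqrt)
        also have "\<dots> = T powr (3/2)"
          by (subst powr_add[symmetric]) simp
        also have "\<dots> = (\<sigma> / 2) powr (3/2) / real n powr (3/2)"
          unfolding T_def powr_divide[symmetric] by (simp add: field_simps)
        finally show ?thesis
          by (simp add: \<kappa>_def)
      qed
      have "(\<Sum>k\<in>?K. 1 / sqrt (y k - t)) \<le> (\<Sum>k\<in>?K. 1 / sqrt \<kappa> * (1 / sqrt (real (card {i\<in>?K. y i \<le> y k}))))"
      proof (rule sum_mono)
        fix k assume "k \<in> ?K"
        then have k: "y k > t"
          by simp
        have "sqrt \<kappa> * sqrt (real (card {i\<in>?K. y i \<le> y k})) \<le> sqrt (y k - t)"
          unfolding real_sqrt_mult[symmetric] using gap[OF k] by (rule real_sqrt_le_mono)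
        moreover have "sqrt \<kappa> * sqrt (real (card {i\<in>?K. y i \<le> y k})) > 0"
          using \<kappa> rank[OF k] by (intro mult_pos_pos) auto
        ultimately show "1 / sqrt (y k - t) \<le> 1 / sqrt \<kappa> * (1 / sqrt (real (card {i\<in>?K. y i \<le> y k})))"
          using frac_le[of 1 1 "sqrt \<kappa> * sqrt (real (card {i\<in>?K. y i \<le> y k}))" "sqrt (y k - t)"] by simp
      qed
      also have "\<dots> \<le> 1 / sqrt \<kappa> * (2 * sqrt (real (card ?K)))"
        unfolding sum_distrib_left[symmetric] using sum_inverse_sqrt_rank_le[OF finK, of y] \<kappa>
        by (intro mult_left_mono) auto
      also have "\<dots> = 2 * sqrt (\<kappa> * real (card ?K)) / \<kappa>"
        using \<kappa> by (simp add: real_sqrt_mult field_simps)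
      also have "\<dots> \<le> 2 * sqrt (2 * T) / \<kappa>"
        using cK \<kappa> by (intro divide_right_mono mult_left_mono real_sqrt_le_mono) auto
      also have "\<dots> = 2 * sqrt 2 * \<eta> / T"
        using T \<eta> by (simp add: \<kappa>_def real_sqrt_mult field_simps)
      also have "\<dots> = sqrt 2 / 2 * \<delta> * real n"
        using \<sigma> elim(2) by (simp add: T_def \<eta>_def field_simps)
      also have "\<dots> \<le> \<delta> * real n"
        using \<delta> sqrt2_less_2 mult_right_mono[of "sqrt 2 / 2" 1 "\<delta> * real n"] by (simp add: mult.assoc)
      finally have "(\<Sum>k\<in>?K. 1 / sqrt (y k - t)) \<le> \<delta> * real n" .
      moreover have "real n * t \<le> \<sigma>"
        using mult_left_mono[OF t2T, of "real n"] elim(2) by (simp add: T_def)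
      ultimately show ?case
        using t finK gap\<kappa> \<kappa>n by (intro exI[of _ t]) auto
    qed
  qed
qed

subsection \<open>Blaschke products\<close>

text \<open>The zero is real, so no conjugate appears. The unimodular constant of
  \<open>blaschke_factor\<close> is left out; it returns in \<open>factor\<close>.\<close>

definition blaschke :: "real \<Rightarrow> complex \<Rightarrow> complex"
  where "blaschke \<beta> w = (w - of_real \<beta>) / (1 - of_real \<beta> * w)"

lemma blaschke_denominator_nonzero:
  fixes w :: complex
  assumes "\<bar>\<beta>\<bar> * norm w < 1"
  shows "1 - of_real \<beta> * w \<noteq> 0"
proof
  assume "1 - of_real \<beta> * w = 0"
  then have "norm (of_real \<beta> * w) = 1"
    by simp
  with assms show False
    by (simp add: norm_mult)
qed

lemma blaschke_denominator_nonzero':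
  fixes w :: complex
  assumes "\<bar>\<beta>\<bar> < 1" "norm w \<le> 1"
  shows "1 - of_real \<beta> * w \<noteq> 0"
proof (rule blaschke_denominator_nonzero)
  have "\<bar>\<beta>\<bar> * norm w \<le> \<bar>\<beta>\<bar> * 1"
    using assms by (intro mult_left_mono) auto
  then show "\<bar>\<beta>\<bar> * norm w < 1"
    using assms(1) by linarith
qed

text \<open>The sign of \<open>norm w - 1\<close> decides on which side of 1 the modulus lies, so
  one identity serves inside the disk, near the circle and on a larger circle.\<close>

lemma norm_blaschke_squared:
  assumes "1 - of_real \<beta> * w \<noteq> 0"
  shows "(norm (blaschke \<beta> w))\<^sup>2 = 1 + ((norm w)\<^sup>2 - 1) * (1 - \<beta>\<^sup>2) / (norm (1 - of_real \<beta> * w))\<^sup>2"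
proof -
  have "(norm (w - of_real \<beta>))\<^sup>2 = (norm (1 - of_real \<beta> * w))\<^sup>2 + ((norm w)\<^sup>2 - 1) * (1 - \<beta>\<^sup>2)"
    by (simp only: cmod_power2) (simp add: power2_eq_square algebra_simps)
  then show ?thesis
    using assms by (simp add: blaschke_def norm_divide power_divide add_divide_distrib)
qed

lemma norm_blaschke_le_1:
  assumes "\<bar>\<beta>\<bar> < 1" "norm w \<le> 1"
  shows "norm (blaschke \<beta> w) \<le> 1"
proof -
  have "(norm w)\<^sup>2 \<le> 1" "\<beta>\<^sup>2 \<le> 1"
    using assms by (simp_all add: abs_square_le_1)
  then have "((norm w)\<^sup>2 - 1) * (1 - \<beta>\<^sup>2) / (norm (1 - of_real \<beta> * w))\<^sup>2 \<le> 0"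
    by (intro divide_nonpos_nonneg mult_nonpos_nonneg) auto
  then have "(norm (blaschke \<beta> w))\<^sup>2 \<le> 1"
    using norm_blaschke_squared[OF blaschke_denominator_nonzero'[OF assms]] by simp
  then show ?thesis
    by (simp add: abs_square_le_1)
qed

lemma blaschke_eq_0_iff:
  assumes "\<bar>\<beta>\<bar> < 1" "norm w \<le> 1"
  shows "blaschke \<beta> w = 0 \<longleftrightarrow> w = of_real \<beta>"
  using blaschke_denominator_nonzero'[OF assms] by (simp add: blaschke_def)

lemma blaschke_holomorphic:
  assumes "\<And>w. w \<in> S \<Longrightarrow> 1 - of_real \<beta> * w \<noteq> 0"
  shows "blaschke \<beta> holomorphic_on S"
  unfolding blaschke_def using assms by (intro holomorphic_intros) auto

text \<open>A uniform form of modulus 1 on the circle, for use on circles of radius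
  \<open>r < 1\<close> when the function to be divided has no boundary values.\<close>

lemma norm_blaschke_circle_ge:
  assumes "\<bar>\<beta>\<bar> < 1"
  shows "\<exists>c. (\<forall>w. norm w < 1 \<longrightarrow> 1 - c * (1 - (norm w)\<^sup>2) \<le> (norm (blaschke \<beta> w))\<^sup>2)"
proof (intro exI allI impI)
  fix w :: complex assume w: "norm w < 1"
  have le: "1 - \<bar>\<beta>\<bar> \<le> norm (1 - of_real \<beta> * w)"
  proof -
    have "1 - norm (of_real \<beta> * w) \<le> norm (1 - of_real \<beta> * w)"
      using norm_triangle_ineq2[of 1 "of_real \<beta> * w"] by simp
    moreover have "norm (of_real \<beta> * w) \<le> \<bar>\<beta>\<bar> * 1"
      unfolding norm_mult norm_of_real using w by (intro mult_left_mono) auto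
    ultimately show ?thesis
      by linarith
  qed
  have "\<beta>\<^sup>2 \<le> 1" "(norm w)\<^sup>2 \<le> 1"
    using assms w by (simp_all add: abs_square_le_1)
  then have "(1 - (norm w)\<^sup>2) * (1 - \<beta>\<^sup>2) / (norm (1 - of_real \<beta> * w))\<^sup>2 \<le> (1 - (norm w)\<^sup>2) * 1 / (1 - \<bar>\<beta>\<bar>)\<^sup>2"
    using le assms by (intro frac_le mult_left_mono power_mono mult_nonneg_nonneg) auto
  then show "1 - 1 / (1 - \<bar>\<beta>\<bar>)\<^sup>2 * (1 - (norm w)\<^sup>2) \<le> (norm (blaschke \<beta> w))\<^sup>2"
    using norm_blaschke_squared[OF blaschke_denominator_nonzero'[OF assms, of w]] w
    by (simp add: algebra_simps diff_divide_distrib)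
qed

text \<open>The quotient has a removable singularity at the zero. On the circle of radius
  \<open>r\<close> it is bounded by \<open>M / sqrt (1 - c * (1 - r\<^sup>2))\<close>; the maximum
  principle carries this inside, and \<open>r\<close> tends to 1.\<close>

lemma divide_blaschke:
  assumes f: "f holomorphic_on ball 0 1" "\<And>w. norm w < 1 \<Longrightarrow> norm (f w) \<le> M"
    and \<beta>: "\<bar>\<beta>\<bar> < 1" "f (of_real \<beta>) = 0"
  obtains g where "g holomorphic_on ball 0 1" "\<And>w. norm w < 1 \<Longrightarrow> norm (g w) \<le> M"
    "\<And>w. norm w < 1 \<Longrightarrow> f w = blaschke \<beta> w * g w"
proof
  have M: "M \<ge> 0"
    using f(2)[of 0] by (rule order_trans[OF norm_ge_zero]) simp
  define q where "q = (\<lambda>w. if w = of_real \<beta> then deriv f (of_real \<beta>) else (f w - f (of_real \<beta>)) / (w - of_real \<beta>))"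
  define g where "g = (\<lambda>w. q w * (1 - of_real \<beta> * w))"
  have "q holomorphic_on ball 0 1"
    unfolding q_def using f(1) by (rule pole_lemma) (use \<beta> in simp)
  then show holg: "g holomorphic_on ball 0 1"
    unfolding g_def by (intro holomorphic_intros)
  have fg: "f w = blaschke \<beta> w * g w" if "norm w < 1" for w
    using blaschke_denominator_nonzero'[of \<beta> w] \<beta> that by (auto simp: g_def q_def blaschke_def)
  then show "\<And>w. norm w < 1 \<Longrightarrow> f w = blaschke \<beta> w * g w" .
  obtain c where c: "\<And>w. norm w < 1 \<Longrightarrow> 1 - c * (1 - (norm w)\<^sup>2) \<le> (norm (blaschke \<beta> w))\<^sup>2"
    using norm_blaschke_circle_ge[OF \<beta>(1)] by blast
  show "norm (g w) \<le> M" if w: "norm w < 1" for w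
  proof -
    have ev1: "\<forall>\<^sub>F r in at_left 1. norm w < r \<and> 0 < r \<and> r < 1"
      unfolding eventually_at_left_field using w
      by (intro exI[of _ "norm w"]) (auto intro: le_less_trans[OF norm_ge_zero])
    have lim: "((\<lambda>r. 1 - c * (1 - r\<^sup>2)) \<longlongrightarrow> 1 - c * (1 - 1\<^sup>2)) (at_left (1::real))"
      by (intro tendsto_intros)
    then have ev2: "\<forall>\<^sub>F r in at_left 1. 0 < 1 - c * (1 - r\<^sup>2)"
      by (intro order_tendstoD) auto
    have "\<forall>\<^sub>F r in at_left 1. norm (g w) \<le> M / sqrt (1 - c * (1 - r\<^sup>2))"
      using ev1 ev2
    proof eventually_elim
      case (elim r)
      show ?case
      proof (rule maximum_modulus_frontier[of g "cball 0 r"])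
        show "g holomorphic_on interior (cball 0 r)" "continuous_on (closure (cball 0 r)) g"
          using elim by (auto intro!: holomorphic_on_subset[OF holg] holomorphic_on_imp_continuous_on)
        fix z assume "z \<in> frontier (cball 0 r :: complex set)"
        then have z: "norm z = r"
          using elim by (simp add: frontier_cball)
        have b: "sqrt (1 - c * (1 - r\<^sup>2)) \<le> norm (blaschke \<beta> z)"
          using c[of z] z elim by (intro real_le_lsqrt) (auto simp: real_sqrt_le_iff)
        have "norm (g z) * sqrt (1 - c * (1 - r\<^sup>2)) \<le> norm (g z) * norm (blaschke \<beta> z)"
          using b by (intro mult_left_mono) auto
        also have "\<dots> \<le> M"
          using f(2)[of z] fg[of z] z elim by (simp add: norm_mult mult.commute)
        finally show "norm (g z) \<le> M / sqrt (1 - c * (1 - r\<^sup>2))"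
          using elim by (simp add: field_simps)
      qed (use elim in auto)
    qed
    moreover have "((\<lambda>r. M / sqrt (1 - c * (1 - r\<^sup>2))) \<longlongrightarrow> M / sqrt (1 - c * (1 - 1\<^sup>2))) (at_left (1::real))"
      by (intro tendsto_intros lim) auto
    ultimately have "norm (g w) \<le> M / sqrt (1 - c * (1 - 1\<^sup>2))"
      by (intro tendsto_lowerbound[of _ _ "at_left 1"]) auto
    then show ?thesis
      by simp
  qed
qed

lemma norm_le_prod_blaschke:
  assumes "f holomorphic_on ball 0 1" "\<And>w. norm w < 1 \<Longrightarrow> norm (f w) \<le> M"
    and "finite I" "inj_on \<beta> I" "\<And>k. k \<in> I \<Longrightarrow> \<bar>\<beta> k\<bar> < 1" "\<And>k. k \<in> I \<Longrightarrow> f (of_real (\<beta> k)) = 0"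
    and w: "norm w < 1"
  shows "norm (f w) \<le> M * (\<Prod>k\<in>I. norm (blaschke (\<beta> k) w))"
  using assms(3,1,2,4-6)
proof (induction I arbitrary: f)
  case empty
  then show ?case
    using w by simp
next
  case (insert i I)
  obtain g where g: "g holomorphic_on ball 0 1" "\<And>w. norm w < 1 \<Longrightarrow> norm (g w) \<le> M"
    "\<And>w. norm w < 1 \<Longrightarrow> f w = blaschke (\<beta> i) w * g w"
    using divide_blaschke[OF insert.prems(1,2), of "\<beta> i"] insert.prems by auto
  have "norm (g w) \<le> M * (\<Prod>k\<in>I. norm (blaschke (\<beta> k) w))"
  proof (rule insert.IH[OF g(1,2)])
    show "g (of_real (\<beta> k)) = 0" if "k \<in> I" for k
    proof -
      have "\<beta> k \<noteq> \<beta> i"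
        using that insert by (auto simp: inj_on_def)
      then have "blaschke (\<beta> i) (of_real (\<beta> k)) \<noteq> 0"
        using that insert.prems(4)[of i] insert.prems(4)[of k] by (subst blaschke_eq_0_iff) auto
      then show ?thesis
        using g(3)[of "of_real (\<beta> k)"] insert.prems(4)[of k] insert.prems(5)[of k] that by auto
    qed
  qed (use insert.prems in auto)
  then have "norm (blaschke (\<beta> i) w) * norm (g w) \<le> norm (blaschke (\<beta> i) w) * (M * (\<Prod>k\<in>I. norm (blaschke (\<beta> k) w)))"
    by (intro mult_left_mono) auto
  then show ?case
    using insert.hyps g(3)[OF w] by (simp add: norm_mult mult_ac)
qed

section \<open>Infinite Blaschke products with real zeros\<close>

locale blaschke_sequence =
  fixes \<beta> :: "nat \<Rightarrow> real"
  assumes \<beta>_less_1: "\<bar>\<beta> k\<bar> < 1" and \<beta>_nonzero: "\<beta> k \<noteq> 0"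
    and summable_\<beta>: "summable (\<lambda>k. 1 - \<bar>\<beta> k\<bar>)"
begin

text \<open>The sign makes \<open>factor k 0 = \<bar>\<beta> k\<bar>\<close> positive and lets the
  factors tend to 1, without which the product could not converge.\<close>

definition factor :: "nat \<Rightarrow> complex \<Rightarrow> complex"
  where "factor k w = - of_real (sgn (\<beta> k)) * blaschke (\<beta> k) w"

definition A :: "complex \<Rightarrow> complex"
  where "A w = (\<Prod>k. factor k w)"

lemma norm_factor: "norm (factor k w) = norm (blaschke (\<beta> k) w)"
  using \<beta>_nonzero[of k] by (simp add: factor_def norm_mult abs_sgn_eq)

lemma norm_factor_minus_1_le:
  assumes "norm w \<le> r" "r < 1"
  shows "norm (factor k w - 1) \<le> 2 / (1 - r) * (1 - \<bar>\<beta> k\<bar>)"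
proof -
  let ?s = "of_real (sgn (\<beta> k)) :: complex"
  have w1: "norm w \<le> 1"
    using assms by simp
  have d: "1 - of_real (\<beta> k) * w \<noteq> 0"
    by (rule blaschke_denominator_nonzero'[OF \<beta>_less_1 w1])
  have "factor k w - 1 = - (of_real (1 - \<bar>\<beta> k\<bar>) * (1 + ?s * w)) / (1 - of_real (\<beta> k) * w)"
  proof (cases "\<beta> k > 0")
    case True
    then show ?thesis
      using d by (simp add: factor_def blaschke_def divide_simps) (simp add: algebra_simps)
  next
    case False
    then have "\<beta> k < 0"
      using \<beta>_nonzero[of k] by simp
    then show ?thesis
      using d by (simp add: factor_def blaschke_def divide_simps) (simp add: algebra_simps)
  qed
  then have eq: "norm (factor k w - 1) = (1 - \<bar>\<beta> k\<bar>) * norm (1 + ?s * w) / norm (1 - of_real (\<beta> k) * w)"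
    using \<beta>_less_1[of k] by (simp add: norm_divide norm_mult del: of_real_diff)
  have "norm (1 + ?s * w) \<le> 1 + norm (?s * w)"
    using norm_triangle_ineq[of 1 "?s * w"] by simp
  also have "norm (?s * w) = norm w"
    using \<beta>_nonzero[of k] by (simp add: norm_mult abs_sgn_eq)
  finally have n: "norm (1 + ?s * w) \<le> 2"
    using w1 by simp
  have "1 - r \<le> 1 - \<bar>\<beta> k\<bar> * norm w"
    using mult_mono[of "\<bar>\<beta> k\<bar>" 1 "norm w" r] assms \<beta>_less_1[of k] by simp
  also have "\<dots> \<le> norm (1 - of_real (\<beta> k) * w)"
    using norm_triangle_ineq2[of 1 "of_real (\<beta> k) * w"] by (simp add: norm_mult)
  finally have "norm (factor k w - 1) \<le> (1 - \<bar>\<beta> k\<bar>) * 2 / (1 - r)"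
    unfolding eq using n assms \<beta>_less_1[of k] by (intro frac_le mult_left_mono mult_nonneg_nonneg) auto
  then show ?thesis
    by (simp add: mult.commute)
qed

lemma factor_holomorphic: "factor k holomorphic_on ball 0 1"
  unfolding factor_def
  by (intro holomorphic_intros blaschke_holomorphic blaschke_denominator_nonzero' \<beta>_less_1) auto

lemma convergent_prod_factor:
  assumes "norm w < 1"
  shows "convergent_prod (\<lambda>k. factor k w)"
proof -
  have "summable (\<lambda>k. norm (factor k w - 1))"
    by (rule summable_comparison_test'[OF summable_mult[OF summable_\<beta>, of "2 / (1 - norm w)"], of 0])
      (use norm_factor_minus_1_le[of w "norm w"] assms in auto)
  then show ?thesis
    by (intro abs_convergent_prod_imp_convergent_prod summable_imp_abs_convergent_prod)
qed

lemma A_LIMSEQ: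
  assumes "norm w < 1"
  shows "(\<lambda>N. \<Prod>k<N. factor k w) \<longlonglongrightarrow> A w"
  using convergent_prod_LIMSEQ[OF convergent_prod_factor[OF assms]]
  unfolding A_def LIMSEQ_lessThan_iff_atMost .

lemma A_eq_0_iff:
  assumes "norm w < 1"
  shows "A w = 0 \<longleftrightarrow> w \<in> range (\<lambda>k. of_real (\<beta> k))"
proof -
  have "(\<lambda>k. factor k w) has_prod A w"
    unfolding A_def by (rule convergent_prod_has_prod[OF convergent_prod_factor[OF assms]])
  then have "A w = 0 \<longleftrightarrow> (\<exists>k. factor k w = 0)"
    by (auto simp: has_prod_eq_0_iff)
  then show ?thesis
    using blaschke_eq_0_iff[OF \<beta>_less_1, of w] assms \<beta>_nonzero by (auto simp: factor_def sgn_zero_iff)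
qed

lemma A_holomorphic: "A holomorphic_on ball 0 1"
proof (rule holomorphic_uniform_sequence)
  show "(\<lambda>w. \<Prod>k<N. factor k w) holomorphic_on ball 0 1" for N
    by (intro holomorphic_intros factor_holomorphic)
  fix z :: complex assume z: "z \<in> ball 0 1"
  define d where "d = (1 - norm z) / 2"
  have d: "d > 0"
    using z by (simp add: d_def)
  have sub: "norm w \<le> 1 - d" if "w \<in> cball z d" for w
    using that norm_triangle_ineq2[of w z] by (simp add: d_def dist_norm norm_minus_commute field_simps)
  have "uniformly_convergent_on (cball z d) (\<lambda>N w. \<Prod>k<N. factor k w)"
  proof (rule uniformly_convergent_on_prod')
    show "continuous_on (cball z d) (factor k)" for k
    proof (intro holomorphic_on_imp_continuous_on holomorphic_on_subset[OF factor_holomorphic] subsetI)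
      show "w \<in> ball 0 1" if "w \<in> cball z d" for w
        using sub[OF that] d by simp
    qed
    show "uniformly_convergent_on (cball z d) (\<lambda>N w. \<Sum>k<N. norm (factor k w - 1))"
    proof (rule Weierstrass_m_test')
      show "norm (norm (factor k w - 1)) \<le> 2 / (1 - (1 - d)) * (1 - \<bar>\<beta> k\<bar>)" if "w \<in> cball z d" for k w
        using norm_factor_minus_1_le[OF sub[OF that]] d by simp
    qed (intro summable_mult summable_\<beta>)
  qed auto
  then obtain g where g: "uniform_limit (cball z d) (\<lambda>N w. \<Prod>k<N. factor k w) g sequentially"
    by (auto simp: uniformly_convergent_on_def)
  have "g w = A w" if "w \<in> cball z d" for w
    using tendsto_uniform_limitI[OF g that] A_LIMSEQ[of w] sub[OF that] d
    by (intro tendsto_unique[of sequentially]) auto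
  then have "uniform_limit (cball z d) (\<lambda>N w. \<Prod>k<N. factor k w) A sequentially"
    using g by (subst uniform_limit_cong'[of _ _ _ A g]) auto
  then show "\<exists>d>0. cball z d \<subseteq> ball 0 1 \<and> uniform_limit (cball z d) (\<lambda>N w. \<Prod>k<N. factor k w) A sequentially"
  proof (intro exI[of _ d] conjI subsetI)
    show "w \<in> ball 0 1" if "w \<in> cball z d" for w
      using sub[OF that] d by simp
  qed (use d in auto)
qed auto


text \<open>Omitted factors have modulus at most 1. This provides one lower bound for all finite
  subproducts, as needed when the retained set of zeros varies with \<open>n\<close>.\<close>

lemma norm_A_le:
  assumes "norm w < 1" "finite I"
  shows "norm (A w) \<le> (\<Prod>k\<in>I. norm (blaschke (\<beta> k) w))"
proof -
  obtain N0 where N0: "I \<subseteq> {..<N0}"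
    using assms(2) finite_nat_iff_bounded by blast
  have b1: "norm (blaschke (\<beta> k) w) \<le> 1" for k
    using norm_blaschke_le_1[OF \<beta>_less_1] assms(1) by simp
  have "norm (\<Prod>k<N. factor k w) \<le> (\<Prod>k\<in>I. norm (blaschke (\<beta> k) w))" if "N \<ge> N0" for N
  proof -
    have "norm (\<Prod>k<N. factor k w) = (\<Prod>k<N. norm (blaschke (\<beta> k) w))"
      by (simp add: prod_norm[symmetric] norm_factor)
    also have "\<dots> = (\<Prod>k\<in>{..<N} - I. norm (blaschke (\<beta> k) w)) * (\<Prod>k\<in>I. norm (blaschke (\<beta> k) w))"
      using N0 that by (intro prod.subset_diff) auto
    also have "\<dots> \<le> 1 * (\<Prod>k\<in>I. norm (blaschke (\<beta> k) w))"
      using b1 by (intro mult_right_mono prod_le_1 prod_nonneg) auto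
    finally show ?thesis
      by simp
  qed
  then show ?thesis
    using tendsto_norm[OF A_LIMSEQ[OF assms(1)]] by (intro LIMSEQ_le_const2) auto
qed

lemma norm_le_norm_A:
  assumes f: "f holomorphic_on ball 0 1" "\<And>w. norm w < 1 \<Longrightarrow> norm (f w) \<le> M"
    and "inj \<beta>" "\<And>k. f (of_real (\<beta> k)) = 0" and w: "norm w < 1"
  shows "norm (f w) \<le> M * norm (A w)"
proof -
  have "norm (f w) \<le> M * norm (\<Prod>k<N. factor k w)" for N
    using norm_le_prod_blaschke[OF f, where I = "{..<N}" and \<beta> = \<beta>] assms \<beta>_less_1
    by (simp add: prod_norm[symmetric] norm_factor inj_on_subset)
  moreover have "(\<lambda>N. M * norm (\<Prod>k<N. factor k w)) \<longlonglongrightarrow> M * norm (A w)"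
    by (intro tendsto_intros A_LIMSEQ w)
  ultimately show ?thesis
    by (intro LIMSEQ_le_const) auto
qed

text \<open>Removing a countable set from the disk leaves it connected, so the maximum principle
  applies to quotients by \<open>A\<close>.\<close>

lemma A_nonzero_set:
  shows "open {w. norm w < 1 \<and> A w \<noteq> 0}" "connected {w. norm w < 1 \<and> A w \<noteq> 0}"
proof -
  have eq: "{w. norm w < 1 \<and> A w \<noteq> 0} = ball 0 1 \<inter> A -` (- {0})"
    by auto
  show "open {w. norm w < 1 \<and> A w \<noteq> 0}"
    unfolding eq using holomorphic_on_imp_continuous_on[OF A_holomorphic]
    by (intro continuous_open_preimage) auto
  have eq': "{w. norm w < 1 \<and> A w \<noteq> 0} = ball 0 1 - range (\<lambda>k. of_real (\<beta> k))"
    using A_eq_0_iff by auto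
  show "connected {w. norm w < 1 \<and> A w \<noteq> 0}"
    unfolding eq' by (intro connected_open_diff_countable) auto
qed

text \<open>By \<open>norm_le_norm_A\<close> the quotient \<open>f / A\<close> is bounded by
  \<open>M\<close> wherever \<open>A\<close> does not vanish, and it reaches \<open>M\<close> at
  \<open>v\<close>, so it is constant there. At the zeros of \<open>A\<close> the same bound forces
  \<open>f\<close> to vanish.\<close>

lemma eq_multiple_of_A:
  assumes f: "f holomorphic_on ball 0 1" "\<And>w. norm w < 1 \<Longrightarrow> norm (f w) \<le> M"
    and inj: "inj \<beta>" and zeros: "\<And>k. f (of_real (\<beta> k)) = 0"
    and v: "norm v < 1" "A v \<noteq> 0" "norm (f v) \<ge> M * norm (A v)"
    and w: "norm w < 1"
  shows "f w = f v / A v * A w"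
proof -
  let ?S = "{w. norm w < 1 \<and> A w \<noteq> 0}"
  have le: "norm (f z) \<le> M * norm (A z)" if "norm z < 1" for z
    using norm_le_norm_A[OF f(1) _ inj zeros that, of M] f(2) by blast
  have "(\<lambda>w. f w / A w) constant_on ?S"
  proof (rule maximum_modulus_principle[where U = ?S and \<xi> = v])
    show "(\<lambda>w. f w / A w) holomorphic_on ?S"
      by (intro holomorphic_intros holomorphic_on_subset[OF f(1)] holomorphic_on_subset[OF A_holomorphic]) auto
    show "norm (f z / A z) \<le> norm (f v / A v)" if "z \<in> ?S" for z
    proof -
      have "norm (f z / A z) \<le> M"
        using le[of z] that by (simp add: norm_divide field_simps)
      also have "M \<le> norm (f v / A v)"
        using v by (simp add: norm_divide field_simps)
      finally show ?thesis .
    qed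
  qed (use A_nonzero_set v in auto)
  then have "f w / A w = f v / A v" if "A w \<noteq> 0"
    using v w that unfolding constant_on_def by (metis (mono_tags, lifting) mem_Collect_eq)
  then show ?thesis
    using le[OF w] by (cases "A w = 0") (auto simp: field_simps)
qed

end

subsection \<open>Competitors for the extremal problem\<close>

fun cheb_poly :: "nat \<Rightarrow> complex poly" where
  "cheb_poly 0 = 1"
| "cheb_poly (Suc 0) = [:0, 1:]"
| "cheb_poly (Suc (Suc n)) = [:0, 2:] * cheb_poly (Suc n) - cheb_poly n"

lemma poly_cheb_joukowski:
  assumes "w \<noteq> 0"
  shows "poly (cheb_poly n) (joukowski w) = (w ^ n + (1 / w) ^ n) / 2"
proof (induction n rule: cheb_poly.induct)
  case (3 n)
  define v where "v = 1 / w"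
  have e: "2 * joukowski w = w + v" and wv: "w * v = 1"
    using assms by (simp_all add: joukowski_def v_def)
  have "poly (cheb_poly (Suc (Suc n))) (joukowski w)
      = (2 * joukowski w) * poly (cheb_poly (Suc n)) (joukowski w) - poly (cheb_poly n) (joukowski w)"
    by simp
  also have "\<dots> = (w + v) * ((w ^ Suc n + v ^ Suc n) / 2) - (w ^ n + v ^ n) / 2"
    unfolding 3 e by (simp only: v_def)
  also have "\<dots> = (w ^ Suc (Suc n) + (w * v) * v ^ n + (w * v) * w ^ n + v ^ Suc (Suc n)) / 2 - (w ^ n + v ^ n) / 2"
    by (simp add: algebra_simps add_divide_distrib)
  also have "\<dots> = (w ^ Suc (Suc n) + v ^ Suc (Suc n)) / 2"
    unfolding wv by (simp add: add_divide_distrib)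
  finally show ?case
    by (simp only: v_def)
qed (auto simp: joukowski_def)

lemma degree_cheb_poly: "degree (cheb_poly n) \<le> n"
proof (induction n rule: cheb_poly.induct)
  case (3 n)
  have "degree ([:0, 2:] * cheb_poly (Suc n)) \<le> 1 + Suc n"
    using 3 by (intro order_trans[OF degree_mult_le] add_mono) auto
  then show ?case
    using 3 by (simp only: cheb_poly.simps) (intro degree_diff_le, auto)
qed auto

lemma coeff_cheb_poly: "coeff (cheb_poly (Suc n)) (Suc n) = 2 ^ n"
proof (induction n)
  case (Suc n)
  have "coeff (cheb_poly n) (Suc (Suc n)) = 0"
    using degree_cheb_poly[of n] by (intro coeff_eq_0) simp
  then show ?case
    using Suc by (simp add: coeff_pCons)
qed simp

text \<open>A Chebyshev expansion for the interval from \<open>- \<tau>\<close> to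
  \<open>\<tau>\<close> with reversed indices: \<open>c j\<close> goes with degree
  \<open>n - j\<close>. In the coordinate \<open>w\<close> this produces \<open>w ^ n\<close> in the
  denominator under the Taylor polynomial with coefficients \<open>c\<close>, and \<open>c 0\<close>
  governs the coefficient of degree \<open>n\<close>.\<close>

definition dilated_cheb_sum :: "nat \<Rightarrow> real \<Rightarrow> (nat \<Rightarrow> complex) \<Rightarrow> complex poly"
  where "dilated_cheb_sum n \<tau> c = (\<Sum>j\<le>n. smult (c j) (pcompose (cheb_poly (n - j)) [:0, of_real (1 / \<tau>):]))"

lemma poly_dilated_cheb_sum:
  assumes "\<tau> > 0" "w \<noteq> 0"
  shows "w ^ n * poly (dilated_cheb_sum n \<tau> c) (of_real \<tau> * joukowski w)
    = ((\<Sum>j\<le>n. c j * w ^ j) + w ^ n * (\<Sum>j\<le>n. c j * w ^ (n - j))) / 2" (is ?A)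
    and "poly (dilated_cheb_sum n \<tau> c) (of_real \<tau> * joukowski w)
    = ((\<Sum>j\<le>n. c j * w ^ j) / w ^ n + (\<Sum>j\<le>n. c j * w ^ (n - j))) / 2" (is "?p = ?r")
proof -
  have "w ^ n * poly (dilated_cheb_sum n \<tau> c) (of_real \<tau> * joukowski w)
      = (\<Sum>j\<le>n. w ^ n * (c j * ((w ^ (n - j) + (1 / w) ^ (n - j)) / 2)))"
    using assms by (simp add: dilated_cheb_sum_def poly_sum poly_pcompose poly_cheb_joukowski sum_distrib_left)
  also have "\<dots> = (\<Sum>j\<le>n. (c j * w ^ j + w ^ n * (c j * w ^ (n - j))) / 2)"
  proof (rule sum.cong)
    fix j assume "j \<in> {..n}"
    then have "w ^ n = w ^ j * w ^ (n - j)"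
      by (simp flip: power_add)
    then have "w ^ n * (1 / w) ^ (n - j) = w ^ j"
      using assms(2) by (simp add: power_one_over)
    then show "w ^ n * (c j * ((w ^ (n - j) + (1 / w) ^ (n - j)) / 2)) = (c j * w ^ j + w ^ n * (c j * w ^ (n - j))) / 2"
      by (simp add: algebra_simps add_divide_distrib)
  qed simp
  also have "\<dots> = ((\<Sum>j\<le>n. c j * w ^ j) + w ^ n * (\<Sum>j\<le>n. c j * w ^ (n - j))) / 2"
    by (simp add: sum.distrib sum_distrib_left flip: sum_divide_distrib)
  finally show A: ?A .
  have "w ^ n \<noteq> 0"
    using assms by simp
  then have "?p = (w ^ n * ?p) / w ^ n"
    by simp
  also have "\<dots> = ?r"
    unfolding A using \<open>w ^ n \<noteq> 0\<close> by (simp add: field_simps)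
  finally show "?p = ?r" .
qed

lemma degree_pcompose_cheb: "degree (pcompose (cheb_poly m) [:0, c:]) \<le> m"
  using degree_pcompose_le[of "cheb_poly m" "[:0, c:]"] degree_cheb_poly[of m]
  by (auto split: if_splits)

lemma degree_dilated_cheb_sum: "degree (dilated_cheb_sum n \<tau> c) \<le> n"
  unfolding dilated_cheb_sum_def
  by (intro degree_sum_le order_trans[OF degree_smult_le] order_trans[OF degree_pcompose_cheb]) auto

lemma coeff_pcompose_linear:
  fixes p :: "'a::comm_semiring_1 poly"
  shows "coeff (pcompose p [:0, c:]) m = c ^ m * coeff p m"
proof (induction p arbitrary: m)
  case (pCons a p)
  then show ?case
    by (cases m) (simp_all add: pcompose_pCons coeff_pCons mult.assoc)
qed simp

text \<open>Only \<open>j = 0\<close> reaches degree \<open>n\<close>, with leading coefficient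
  \<open>2 ^ (n - 1)\<close>. For \<open>n = 0\<close> the factor 1/2 would be missing, since
  \<open>cheb_poly 0\<close> is 1.\<close>

lemma coeff_dilated_cheb_sum:
  assumes "n > 0"
  shows "coeff (dilated_cheb_sum n \<tau> c) n / 2 ^ n = c 0 / (2 * of_real \<tau> ^ n)"
proof -
  have "coeff (dilated_cheb_sum n \<tau> c) n = (\<Sum>j\<le>n. if j = 0 then c 0 * (of_real (1 / \<tau>) ^ n * 2 ^ (n - 1)) else 0)"
    unfolding dilated_cheb_sum_def coeff_sum
  proof (rule sum.cong)
    fix j assume "j \<in> {..n}"
    show "coeff (smult (c j) (pcompose (cheb_poly (n - j)) [:0, of_real (1 / \<tau>):])) n
      = (if j = 0 then c 0 * (of_real (1 / \<tau>) ^ n * 2 ^ (n - 1)) else 0)"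
    proof (cases "j = 0")
      case True
      then show ?thesis
        using coeff_cheb_poly[of "n - 1"] assms by (simp add: coeff_pcompose_linear)
    next
      case False
      then have "coeff (cheb_poly (n - j)) n = 0"
        using degree_cheb_poly[of "n - j"] assms by (intro coeff_eq_0) simp
      then show ?thesis
        using False by (simp add: coeff_pcompose_linear)
    qed
  qed simp
  then show ?thesis
    using assms by (cases n) (simp_all add: power_divide field_simps)
qed

text \<open>Cauchy estimates on the circle of radius \<open>R\<close> bound the coefficients by
  \<open>M / R ^ j\<close>. All discarded powers exceed \<open>n\<close>, so
  \<open>norm w ^ n\<close> can be taken out before summing the geometric series.\<close>

lemma taylor_truncation:
  assumes f: "f holomorphic_on ball 0 R" "continuous_on (cball 0 R) f" and R: "R > 1"
    and M: "\<And>z. norm z = R \<Longrightarrow> norm (f z) \<le> M"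
  obtains c :: "nat \<Rightarrow> complex"
  where "\<And>w. norm w \<le> 1 \<Longrightarrow> norm (f w - (\<Sum>j\<le>n. c j * w ^ j)) \<le> norm w ^ n * (M / (R ^ n * (R - 1)))"
proof
  define c where "c = (\<lambda>j. (deriv ^^ j) f 0 / fact j)"
  have c: "norm (c j) \<le> M / R ^ j" for j
  proof -
    have "norm ((deriv ^^ j) f 0) \<le> fact j * M / R ^ j"
      using f R M by (intro Cauchy_inequality) auto
    then show ?thesis
      by (simp add: c_def norm_divide field_simps)
  qed
  show "norm (f w - (\<Sum>j\<le>n. c j * w ^ j)) \<le> norm w ^ n * (M / (R ^ n * (R - 1)))" if w: "norm w \<le> 1" for w
  proof -
    have "(\<lambda>j. c j * w ^ j) sums f w"
      using holomorphic_power_series[OF f(1), of w] w R by (simp add: c_def)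
    then have s: "(\<lambda>j. c (j + Suc n) * w ^ (j + Suc n)) sums (f w - (\<Sum>j<Suc n. c j * w ^ j))"
      by (rule sums_split_initial_segment)
    have geo: "(\<lambda>j. norm w ^ n * (M / R ^ Suc n) * (1 / R) ^ j) sums (norm w ^ n * (M / R ^ Suc n) * (1 / (1 - 1 / R)))"
      using R by (intro sums_mult geometric_sums) auto
    have M0: "M \<ge> 0"
      using M[of "of_real R"] R by (intro order_trans[OF norm_ge_zero]) auto
    have "norm (f w - (\<Sum>j<Suc n. c j * w ^ j)) = norm (\<Sum>j. c (j + Suc n) * w ^ (j + Suc n))"
      using sums_unique[OF s] by simp
    also have "\<dots> \<le> (\<Sum>j. norm w ^ n * (M / R ^ Suc n) * (1 / R) ^ j)"
    proof (rule norm_suminf_le)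
      show "norm (c (j + Suc n) * w ^ (j + Suc n)) \<le> norm w ^ n * (M / R ^ Suc n) * (1 / R) ^ j" for j
      proof -
        have "norm (c (j + Suc n) * w ^ (j + Suc n)) \<le> M / R ^ (j + Suc n) * norm w ^ (j + Suc n)"
          unfolding norm_mult norm_power by (intro mult_right_mono c) auto
        also have "\<dots> \<le> M / R ^ (j + Suc n) * norm w ^ n"
          using w M0 R by (intro mult_left_mono power_decreasing) auto
        finally show ?thesis
          by (simp add: power_add power_one_over field_simps)
      qed
    qed (use geo sums_summable in blast)
    also have "\<dots> = norm w ^ n * (M / R ^ Suc n) * (1 / (1 - 1 / R))"
      using geo by (simp add: sums_iff)
    also have "\<dots> = norm w ^ n * (M / (R ^ n * (R - 1)))"
      using R by (simp add: field_simps)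
    finally show ?thesis
      by (simp only: lessThan_Suc_atMost)
  qed
qed

text \<open>On the unit circle the reversed sum is \<open>z ^ n\<close> times the original one at
  \<open>1 / z\<close>; the maximum principle does the rest.\<close>

lemma norm_reversed_poly_le:
  fixes c :: "nat \<Rightarrow> complex"
  assumes S: "\<And>w. norm w = 1 \<Longrightarrow> norm (\<Sum>j\<le>n. c j * w ^ j) \<le> B" and w: "norm w \<le> 1"
  shows "norm (\<Sum>j\<le>n. c j * w ^ (n - j)) \<le> B"
proof (rule maximum_modulus_frontier[of "\<lambda>w. \<Sum>j\<le>n. c j * w ^ (n - j)" "cball 0 1"])
  fix z :: complex assume "z \<in> frontier (cball 0 1)"
  then have z: "norm z = 1"
    by (simp add: frontier_cball)
  have "(\<Sum>j\<le>n. c j * z ^ (n - j)) = z ^ n * (\<Sum>j\<le>n. c j * (1 / z) ^ j)"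
    unfolding sum_distrib_left
  proof (rule sum.cong)
    fix j assume "j \<in> {..n}"
    then have "z ^ n = z ^ (n - j) * z ^ j"
      by (simp flip: power_add)
    moreover have "z \<noteq> 0"
      using z by auto
    ultimately show "c j * z ^ (n - j) = z ^ n * (c j * (1 / z) ^ j)"
      by (simp add: power_one_over)
  qed simp
  then show "norm (\<Sum>j\<le>n. c j * z ^ (n - j)) \<le> B"
    using S[of "1 / z"] z by (simp add: norm_mult norm_power norm_divide)
qed (use w in \<open>auto intro!: holomorphic_intros continuous_intros\<close>)

text \<open>With \<open>d = 1 - \<bar>\<beta>\<bar>\<close> the denominator is still at least
  \<open>d / 2\<close>, so the squared modulus is at most \<open>1 + 3 * \<rho> * 2 * d / (d /
  2)\<^sup>2 = 1 + 24 * \<rho> / d\<close>. Taking the square root turns 24 into 12.\<close>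

lemma norm_blaschke_outside_le:
  assumes \<beta>: "\<bar>\<beta>\<bar> < 1" and \<rho>: "0 < \<rho>" "\<rho> \<le> 1" "\<rho> \<le> (1 - \<bar>\<beta>\<bar>) / 2" and w: "norm w = 1 + \<rho>"
  shows "norm (blaschke \<beta> w) \<le> exp (12 * \<rho> / (1 - \<bar>\<beta>\<bar>))"
    and "\<bar>\<beta>\<bar> * (1 + \<rho>) < 1"
proof -
  define d where "d = 1 - \<bar>\<beta>\<bar>"
  have d: "0 < d" "d \<le> 1" "\<rho> \<le> d / 2" "\<bar>\<beta>\<bar> = 1 - d"
    using \<beta> \<rho> by (auto simp: d_def)
  have "\<bar>\<beta>\<bar> * (1 + \<rho>) = 1 - d + \<rho> - d * \<rho>"
    unfolding d(4) by (simp add: algebra_simps)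
  then have prod: "\<bar>\<beta>\<bar> * (1 + \<rho>) \<le> 1 - d / 2"
    using d \<rho> mult_pos_pos[of d \<rho>] by linarith
  then show lt: "\<bar>\<beta>\<bar> * (1 + \<rho>) < 1"
    using d by linarith
  have "1 - norm (of_real \<beta> * w) \<le> norm (1 - of_real \<beta> * w)"
    using norm_triangle_ineq2[of 1 "of_real \<beta> * w"] by simp
  then have le: "d / 2 \<le> norm (1 - of_real \<beta> * w)"
    using prod by (simp add: norm_mult w)
  have "1 - \<beta>\<^sup>2 = (1 - \<bar>\<beta>\<bar>) * (1 + \<bar>\<beta>\<bar>)"
    by (simp add: algebra_simps flip: power2_eq_square)
  also have "\<dots> \<le> d * 2"
    unfolding d_def using \<beta> by (intro mult_left_mono) auto
  finally have b2: "1 - \<beta>\<^sup>2 \<le> 2 * d"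
    by simp
  have b2': "0 \<le> 1 - \<beta>\<^sup>2"
    using \<beta> by (simp add: abs_square_le_1)
  have R2: "(1 + \<rho>)\<^sup>2 - 1 \<le> 3 * \<rho>" "0 \<le> (1 + \<rho>)\<^sup>2 - 1"
    using \<rho> by (simp_all add: power2_eq_square algebra_simps)
  have "((norm w)\<^sup>2 - 1) * (1 - \<beta>\<^sup>2) / (norm (1 - of_real \<beta> * w))\<^sup>2 \<le> (3 * \<rho>) * (2 * d) / (d / 2)\<^sup>2"
    unfolding w using le d b2 b2' R2 \<rho> by (intro frac_le mult_mono power_mono) auto
  also have "\<dots> = 24 * \<rho> / d"
    using d by (simp add: power2_eq_square field_simps)
  finally have "(norm (blaschke \<beta> w))\<^sup>2 \<le> 1 + 24 * \<rho> / d"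
    using norm_blaschke_squared[OF blaschke_denominator_nonzero, of \<beta> w] lt w by simp
  also have "\<dots> \<le> exp (24 * \<rho> / d)"
    by (rule exp_ge_add_one_self)
  also have "\<dots> = (exp (12 * \<rho> / d))\<^sup>2"
    by (simp flip: exp_of_nat_mult)
  finally show "norm (blaschke \<beta> w) \<le> exp (12 * \<rho> / (1 - \<bar>\<beta>\<bar>))"
    unfolding d_def by (rule power2_le_imp_le) simp
qed

section \<open>The Joukowski map on the real line and dilations\<close>

lemma abs_joukowski: "\<bar>joukowski (w :: real)\<bar> = joukowski \<bar>w\<bar>"
proof -
  have nn: "\<bar>joukowski v\<bar> = joukowski v" if "v \<ge> 0" for v :: real
    using that by (simp add: joukowski_def)
  show ?thesis
  proof (cases "w \<ge> 0")
    case True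
    then show ?thesis
      using nn[of w] by simp
  next
    case False
    have "\<bar>joukowski w\<bar> = \<bar>joukowski (- w)\<bar>"
      by (simp add: joukowski_minus)
    also have "\<dots> = joukowski (- w)"
      using False by (intro nn) simp
    finally show ?thesis
      using False by simp
  qed
qed

lemma joukowski_diff:
  fixes s t :: "'a::field_char_0"
  assumes "s \<noteq> 0" "t \<noteq> 0"
  shows "joukowski s - joukowski t = (t - s) * (1 - s * t) / (2 * s * t)"
  using assms by (simp add: joukowski_def field_simps)

lemma joukowski_le_iff:
  fixes s t :: real
  assumes "0 < s" "s < 1" "0 < t" "t < 1"
  shows "joukowski s \<le> joukowski t \<longleftrightarrow> t \<le> s"
proof -
  have "s * t < 1"
    using assms mult_strict_mono[of s 1 t 1] by simp
  then have "joukowski s - joukowski t \<le> 0 \<longleftrightarrow> t - s \<le> 0"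
    using assms by (subst joukowski_diff) (auto simp: divide_le_0_iff mult_le_0_iff)
  then show ?thesis
    by simp
qed

lemma joukowski_inj:
  fixes s t :: real
  assumes "joukowski s = joukowski t" "\<bar>s\<bar> < 1" "\<bar>t\<bar> < 1" "s \<noteq> 0" "t \<noteq> 0"
  shows "s = t"
proof -
  have "\<bar>s * t\<bar> < 1"
    using assms mult_strict_mono[of "\<bar>s\<bar>" 1 "\<bar>t\<bar>" 1] by (simp add: abs_mult)
  then have "s * t \<noteq> 1"
    by auto
  then show ?thesis
    using joukowski_diff[of s t] assms by simp
qed

text \<open>The map is quadratic at its critical points 1 and -1. This is where the square root of
  the distance in the summability condition comes from.\<close>

lemma abs_joukowski_minus_1:
  fixes b :: real
  assumes "b \<noteq> 0"
  shows "\<bar>joukowski b\<bar> - 1 = (1 - \<bar>b\<bar>)\<^sup>2 / (2 * \<bar>b\<bar>)"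
  unfolding abs_joukowski using assms by (simp add: joukowski_def power2_eq_square field_simps)

lemma abs_joukowski_gt_1:
  fixes b :: real
  assumes "b \<noteq> 0" "\<bar>b\<bar> < 1"
  shows "\<bar>joukowski b\<bar> > 1"
proof -
  have "(1 - \<bar>b\<bar>)\<^sup>2 / (2 * \<bar>b\<bar>) > 0"
    using assms by (intro divide_pos_pos) auto
  then show ?thesis
    using abs_joukowski_minus_1[OF assms(1)] by simp
qed

lemma exists_joukowski_preimage:
  fixes v :: real
  assumes "\<bar>v\<bar> > 1"
  obtains b where "\<bar>b\<bar> < 1" "b \<noteq> 0" "joukowski b = v"
proof -
  have pos: "\<exists>b. 0 < b \<and> b < 1 \<and> joukowski b = v" if "v > 1" for v :: real
  proof -
    define s where "s = sqrt (v\<^sup>2 - 1)"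
    have v2: "v\<^sup>2 > 1"
      using that by simp
    have s2: "s * s = v * v - 1"
      using v2 by (simp add: s_def power2_eq_square)
    have s0: "s > 0"
      using v2 by (simp add: s_def)
    have "s < v"
    proof (rule power_less_imp_less_base)
      show "s ^ 2 < v ^ 2"
        unfolding power2_eq_square using s2 by linarith
    qed (use that in simp)
    have prod: "(v - s) * (v + s) = 1"
      using s2 by (simp add: algebra_simps)
    then have inv: "1 / (v - s) = v + s"
      using \<open>s < v\<close> by (simp add: field_simps)
    have "v + s > 1"
      using s0 that by linarith
    then have "v - s < 1"
      using inv \<open>s < v\<close> less_divide_eq_1_pos[of "v - s" 1] by simp
    then show ?thesis
      using \<open>s < v\<close> inv by (intro exI[of _ "v - s"]) (simp add: joukowski_def)
  qed
  show ?thesis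
  proof (cases "v > 1")
    case True
    then obtain b where "0 < b" "b < 1" "joukowski b = v"
      using pos[of v] by auto
    then show ?thesis
      by (intro that[of b]) auto
  next
    case False
    then have "- v > 1"
      using assms by auto
    then obtain b where "0 < b" "b < 1" "joukowski b = - v"
      using pos[of "- v"] by auto
    then show ?thesis
      by (intro that[of "- b"]) (auto simp: joukowski_minus)
  qed
qed

text \<open>The minimum with 1/2 is for points far away, where \<open>joukowski b\<close> is
  unbounded but \<open>1 - \<bar>b\<bar>\<close> stays below 1.\<close>

lemma abs_joukowski_preimage_le:
  fixes b :: real
  assumes "\<bar>b\<bar> < 1" "b \<noteq> 0"
  shows "1 - \<bar>b\<bar> \<le> sqrt 2 * sqrt (\<bar>joukowski b\<bar> - 1)"
    and "min (1/2) (sqrt (\<bar>joukowski b\<bar> - 1)) \<le> 1 - \<bar>b\<bar>"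
proof -
  have e: "(1 - \<bar>b\<bar>)\<^sup>2 = 2 * \<bar>b\<bar> * (\<bar>joukowski b\<bar> - 1)"
    using assms by (subst abs_joukowski_minus_1) auto
  have pos: "\<bar>joukowski b\<bar> - 1 > 0"
    using abs_joukowski_gt_1[OF assms(2,1)] by simp
  have "(1 - \<bar>b\<bar>)\<^sup>2 \<le> 2 * (\<bar>joukowski b\<bar> - 1)"
    unfolding e using assms pos by (intro mult_right_mono) auto
  then show "1 - \<bar>b\<bar> \<le> sqrt 2 * sqrt (\<bar>joukowski b\<bar> - 1)"
    unfolding real_sqrt_mult[symmetric] by (rule real_le_rsqrt)
  show "min (1/2) (sqrt (\<bar>joukowski b\<bar> - 1)) \<le> 1 - \<bar>b\<bar>"
  proof (cases "\<bar>b\<bar> \<ge> 1/2")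
    case True
    have "1 * (\<bar>joukowski b\<bar> - 1) \<le> (1 - \<bar>b\<bar>)\<^sup>2"
      unfolding e using True pos by (intro mult_right_mono) auto
    then have "sqrt (\<bar>joukowski b\<bar> - 1) \<le> 1 - \<bar>b\<bar>"
      using assms by (intro real_le_lsqrt) auto
    then show ?thesis
      by simp
  qed auto
qed

text \<open>
  For real arguments the Joukowski map turns the pseudohyperbolic distance into a rational
  expression, from which its monotonicity under dilation of the interval can be read off.
\<close>

definition pseudohyp :: "real \<Rightarrow> real \<Rightarrow> real"
  where "pseudohyp b c = \<bar>(c - b) / (1 - b * c)\<bar>"

lemma norm_blaschke_of_real: "norm (blaschke b (of_real c)) = pseudohyp b c"
proof -
  have "blaschke b (of_real c) = of_real ((c - b) / (1 - b * c))"
    by (simp add: blaschke_def)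
  then show ?thesis
    by (simp only: norm_of_real pseudohyp_def)
qed

text \<open>With \<open>p = c - b\<close> and \<open>q = 1 - b * c\<close> both sides equal
  \<open>(p\<^sup>2 + q\<^sup>2) / (2 * \<bar>p * q\<bar>)\<close>.\<close>

lemma joukowski_pseudohyp:
  assumes "\<bar>b\<bar> < 1" "\<bar>c\<bar> < 1" "b \<noteq> 0" "c \<noteq> 0" "b \<noteq> c"
  shows "joukowski (pseudohyp b c) = \<bar>joukowski b * joukowski c - 1\<bar> / \<bar>joukowski b - joukowski c\<bar>"
proof -
  have "\<bar>b * c\<bar> < 1"
    using assms mult_strict_mono[of "\<bar>b\<bar>" 1 "\<bar>c\<bar>" 1] by (simp add: abs_mult)
  then have d: "1 - b * c \<noteq> 0"
    by auto
  have m: "joukowski b * joukowski c - 1 = ((c - b)\<^sup>2 + (1 - b * c)\<^sup>2) / (4 * b * c)"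
    using assms by (simp add: joukowski_def power2_eq_square field_simps)
  have "joukowski ((c - b) / (1 - b * c)) = ((c - b)\<^sup>2 + (1 - b * c)\<^sup>2) / (2 * ((c - b) * (1 - b * c)))"
    using joukowski_divide[of "c - b" "1 - b * c"] assms d by (simp add: power2_eq_square)
  also have "\<dots> = (joukowski b * joukowski c - 1) / (joukowski b - joukowski c)"
    unfolding m using assms d by (subst joukowski_diff) (simp_all add: divide_simps, simp add: algebra_simps)
  finally show ?thesis
    unfolding pseudohyp_def abs_joukowski[symmetric] by (simp add: abs_divide)
qed

text \<open>An instance of the Schwarz-Pick principle: \<open>b'\<close> and \<open>c'\<close> are
  the coordinates of the same two points relative to the smaller domain outside the dilated
  interval. As \<open>joukowski\<close> decreases between 0 and 1, the claim becomes
  \<open>key\<close>, that is,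
  \<open>(\<tau> - 1) * (\<tau> * \<bar>X * Y\<bar> + 1) \<ge> 0\<close> for positive
  \<open>X * Y\<close> and the same with \<open>- 1\<close> in the second factor for negative
  \<open>X * Y\<close>.\<close>

lemma pseudohyp_mono_dilation:
  assumes b: "\<bar>b\<bar> < 1" "b \<noteq> 0" and c: "\<bar>c\<bar> < 1" "c \<noteq> 0" and b': "\<bar>b'\<bar> < 1" "b' \<noteq> 0" and c': "\<bar>c'\<bar> < 1" "c' \<noteq> 0"
    and \<tau>: "\<tau> \<ge> 1" and Jb: "joukowski b = \<tau> * joukowski b'" and Jc: "joukowski c = \<tau> * joukowski c'"
  shows "pseudohyp b c \<le> pseudohyp b' c'"
proof (cases "b = c")
  case True
  then show ?thesis
    by (simp add: pseudohyp_def)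
next
  case False
  then have ne: "joukowski b \<noteq> joukowski c"
    using joukowski_inj b c by blast
  then have ne': "b' \<noteq> c'"
    using Jb Jc by auto
  define X Y where "X = joukowski b'" and "Y = joukowski c'"
  have XY: "\<bar>X\<bar> > 1" "\<bar>Y\<bar> > 1"
    using abs_joukowski_gt_1 b' c' by (auto simp: X_def Y_def)
  then have a1: "\<bar>X * Y\<bar> > 1"
    unfolding abs_mult using mult_strict_mono[of 1 "\<bar>X\<bar>" 1 "\<bar>Y\<bar>"] by simp
  have key: "\<tau> * \<bar>X * Y - 1\<bar> \<le> \<bar>\<tau> * X * (\<tau> * Y) - 1\<bar>"
  proof (cases "X * Y > 0")
    case True
    then have "X * Y > 1"
      using a1 by simp
    have "0 \<le> \<tau> * (X * Y)"
      using \<open>X * Y > 0\<close> \<tau> by (intro mult_nonneg_nonneg[of \<tau> "X * Y"]) auto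
    then have "0 \<le> (\<tau> - 1) * (\<tau> * (X * Y) + 1)"
      using \<tau> by (intro mult_nonneg_nonneg[of "\<tau> - 1" "\<tau> * (X * Y) + 1"]) linarith+
    then have le: "\<tau> * (X * Y - 1) \<le> \<tau> * X * (\<tau> * Y) - 1"
      by (simp add: algebra_simps)
    then show ?thesis
      using \<open>X * Y > 1\<close> \<tau> mult_nonneg_nonneg[of \<tau> "X * Y - 1"] by linarith
  next
    case False
    then have "- (X * Y) > 1"
      using a1 by linarith
    then have "0 \<le> (\<tau> - 1) * (\<tau> * - (X * Y) - 1)"
      using \<tau> mult_mono[of 1 \<tau> 1 "- (X * Y)"] by (intro mult_nonneg_nonneg) auto
    then have "\<tau> * (1 - X * Y) \<le> 1 - \<tau> * X * (\<tau> * Y)"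
      by (simp add: algebra_simps)
    then show ?thesis
      using \<open>- (X * Y) > 1\<close> by (simp add: abs_if)
  qed
  have XYne: "X \<noteq> Y"
    using ne Jb Jc by (auto simp: X_def Y_def)
  have "joukowski (pseudohyp b' c') = \<bar>X * Y - 1\<bar> / \<bar>X - Y\<bar>"
    using joukowski_pseudohyp[of b' c'] b' c' ne' by (simp add: X_def Y_def)
  also have "\<dots> = \<tau> * \<bar>X * Y - 1\<bar> / (\<tau> * \<bar>X - Y\<bar>)"
    using \<tau> by simp
  also have "\<dots> \<le> \<bar>\<tau> * X * (\<tau> * Y) - 1\<bar> / (\<tau> * \<bar>X - Y\<bar>)"
    using key \<tau> by (intro divide_right_mono) auto
  also have "\<tau> * \<bar>X - Y\<bar> = \<bar>\<tau> * X - \<tau> * Y\<bar>"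
    using \<tau> by (simp add: abs_mult flip: right_diff_distrib)
  also have "\<bar>\<tau> * X * (\<tau> * Y) - 1\<bar> / \<bar>\<tau> * X - \<tau> * Y\<bar> = joukowski (pseudohyp b c)"
    using joukowski_pseudohyp[of b c] b c False by (simp add: X_def Y_def Jb Jc)
  finally have le: "joukowski (pseudohyp b' c') \<le> joukowski (pseudohyp b c)" .
  have ph: "0 < pseudohyp b c \<and> pseudohyp b c < 1" if "\<bar>b\<bar> < 1" "\<bar>c\<bar> < 1" "b \<noteq> c" for b c
  proof -
    have "\<bar>b * c\<bar> < 1"
      using that mult_strict_mono[of "\<bar>b\<bar>" 1 "\<bar>c\<bar>" 1] by (cases "b = 0 \<or> c = 0") (auto simp: abs_mult)
    then have d: "1 - b * c > 0"
      by auto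
    have "0 < (1 - b) * (1 + c)" "0 < (1 + b) * (1 - c)"
      using that by (auto intro!: mult_pos_pos)
    then have "\<bar>c - b\<bar> < 1 - b * c"
      by (simp add: algebra_simps abs_less_iff)
    then show ?thesis
      using d that by (simp add: pseudohyp_def abs_divide)
  qed
  show ?thesis
    using le joukowski_le_iff[of "pseudohyp b' c'" "pseudohyp b c"] ph[of b c] ph[of b' c'] b c b' c' False ne' by simp
qed

text \<open>The companion of \<open>pseudohyp_mono_dilation\<close> with infinity, of coordinate 0,
  as second point.\<close>

lemma abs_le_of_joukowski_dilation:
  fixes b b' :: real
  assumes "\<bar>b\<bar> < 1" "b \<noteq> 0" "\<bar>b'\<bar> < 1" "b' \<noteq> 0" "\<tau> \<ge> 1" "joukowski b = \<tau> * joukowski b'"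
  shows "\<bar>b\<bar> \<le> \<bar>b'\<bar>"
proof -
  have "\<bar>joukowski b'\<bar> \<le> \<tau> * \<bar>joukowski b'\<bar>"
    using assms mult_right_mono[of 1 \<tau> "\<bar>joukowski b'\<bar>"] by simp
  also have "\<dots> = \<bar>joukowski b\<bar>"
    using assms by (simp add: abs_mult)
  finally show ?thesis
    unfolding abs_joukowski using assms by (subst (asm) joukowski_le_iff) auto
qed

text \<open>Controls how far a fixed point moves in the disk when the interval is dilated by
  \<open>1 + t\<close>: the factor \<open>(g / w) ^ n\<close> loses at most order
  \<open>n * t\<close>, and \<open>w ^ n\<close> decays uniformly in \<open>t\<close>. By
  monotonicity it suffices to test the candidate \<open>g * (1 + C * t)\<close>.\<close>

lemma joukowski_dilation_bound:
  fixes g :: real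
  assumes g: "0 < g" "g < 1"
  obtains C r t0 where "C > 0" "r < 1" "t0 > 0"
    "\<And>t. 0 < t \<Longrightarrow> t \<le> t0 \<Longrightarrow> joukowski g > 1 + t"
    "\<And>t w. 0 < t \<Longrightarrow> t \<le> t0 \<Longrightarrow> 0 < w \<Longrightarrow> w < 1 \<Longrightarrow> joukowski w = joukowski g / (1 + t) \<Longrightarrow> w \<le> r \<and> w \<le> g * (1 + C * t)"
proof -
  define \<delta> where "\<delta> = 1 - g\<^sup>2"
  have "g\<^sup>2 > 0" "g\<^sup>2 < 1"
    using g by (auto simp: power_less_one_iff)
  then have \<delta>: "0 < \<delta>" "\<delta> < 1" "g\<^sup>2 = 1 - \<delta>"
    by (auto simp: \<delta>_def)
  \<comment> \<open>The first bound gives \<open>s \<le> \<delta> / 4\<close> for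
    \<open>s = 8 / \<delta> * t\<close>, the second keeps \<open>joukowski g\<close> above
    \<open>1 + t\<close>.\<close>
  define t0 where "t0 = min (\<delta>\<^sup>2 / 32) ((joukowski g - 1) / 2)"
  have J1: "joukowski g > 1"
    using abs_joukowski_gt_1[of g] g by (simp add: abs_joukowski)
  define r where "r = g * (1 + \<delta> / 4)"
  have "(1 - \<delta>) * (1 + \<delta> / 4)\<^sup>2 = 1 - (\<delta> / 2 + 7 * \<delta>\<^sup>2 / 16 + \<delta> ^ 3 / 16)"
    by (simp add: power2_eq_square power3_eq_cube field_simps)
  moreover have "\<delta> / 2 + 7 * \<delta>\<^sup>2 / 16 + \<delta> ^ 3 / 16 \<ge> \<delta> / 2"
    using \<delta> by simp
  ultimately have sq: "(1 - \<delta>) * (1 + \<delta> / 4)\<^sup>2 \<le> 1 - \<delta> / 2"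
    by simp
  have "r\<^sup>2 < 1\<^sup>2"
    using sq \<delta> by (simp add: r_def power_mult_distrib)
  then have r: "r < 1"
    by (rule power_less_imp_less_base) simp
  show ?thesis
  proof (rule that[of "8 / \<delta>" r t0])
    show "8 / \<delta> > 0" "r < 1" "t0 > 0"
      using \<delta> r J1 by (auto simp: t0_def)
    fix t assume t: "0 < t" "t \<le> t0"
    then have "2 * t \<le> joukowski g - 1"
      by (simp add: t0_def)
    then show "joukowski g > 1 + t"
      using t by linarith
    fix w :: real assume w: "0 < w" "w < 1" "joukowski w = joukowski g / (1 + t)"
    define s where "s = 8 / \<delta> * t"
    have s: "0 < s" "s \<le> \<delta> / 4" "t = s * \<delta> / 8"
      using t \<delta> by (auto simp: s_def t0_def power2_eq_square field_simps)
    have gr: "g * (1 + s) \<le> r"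
      unfolding r_def using s g by (intro mult_left_mono) auto
    have g1: "0 < g * (1 + s)" "g * (1 + s) < 1"
      using gr r g s by auto
    have "(1 + s) * (1 + \<delta> / 8 + s * \<delta> / 8) \<le> (1 + \<delta> / 4) * (1 + \<delta> / 4)"
    proof (intro mult_mono)
      have "s * \<delta> \<le> 1 * \<delta>"
        using s \<delta> by (intro mult_right_mono) auto
      then show "1 + \<delta> / 8 + s * \<delta> / 8 \<le> 1 + \<delta> / 4"
        by linarith
    qed (use s \<delta> in auto)
    then have "(1 - \<delta>) * ((1 + s) * (1 + \<delta> / 8 + s * \<delta> / 8)) \<le> (1 - \<delta>) * (1 + \<delta> / 4)\<^sup>2"
      unfolding power2_eq_square using \<delta> by (intro mult_left_mono) auto
    also have "\<dots> \<le> 1 - \<delta> / 8"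
      using sq \<delta> by simp
    finally have "s * ((1 - \<delta>) * ((1 + s) * (1 + \<delta> / 8 + s * \<delta> / 8))) \<le> s * (1 - \<delta> / 8)"
      using s by (intro mult_left_mono) auto
    then have "(1 - \<delta>) * (1 + s) * (t + s + t * s) \<le> s - t"
      by (simp add: s(3) algebra_simps)
    \<comment> \<open>This is \<open>joukowski (g * (1 + s)) \<le> joukowski g / (1 + t)\<close>
      with the denominators cleared.\<close>
    then have "(1 + t) * (g\<^sup>2 * (1 + s)\<^sup>2 + 1) \<le> (1 + s) * (g\<^sup>2 + 1)"
      unfolding \<delta>(3) by (simp add: power2_eq_square algebra_simps)
    then have "(g\<^sup>2 * (1 + s)\<^sup>2 + 1) / (1 + s) \<le> (g\<^sup>2 + 1) / (1 + t)"
    proof -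
      assume le: "(1 + t) * (g\<^sup>2 * (1 + s)\<^sup>2 + 1) \<le> (1 + s) * (g\<^sup>2 + 1)"
      have "X / p \<le> Y / q" if "q * X \<le> p * Y" "p > 0" "q > 0" for X Y p q :: real
        using that by (simp add: field_simps)
      from this[OF le] show ?thesis
        using s(1) t(1) by simp
    qed
    then have "(g\<^sup>2 * (1 + s)\<^sup>2 + 1) / (1 + s) / (2 * g) \<le> (g\<^sup>2 + 1) / (1 + t) / (2 * g)"
      using g by (intro divide_right_mono) auto
    then have "(g\<^sup>2 * (1 + s)\<^sup>2 + 1) / (2 * g * (1 + s)) \<le> (g\<^sup>2 + 1) / (2 * g * (1 + t))"
      by (simp only: divide_divide_eq_left mult_ac)
    moreover have J: "joukowski h = (h\<^sup>2 + 1) / (2 * h)" if "h \<noteq> 0" for h :: real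
      using that by (simp add: joukowski_def power2_eq_square field_simps)
    have "joukowski (g * (1 + s)) = (g\<^sup>2 * (1 + s)\<^sup>2 + 1) / (2 * g * (1 + s))"
      using J[of "g * (1 + s)"] g1(1) by (simp only: power_mult_distrib mult.assoc; simp)
    moreover have "joukowski g / (1 + t) = (g\<^sup>2 + 1) / (2 * g * (1 + t))"
      using J[of g] g by (simp only: divide_divide_eq_left; simp)
    ultimately have "joukowski (g * (1 + s)) \<le> joukowski w"
      using w by simp
    then have "w \<le> g * (1 + s)"
      using joukowski_le_iff[OF g1 w(1,2)] by simp
    then show "w \<le> r \<and> w \<le> g * (1 + 8 / \<delta> * t)"
      using gr by (simp add: s_def)
  qed
qed

text \<open>
  On the dilated interval the polynomial is \<open>Re (exp (- i n \<theta>) S (exp (i \<theta>)))\<close>,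
  where \<open>S\<close> is the truncated Taylor series of the Blaschke product. The truncation error
  carries a factor \<open>w ^ n\<close>, which compensates \<open>w ^ (- n)\<close> at the zeros of the product.
\<close>

lemma exists_polynomial_from_blaschke_product:
  fixes b :: "nat \<Rightarrow> real"
  assumes K: "finite K" "\<And>k. k \<in> K \<Longrightarrow> \<bar>b k\<bar> < 1" "\<And>k. k \<in> K \<Longrightarrow> b k \<noteq> 0" and n: "n > 0" and \<tau>: "\<tau> > 0"
    and R: "R > 1" "\<And>k. k \<in> K \<Longrightarrow> \<bar>b k\<bar> * R < 1"
    and M: "\<And>z. norm z = R \<Longrightarrow> (\<Prod>k\<in>K. norm (blaschke (b k) z)) \<le> M"
    and e: "M / (R ^ n * (R - 1)) \<le> e"
  obtains p where "degree p \<le> n" "\<And>x. \<bar>x\<bar> \<le> \<tau> \<Longrightarrow> norm (poly p (of_real x)) \<le> 1"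
    "\<And>k. k \<in> K \<Longrightarrow> norm (poly p (of_real (\<tau> * joukowski (b k)))) \<le> 1"
    "\<And>w. norm w < 1 \<Longrightarrow> w \<noteq> 0 \<Longrightarrow>
      ((\<Prod>k\<in>K. norm (blaschke (b k) w)) - 2 * e) / 2 - norm w ^ n / 2 \<le> norm (w ^ n * poly p (of_real \<tau> * joukowski w))"
    "((\<Prod>k\<in>K. \<bar>b k\<bar>) - 2 * e) / 2 / \<tau> ^ n \<le> norm (coeff p n / 2 ^ n)"
proof -
  define f where "f = (\<lambda>w. \<Prod>k\<in>K. blaschke (b k) w)"
  have nz: "1 - of_real (b k) * w \<noteq> 0" if "k \<in> K" "norm w \<le> R" for k and w :: complex
  proof (rule blaschke_denominator_nonzero)
    show "\<bar>b k\<bar> * norm w < 1"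
      using mult_left_mono[OF that(2), of "\<bar>b k\<bar>"] R(2)[OF that(1)] by simp
  qed
  have hol: "f holomorphic_on S" if "S \<subseteq> cball 0 R" for S
    unfolding f_def using nz that by (intro holomorphic_intros blaschke_holomorphic) auto
  have nf: "norm (f w) = (\<Prod>k\<in>K. norm (blaschke (b k) w))" for w
    by (simp add: f_def prod_norm)
  define e' where "e' = M / (R ^ n * (R - 1))"
  obtain c where c: "\<And>w. norm w \<le> 1 \<Longrightarrow> norm (f w - (\<Sum>j\<le>n. c j * w ^ j)) \<le> norm w ^ n * e'"
    unfolding e'_def
  proof (rule taylor_truncation)
    show "continuous_on (cball 0 R) f" "f holomorphic_on ball 0 R"
      by (auto intro!: holomorphic_on_imp_continuous_on hol)
    show "norm (f z) \<le> M" if "norm z = R" for z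
      using M[OF that] by (simp add: nf)
  qed (use R in auto)
  have e'0: "e' \<ge> 0"
    using c[of 1] norm_ge_zero order_trans by (metis norm_one order_refl power_one mult_1)
  have ee: "e' \<le> e"
    using e by (simp add: e'_def)
  have f1: "norm (f w) \<le> 1" if "norm w \<le> 1" for w
    unfolding nf using that K by (intro prod_le_1) (auto intro: norm_blaschke_le_1)
  define S where "S = (\<lambda>w. \<Sum>j\<le>n. c j * w ^ j)"
  define T where "T = (\<lambda>w. \<Sum>j\<le>n. c j * w ^ (n - j))"
  have Sf: "norm (f w - S w) \<le> norm w ^ n * e'" if "norm w \<le> 1" for w
    using c[OF that] by (simp add: S_def)
  have pw: "norm w ^ n * e' \<le> e'" if "norm w \<le> 1" for w :: complex
    using that e'0 by (simp add: power_le_one mult_left_le_one_le)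
  have S1: "norm (S w) \<le> 1 + e'" if "norm w \<le> 1" for w
    using Sf[OF that] f1[OF that] pw[OF that] norm_triangle_ineq2[of "S w" "f w"] by (simp add: norm_minus_commute)
  have T1: "norm (T w) \<le> 1 + e'" if "norm w \<le> 1" for w
    unfolding T_def by (rule norm_reversed_poly_le) (use S1 that in \<open>auto simp: S_def\<close>)
  have Slow: "norm (S w) \<ge> norm (f w) - e'" if "norm w \<le> 1" for w
    using Sf[OF that] pw[OF that] norm_triangle_ineq2[of "f w" "S w"] by simp
  define q where "q = dilated_cheb_sum n \<tau> c"
  \<comment> \<open>\<open>S\<close> and the reversed sum \<open>T\<close> are bounded by
    \<open>1 + e'\<close> on the closed disk, hence so is \<open>q\<close> on the dilated
    interval.\<close>
  define p where "p = smult (of_real (1 / (1 + e'))) q"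
  have qw: "w ^ n * poly q (of_real \<tau> * joukowski w) = (S w + w ^ n * T w) / 2"
      "poly q (of_real \<tau> * joukowski w) = (S w / w ^ n + T w) / 2" if "w \<noteq> 0" for w
    unfolding q_def S_def T_def by (fact poly_dilated_cheb_sum[OF \<tau> that])+
  have ne: "norm (of_real (1 / (1 + e')) :: complex) = 1 / (1 + e')"
    unfolding norm_of_real using e'0 by simp
  have np: "norm (poly p z) = norm (poly q z) / (1 + e')" for z
    unfolding p_def poly_smult norm_mult ne by simp
  \<comment> \<open>The price of dividing by \<open>1 + e'\<close>: a value \<open>F \<le> 1\<close>
    of the product, already reduced by \<open>e'\<close>, loses at most another
    \<open>e'\<close>.\<close>
  have ratio: "(F - 2 * e) / 2 \<le> (F - e') / 2 / (1 + e')" if "F \<le> 1" for F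
  proof -
    have "(F - 2 * e') * (1 + e') = F - e' + (F * e' - e') - 2 * (e' * e')"
      by (simp add: algebra_simps)
    also have "\<dots> \<le> F - e'"
      using mult_right_mono[OF that e'0] mult_nonneg_nonneg[OF e'0 e'0] by linarith
    finally have "(F - 2 * e') * (1 + e') \<le> F - e'" .
    then have "F - 2 * e' \<le> (F - e') / (1 + e')"
      using e'0 by (simp add: pos_le_divide_eq)
    then have "F - 2 * e \<le> (F - e') / (1 + e')"
      using ee by linarith
    then have "(F - 2 * e) / 2 \<le> (F - e') / (1 + e') / 2"
      by (rule divide_right_mono) simp
    then show ?thesis
      by (simp only: divide_divide_eq_left mult.commute)
  qed
  show ?thesis
  proof
    show "degree p \<le> n"
      unfolding p_def q_def by (intro order_trans[OF degree_smult_le] degree_dilated_cheb_sum)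
    show "norm (poly p (of_real x)) \<le> 1" if "\<bar>x\<bar> \<le> \<tau>" for x
    proof -
      define t where "t = arccos (x / \<tau>)"
      have "cos t = x / \<tau>"
        using that \<tau> unfolding t_def by (intro cos_arccos) (auto simp: field_simps abs_le_iff)
      then have x: "of_real x = of_real \<tau> * joukowski (cis t)"
        using \<tau> by (simp add: joukowski_cis)
      have "norm (poly q (of_real x)) \<le> (norm (S (cis t)) / norm (cis t ^ n) + norm (T (cis t))) / 2"
        unfolding x using norm_triangle_ineq[of "S (cis t) / cis t ^ n" "T (cis t)"]
        by (simp add: qw norm_divide)
      also have "\<dots> \<le> 1 + e'"
        using S1[of "cis t"] T1[of "cis t"] by (simp add: norm_power)
      finally show ?thesis
        using e'0 by (simp add: np)
    qed
    show "norm (poly p (of_real (\<tau> * joukowski (b k)))) \<le> 1" if "k \<in> K" for k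
    proof -
      let ?w = "complex_of_real (b k)"
      have w: "norm ?w \<le> 1" "?w \<noteq> 0"
        using K that by (auto intro: less_imp_le)
      have "f ?w = 0"
        unfolding f_def using K that by (auto intro!: prod_zero bexI[of _ k] simp: blaschke_def)
      then have "norm (S ?w / ?w ^ n) \<le> e'"
        using Sf[OF w(1)] w(2) by (simp add: norm_divide norm_power field_simps)
      then have "norm (poly q (of_real \<tau> * joukowski ?w)) \<le> (e' + (1 + e')) / 2"
        using norm_triangle_ineq[of "S ?w / ?w ^ n" "T ?w"] T1[OF w(1)]
        unfolding qw(2)[OF w(2)] by (simp add: norm_divide)
      then show ?thesis
        using e'0 by (simp add: np of_real_joukowski)
    qed
    show "((\<Prod>k\<in>K. norm (blaschke (b k) w)) - 2 * e) / 2 - norm w ^ n / 2 \<le> norm (w ^ n * poly p (of_real \<tau> * joukowski w))"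
      if w: "norm w < 1" "w \<noteq> 0" for w
    proof -
      have w1: "norm w \<le> 1"
        using w by simp
      have "(norm (f w) - 2 * e) / 2 - norm w ^ n / 2 \<le> (norm (f w) - e') / 2 / (1 + e') - norm w ^ n / 2"
        using ratio[OF f1[OF w1]] by simp
      also have "\<dots> = ((norm (f w) - e') / 2 - norm w ^ n * (1 + e') / 2) / (1 + e')"
      proof -
        have "A / 2 / v - x / 2 = (A / 2 - x * v / 2) / v" if "v \<noteq> 0" for A v x :: real
          using that by (simp add: field_simps)
        from this[of "1 + e'"] show ?thesis
          using e'0 by (metis add_nonneg_eq_0_iff zero_le_one zero_neq_one)
      qed
      also have "\<dots> \<le> norm (w ^ n * poly q (of_real \<tau> * joukowski w)) / (1 + e')"
      proof (rule divide_right_mono)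
        have "norm (w ^ n * T w) \<le> norm w ^ n * (1 + e')"
          unfolding norm_mult norm_power using T1[OF w1] by (intro mult_left_mono) auto
        then have "norm (f w) - e' - norm w ^ n * (1 + e') \<le> norm (S w + w ^ n * T w)"
          using Slow[OF w1] norm_diff_ineq[of "S w" "w ^ n * T w"] by linarith
        then show "(norm (f w) - e') / 2 - norm w ^ n * (1 + e') / 2 \<le> norm (w ^ n * poly q (of_real \<tau> * joukowski w))"
          unfolding qw(1)[OF w(2)] norm_divide norm_numeral by argo
      qed (use e'0 in simp)
      also have "\<dots> = norm (w ^ n * poly p (of_real \<tau> * joukowski w))"
        by (simp add: np norm_mult)
      finally show ?thesis
        by (simp add: nf)
    qed
    show "((\<Prod>k\<in>K. \<bar>b k\<bar>) - 2 * e) / 2 / \<tau> ^ n \<le> norm (coeff p n / 2 ^ n)"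
    proof -
      have f0: "norm (f 0) = (\<Prod>k\<in>K. \<bar>b k\<bar>)"
        by (simp add: nf blaschke_def)
      have S0: "S 0 = c 0"
        by (simp add: S_def power_0_left if_distrib[of "(*) _"] cong: if_cong)
      have "((\<Prod>k\<in>K. \<bar>b k\<bar>) - 2 * e) / 2 / \<tau> ^ n \<le> (norm (f 0) - e') / 2 / (1 + e') / \<tau> ^ n"
        using ratio[OF f1[of 0]] \<tau> unfolding f0[symmetric] by (intro divide_right_mono) auto
      also have "\<dots> \<le> norm (c 0) / 2 / (1 + e') / \<tau> ^ n"
        using Slow[of 0] e'0 \<tau> unfolding S0 by (intro divide_right_mono) auto
      also have "\<dots> = norm (coeff q n / 2 ^ n) / (1 + e')"
        unfolding q_def coeff_dilated_cheb_sum[OF n] using \<tau> by (simp add: norm_divide norm_mult norm_power field_simps)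
      also have "\<dots> = norm (coeff p n / 2 ^ n)"
        unfolding p_def coeff_smult norm_divide norm_mult ne by simp
      finally show ?thesis .
    qed
  qed
qed

section \<open>Balancing the dilation against the Taylor error\<close>

lemma power_inverse_ge_1_minus:
  fixes s :: real
  assumes "s \<ge> 0"
  shows "1 - real n * s \<le> 1 / (1 + s) ^ n"
proof -
  have "(1 + s) ^ n \<le> exp s ^ n"
    using assms by (intro power_mono exp_ge_add_one_self) auto
  also have "\<dots> = exp (real n * s)"
    by (simp add: exp_of_nat_mult)
  finally have "1 / exp (real n * s) \<le> 1 / (1 + s) ^ n"
    using assms by (intro divide_left_mono) auto
  moreover have "1 - real n * s \<le> 1 / exp (real n * s)"
    using exp_ge_add_one_self[of "- (real n * s)"] by (simp add: exp_minus field_simps)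
  ultimately show ?thesis
    by linarith
qed

text \<open>Since \<open>exp (\<rho> / 2) \<le> 1 + \<rho>\<close>, the Cauchy estimate gains
  \<open>exp (\<rho> * n / 2)\<close>. Half of this exponent pays for the growth of the Blaschke
  product, the other half remains as decay.\<close>

lemma real_power_exp_bound:
  fixes \<rho> :: real
  assumes "0 < \<rho>" "\<rho> \<le> 1"
  shows "exp (\<rho> * real n / 4) / ((1 + \<rho>) ^ n * \<rho>) \<le> exp (- \<rho> * real n / 4) / \<rho>"
proof -
  have "exp (\<rho> / 2) \<le> 1 + \<rho> / 2 + (\<rho> / 2)\<^sup>2"
    using assms by (intro exp_bound) auto
  also have "(\<rho> / 2)\<^sup>2 = \<rho> * \<rho> / 4"
    by (simp add: power2_eq_square)
  also have "1 + \<rho> / 2 + \<rho> * \<rho> / 4 \<le> 1 + \<rho>"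
    using assms mult_left_mono[of \<rho> 1 \<rho>] by argo
  finally have "exp (\<rho> / 2) ^ n \<le> (1 + \<rho>) ^ n"
    by (intro power_mono) auto
  then have "exp (\<rho> * real n / 2) \<le> (1 + \<rho>) ^ n"
    by (simp add: exp_of_nat_mult[symmetric] mult.commute)
  then have "exp (\<rho> * real n / 4) / (1 + \<rho>) ^ n \<le> exp (\<rho> * real n / 4) / exp (\<rho> * real n / 2)"
    using assms by (intro divide_left_mono) auto
  also have "\<dots> = exp (- \<rho> * real n / 4)"
    by (simp flip: exp_diff)
  finally have "exp (\<rho> * real n / 4) / (1 + \<rho>) ^ n / \<rho> \<le> exp (- \<rho> * real n / 4) / \<rho>"
    using assms by (intro divide_right_mono) auto
  then show ?thesis
    by simp
qed

text \<open>
  Points \<open>x\<close> with \<open>\<bar>x\<bar> \<le> 1 + t\<close> are absorbed by dilating the interval by \<open>1 + t\<close>,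
  where \<open>t = o (1 / n)\<close> makes the dilation harmless; the finitely many others become
  zeros of the Blaschke product.
\<close>

lemma exists_competitor_step:
  fixes \<beta> :: "nat \<Rightarrow> real" and \<gamma> C r t0 :: real
  assumes \<beta>: "\<And>k. \<bar>\<beta> k\<bar> < 1" "\<And>k. \<beta> k \<noteq> 0" and \<gamma>: "\<bar>\<gamma>\<bar> < 1"
    and L: "\<And>I. finite I \<Longrightarrow> L \<le> (\<Prod>k\<in>I. norm (blaschke (\<beta> k) (of_real \<gamma>)))"
    and C: "C \<ge> 1" "r \<ge> 0"
    and big: "\<gamma> \<noteq> 0 \<Longrightarrow> \<bar>joukowski \<gamma>\<bar> > 1 + t"
    and dil: "\<And>w. 0 < w \<Longrightarrow> w < 1 \<Longrightarrow> \<gamma> \<noteq> 0 \<Longrightarrow> joukowski w = joukowski \<bar>\<gamma>\<bar> / (1 + t) \<Longrightarrow> w \<le> r \<and> w \<le> \<bar>\<gamma>\<bar> * (1 + C * t)"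
    and t: "0 < t" "t \<le> 1" and n: "n > 0"
    and K: "K = {k. \<bar>joukowski (\<beta> k)\<bar> > 1 + t}" "finite K"
    and C1: "C1 \<ge> 2" "\<And>k. k \<in> K \<Longrightarrow> 2 * sqrt (\<bar>joukowski (\<beta> k)\<bar> - 1 - t) \<le> C1"
    and sum: "(\<Sum>k\<in>K. 1 / sqrt (\<bar>joukowski (\<beta> k)\<bar> - 1 - t)) \<le> 1 / (48 * C1) * real n"
    and \<rho>: "0 < \<rho>" "\<rho> \<le> 1" "\<And>k. k \<in> K \<Longrightarrow> \<rho> \<le> sqrt (\<bar>joukowski (\<beta> k)\<bar> - 1 - t) / (2 * C1)"
  obtains p where "degree p \<le> n" "\<And>x. x \<in> {-1..1} \<Longrightarrow> norm (poly p (of_real x)) \<le> 1"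
    "\<And>k. norm (poly p (of_real (joukowski (\<beta> k)))) \<le> 1"
    "norm (poly (disk_poly n p) (of_real \<gamma>)) \<ge> L / 2 - exp (- \<rho> * real n / 4) / \<rho> - r ^ n / 2 - C * (real n * t) / 2"
proof -
  define \<tau> where "\<tau> = 1 + t"
  have \<tau>: "\<tau> > 1" "\<tau> \<le> 2"
    using t by (auto simp: \<tau>_def)
  define e where "e = exp (- \<rho> * real n / 4) / \<rho>"
  have e: "e > 0"
    using \<rho> by (simp add: e_def)
  have "\<exists>b. \<bar>b\<bar> < 1 \<and> b \<noteq> 0 \<and> joukowski b = joukowski (\<beta> k) / \<tau>" if "k \<in> K" for k
  proof (rule exists_joukowski_preimage[of "joukowski (\<beta> k) / \<tau>"])
    show "\<bar>joukowski (\<beta> k) / \<tau>\<bar> > 1"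
      using that \<tau> K(1) by (simp add: abs_divide \<tau>_def)
  qed blast
  then obtain b where b: "\<And>k. k \<in> K \<Longrightarrow> \<bar>b k\<bar> < 1" "\<And>k. k \<in> K \<Longrightarrow> b k \<noteq> 0"
    "\<And>k. k \<in> K \<Longrightarrow> joukowski (b k) = joukowski (\<beta> k) / \<tau>"
    by metis
  have J\<tau>: "joukowski (\<beta> k) = \<tau> * joukowski (b k)" if "k \<in> K" for k
    using b(3)[OF that] \<tau> by simp
  define s where "s = (\<lambda>k. sqrt (\<bar>joukowski (\<beta> k)\<bar> - 1 - t))"
  have s: "s k > 0" if "k \<in> K" for k
    using that K(1) by (simp add: s_def)
  \<comment> \<open>\<open>C1\<close> is at least 2, hence above \<open>sqrt \<tau>\<close>, and at
    least \<open>2 * s k\<close>, so both arguments of the minimum in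
    \<open>abs_joukowski_preimage_le\<close> dominate \<open>s k / C1\<close>.\<close>
  have d: "s k / C1 \<le> 1 - \<bar>b k\<bar>" if k: "k \<in> K" for k
  proof -
    have "\<bar>joukowski (b k)\<bar> - 1 = (\<bar>joukowski (\<beta> k)\<bar> - 1 - t) / \<tau>"
      unfolding b(3)[OF k] abs_divide using \<tau> t by (simp add: diff_divide_distrib \<tau>_def) (simp add: field_simps)
    then have "sqrt (\<bar>joukowski (b k)\<bar> - 1) = s k / sqrt \<tau>"
      by (simp add: real_sqrt_divide s_def)
    moreover have "s k / C1 \<le> s k / sqrt \<tau>"
    proof (rule divide_left_mono)
      have "sqrt \<tau> \<le> \<tau>"
        using \<tau> by (intro real_le_lsqrt) (auto simp: power2_eq_square)
      then show "sqrt \<tau> \<le> C1"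
        using \<tau> C1 by linarith
    qed (use s[OF k] \<tau> C1 in auto)
    moreover have "s k / C1 \<le> 1 / 2"
      using C1(2)[OF k] C1(1) by (simp add: s_def field_simps)
    ultimately show ?thesis
      using abs_joukowski_preimage_le(2)[of "b k"] b[OF k] by linarith
  qed
  have \<rho>d: "\<rho> \<le> (1 - \<bar>b k\<bar>) / 2" if "k \<in> K" for k
    using \<rho>(3)[OF that] d[OF that] by (simp add: s_def)
  have inv: "1 / (1 - \<bar>b k\<bar>) \<le> C1 * (1 / s k)" if k: "k \<in> K" for k
  proof -
    have "1 / (1 - \<bar>b k\<bar>) \<le> 1 / (s k / C1)"
      using d[OF k] s[OF k] C1 b(1)[OF k] by (intro divide_left_mono) auto
    then show ?thesis
      by simp
  qed
  \<comment> \<open>Each factor grows by at most \<open>exp (12 * \<rho> * C1 / s k)\<close>; the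
    constant \<open>48 * C1\<close> in the bound for the sum is made to leave the exponent
    \<open>\<rho> * n / 4\<close>.\<close>
  have M: "(\<Prod>k\<in>K. norm (blaschke (b k) z)) \<le> exp (\<rho> * real n / 4)" if z: "norm z = 1 + \<rho>" for z
  proof -
    have "(\<Prod>k\<in>K. norm (blaschke (b k) z)) \<le> (\<Prod>k\<in>K. exp (12 * \<rho> / (1 - \<bar>b k\<bar>)))"
      using norm_blaschke_outside_le(1) b(1) \<rho> \<rho>d z by (intro prod_mono) auto
    also have "\<dots> = exp (\<Sum>k\<in>K. 12 * \<rho> / (1 - \<bar>b k\<bar>))"
      using K(2) by (simp add: exp_sum)
    also have "\<dots> \<le> exp (\<Sum>k\<in>K. 12 * \<rho> * (C1 * (1 / s k)))"
    proof -
      have "12 * \<rho> * (1 / (1 - \<bar>b k\<bar>)) \<le> 12 * \<rho> * (C1 * (1 / s k))" if "k \<in> K" for k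
        using inv[OF that] \<rho>(1) by (intro mult_left_mono) auto
      then show ?thesis
        by (auto intro!: sum_mono)
    qed
    also have "(\<Sum>k\<in>K. 12 * \<rho> * (C1 * (1 / s k))) = 12 * \<rho> * C1 * (\<Sum>k\<in>K. 1 / s k)"
      by (simp add: sum_distrib_left mult_ac)
    also have "\<dots> \<le> 12 * \<rho> * C1 * (1 / (48 * C1) * real n)"
      using sum \<rho>(1) C1(1) by (intro mult_left_mono) (auto simp: s_def)
    also have "\<dots> = \<rho> * real n / 4"
      using C1(1) by simp
    finally show ?thesis
      by simp
  qed
  have R: "1 + \<rho> > 1" "\<And>k. k \<in> K \<Longrightarrow> \<bar>b k\<bar> * (1 + \<rho>) < 1"
    using norm_blaschke_outside_le(2)[of _ \<rho> "of_real (1 + \<rho>)"] b(1) \<rho> \<rho>d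
    by (auto simp del: of_real_add)
  have Me: "exp (\<rho> * real n / 4) / ((1 + \<rho>) ^ n * (1 + \<rho> - 1)) \<le> e"
    using real_power_exp_bound[OF \<rho>(1,2), of n] by (simp add: e_def)
  obtain p where p: "degree p \<le> n" "\<And>x. \<bar>x\<bar> \<le> \<tau> \<Longrightarrow> norm (poly p (of_real x)) \<le> 1"
    "\<And>k. k \<in> K \<Longrightarrow> norm (poly p (of_real (\<tau> * joukowski (b k)))) \<le> 1"
    "\<And>w. norm w < 1 \<Longrightarrow> w \<noteq> 0 \<Longrightarrow>
      ((\<Prod>k\<in>K. norm (blaschke (b k) w)) - 2 * e) / 2 - norm w ^ n / 2 \<le> norm (w ^ n * poly p (of_real \<tau> * joukowski w))"
    "((\<Prod>k\<in>K. \<bar>b k\<bar>) - 2 * e) / 2 / \<tau> ^ n \<le> norm (coeff p n / 2 ^ n)"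
    using exists_polynomial_from_blaschke_product[OF K(2) b(1,2) n _ R M Me, of \<tau>] \<tau> by auto
  have L1: "L \<le> 1"
    using L[of "{}"] by simp
  \<comment> \<open>Turns the multiplicative loss \<open>q\<close> into an additive one. Its half
    comes from the bracket being at most 1/2.\<close>
  have combine: "L / 2 - e - r ^ n / 2 - C * (real n * t) / 2 \<le> H"
    if "q * (L / 2 - e - r ^ n / 2) \<le> H" "1 - C * (real n * t) \<le> q" "0 \<le> H" for q H
  proof (cases "L / 2 - e - r ^ n / 2 \<le> 0")
    case True
    then show ?thesis
      using that C t by (smt (verit) divide_nonneg_nonneg mult_nonneg_nonneg of_nat_0_le_iff)
  next
    case False
    define D where "D = L / 2 - e - r ^ n / 2"
    have D: "0 < D" "D \<le> 1 / 2"
      using False L1 e zero_le_power[OF C(2), of n] unfolding D_def by linarith+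
    have "D - C * (real n * t) / 2 \<le> D - C * (real n * t) * D"
      using D C t mult_left_mono[of D "1/2" "C * (real n * t)"] by simp
    also have "\<dots> = (1 - C * (real n * t)) * D"
      by (simp add: algebra_simps)
    also have "\<dots> \<le> q * D"
      using that D by (intro mult_right_mono) auto
    finally show ?thesis
      using that by (simp add: D_def)
  qed
  show ?thesis
  proof (rule that[of p])
    show "degree p \<le> n"
      by (rule p)
    show "norm (poly p (of_real x)) \<le> 1" if "x \<in> {-1..1}" for x
      using that \<tau> by (intro p) auto
    show "norm (poly p (of_real (joukowski (\<beta> k)))) \<le> 1" for k
    proof (cases "k \<in> K")
      case True
      then show ?thesis
        using p(3)[OF True] J\<tau>[OF True] by simp
    next
      case False
      then show ?thesis
        using K(1) by (intro p) (auto simp: \<tau>_def)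
    qed
    show "L / 2 - exp (- \<rho> * real n / 4) / \<rho> - r ^ n / 2 - C * (real n * t) / 2 \<le> norm (poly (disk_poly n p) (of_real \<gamma>))"
      unfolding e_def[symmetric]
    proof (cases "\<gamma> = 0")
      case True
      \<comment> \<open>The value 0 of \<open>\<gamma>\<close> stands for infinity: the coefficient
        of degree \<open>n\<close> takes the place of a value, and the dilation costs exactly
        \<open>1 / \<tau> ^ n\<close>.\<close>
      have "L \<le> (\<Prod>k\<in>K. \<bar>\<beta> k\<bar>)"
        using L[OF K(2)] True by (simp add: blaschke_def)
      also have "\<dots> \<le> (\<Prod>k\<in>K. \<bar>b k\<bar>)"
      proof (rule prod_mono)
        fix k assume k: "k \<in> K"
        show "0 \<le> \<bar>\<beta> k\<bar> \<and> \<bar>\<beta> k\<bar> \<le> \<bar>b k\<bar>"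
          using abs_le_of_joukowski_dilation[OF \<beta>(1,2) b(1,2)[OF k] _ J\<tau>[OF k]] \<tau> by simp
      qed
      finally have "(L - 2 * e) / 2 / \<tau> ^ n \<le> ((\<Prod>k\<in>K. \<bar>b k\<bar>) - 2 * e) / 2 / \<tau> ^ n"
        using \<tau> by (intro divide_right_mono) auto
      then have "(L - 2 * e) / 2 / \<tau> ^ n \<le> norm (coeff p n / 2 ^ n)"
        using p(5) by linarith
      moreover have "1 / \<tau> ^ n * (L / 2 - e - r ^ n / 2) \<le> (L - 2 * e) / 2 / \<tau> ^ n"
      proof -
        have "L / 2 - e - r ^ n / 2 \<le> (L - 2 * e) / 2"
          using zero_le_power[OF C(2), of n] by argo
        then show ?thesis
          using divide_right_mono[of "L / 2 - e - r ^ n / 2" "(L - 2 * e) / 2" "\<tau> ^ n"] \<tau>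
          by (simp only: times_divide_eq_left mult_1 zero_le_power)
      qed
      ultimately have *: "1 / \<tau> ^ n * (L / 2 - e - r ^ n / 2) \<le> norm (poly (disk_poly n p) (of_real \<gamma>))"
        using True by (simp add: poly_disk_poly_0)
      have "1 - C * (real n * t) \<le> 1 - real n * t"
        using C(1) t mult_right_mono[of 1 C "real n * t"] by simp
      also have "\<dots> \<le> 1 / \<tau> ^ n"
        using power_inverse_ge_1_minus[of t n] t by (simp add: \<tau>_def)
      finally show "L / 2 - e - r ^ n / 2 - C * (real n * t) / 2 \<le> norm (poly (disk_poly n p) (of_real \<gamma>))"
        using * by (intro combine[of "1 / \<tau> ^ n"]) auto
    next
      case False
      \<comment> \<open>The coordinate \<open>w\<close> refers to the dilated interval,
        \<open>\<gamma>\<close> to the original one. The estimate for \<open>p\<close> is available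
        with the factor \<open>w ^ n\<close>, and trading it for \<open>\<gamma> ^ n\<close> costs
        \<open>(\<bar>\<gamma>\<bar> / \<bar>w\<bar>) ^ n\<close>.\<close>
      have "\<bar>joukowski \<gamma> / \<tau>\<bar> > 1"
        using big[OF False] \<tau> by (simp add: abs_divide \<tau>_def)
      then obtain w where w: "\<bar>w\<bar> < 1" "w \<noteq> 0" "joukowski w = joukowski \<gamma> / \<tau>"
        using exists_joukowski_preimage by blast
      have J\<gamma>: "joukowski \<gamma> = \<tau> * joukowski w"
        using w(3) \<tau> by simp
      have "joukowski \<bar>w\<bar> = joukowski \<bar>\<gamma>\<bar> / (1 + t)"
        using w(3) \<tau> by (simp add: abs_divide \<tau>_def flip: abs_joukowski)
      then have wr: "\<bar>w\<bar> \<le> r" "\<bar>w\<bar> \<le> \<bar>\<gamma>\<bar> * (1 + C * t)"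
        using dil[of "\<bar>w\<bar>"] w False by auto
      have "L \<le> (\<Prod>k\<in>K. norm (blaschke (\<beta> k) (of_real \<gamma>)))"
        by (rule L[OF K(2)])
      also have "\<dots> \<le> (\<Prod>k\<in>K. norm (blaschke (b k) (of_real w)))"
      proof (rule prod_mono)
        fix k assume k: "k \<in> K"
        have "pseudohyp (\<beta> k) \<gamma> \<le> pseudohyp (b k) w"
          using \<beta> b[OF k] w(1,2) \<gamma> False J\<tau>[OF k] J\<gamma> \<tau>
          by (intro pseudohyp_mono_dilation[where \<tau> = \<tau>]) auto
        then show "0 \<le> norm (blaschke (\<beta> k) (of_real \<gamma>)) \<and>
            norm (blaschke (\<beta> k) (of_real \<gamma>)) \<le> norm (blaschke (b k) (of_real w))"
          by (simp add: norm_blaschke_of_real) (simp add: pseudohyp_def)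
      qed
      finally have F: "L \<le> (\<Prod>k\<in>K. norm (blaschke (b k) (of_real w)))" .
      have "L / 2 - e - r ^ n / 2 \<le> (L - 2 * e) / 2 - \<bar>w\<bar> ^ n / 2"
        using power_mono[OF wr(1), of n] by (simp add: field_simps)
      also have "\<dots> \<le> ((\<Prod>k\<in>K. norm (blaschke (b k) (of_real w))) - 2 * e) / 2 - \<bar>w\<bar> ^ n / 2"
        using F by simp
      also have "\<dots> \<le> norm (of_real w ^ n * poly p (of_real \<tau> * joukowski (of_real w)))"
        using p(4)[of "of_real w"] w by simp
      finally have main: "L / 2 - e - r ^ n / 2 \<le> norm (of_real w ^ n * poly p (of_real \<tau> * joukowski (of_real w)))" .
      have "poly (disk_poly n p) (of_real \<gamma>) = of_real \<gamma> ^ n * poly p (of_real \<tau> * joukowski (of_real w))"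
        using poly_disk_poly[OF p(1), of "of_real \<gamma>"] False J\<gamma>
        by (simp flip: of_real_joukowski)
      also have "\<dots> = (of_real \<gamma> / of_real w) ^ n * (of_real w ^ n * poly p (of_real \<tau> * joukowski (of_real w)))"
        using w(2) by (simp add: power_divide)
      finally have eq: "norm (poly (disk_poly n p) (of_real \<gamma>))
          = (\<bar>\<gamma>\<bar> / \<bar>w\<bar>) ^ n * norm (of_real w ^ n * poly p (of_real \<tau> * joukowski (of_real w)))"
        by (simp add: norm_mult norm_power norm_divide)
      have "1 - C * (real n * t) = 1 - real n * (C * t)"
        by simp
      also have "\<dots> \<le> 1 / (1 + C * t) ^ n"
        using C t by (intro power_inverse_ge_1_minus) auto
      also have "\<dots> = (1 / (1 + C * t)) ^ n"
        by (simp add: power_one_over)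
      also have "\<dots> \<le> (\<bar>\<gamma>\<bar> / \<bar>w\<bar>) ^ n"
      proof (rule power_mono)
        have pos: "1 + C * t > 0"
          using C t by (intro add_pos_nonneg) auto
        then have "\<bar>w\<bar> / (1 + C * t) \<le> \<bar>\<gamma>\<bar>"
          using wr(2) by (simp only: pos_divide_le_eq)
        then show "1 / (1 + C * t) \<le> \<bar>\<gamma>\<bar> / \<bar>w\<bar>"
          using w(2) by (simp add: pos_le_divide_eq)
      qed (use C t in auto)
      finally have q: "1 - C * (real n * t) \<le> (\<bar>\<gamma>\<bar> / \<bar>w\<bar>) ^ n" .
      have "(\<bar>\<gamma>\<bar> / \<bar>w\<bar>) ^ n * (L / 2 - e - r ^ n / 2) \<le> norm (poly (disk_poly n p) (of_real \<gamma>))"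
        unfolding eq using main by (intro mult_left_mono) auto
      then show "L / 2 - e - r ^ n / 2 - C * (real n * t) / 2 \<le> norm (poly (disk_poly n p) (of_real \<gamma>))"
        using q by (intro combine) auto
    qed
  qed
qed

lemma eventually_exists_competitor:
  fixes \<beta> :: "nat \<Rightarrow> real" and \<gamma> L \<epsilon> :: real
  assumes \<beta>: "\<And>k. \<bar>\<beta> k\<bar> < 1" "\<And>k. \<beta> k \<noteq> 0" and \<gamma>: "\<bar>\<gamma>\<bar> < 1"
    and sm: "summable (\<lambda>k. sqrt (\<bar>joukowski (\<beta> k)\<bar> - 1))"
    and L: "\<And>I. finite I \<Longrightarrow> L \<le> (\<Prod>k\<in>I. norm (blaschke (\<beta> k) (of_real \<gamma>)))"
    and \<epsilon>: "\<epsilon> > 0"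
  shows "\<forall>\<^sub>F n in sequentially. \<exists>p. degree p \<le> n \<and> (\<forall>x\<in>{-1..1}. norm (poly p (of_real x)) \<le> 1) \<and>
    (\<forall>k. norm (poly p (of_real (joukowski (\<beta> k)))) \<le> 1) \<and>
    norm (poly (disk_poly n p) (of_real \<gamma>)) \<ge> L / 2 - \<epsilon>"
proof -
  define y where "y = (\<lambda>k. \<bar>joukowski (\<beta> k)\<bar> - 1)"
  have y: "y k > 0" for k
    using abs_joukowski_gt_1[OF \<beta>(2,1)] by (simp add: y_def)
  have smy: "summable (\<lambda>k. sqrt (y k))"
    using sm by (simp add: y_def)
  obtain Y where Y: "\<And>k. sqrt (y k) \<le> Y"
    using summable_imp_Bseq[OF smy] by (auto simp: Bseq_def abs_le_iff)
  define C1 where "C1 = 2 + 2 * max Y 0"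
  have C1: "C1 \<ge> 2"
    by (simp add: C1_def)
  obtain C r t0 where dil: "C \<ge> 1" "0 \<le> r" "r < 1" "t0 > 0"
    "\<And>t. 0 < t \<Longrightarrow> t \<le> t0 \<Longrightarrow> \<gamma> \<noteq> 0 \<Longrightarrow> joukowski \<bar>\<gamma>\<bar> > 1 + t"
    "\<And>t w. 0 < t \<Longrightarrow> t \<le> t0 \<Longrightarrow> 0 < w \<Longrightarrow> w < 1 \<Longrightarrow> \<gamma> \<noteq> 0 \<Longrightarrow> joukowski w = joukowski \<bar>\<gamma>\<bar> / (1 + t) \<Longrightarrow> w \<le> r \<and> w \<le> \<bar>\<gamma>\<bar> * (1 + C * t)"
  proof (cases "\<gamma> = 0")
    case True
    then show ?thesis
      by (intro that[of 1 0 1]) auto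
  next
    case False
    then obtain C r t0 where d: "C > 0" "r < 1" "t0 > 0"
      "\<And>t. 0 < t \<Longrightarrow> t \<le> t0 \<Longrightarrow> joukowski \<bar>\<gamma>\<bar> > 1 + t"
      "\<And>t w. 0 < t \<Longrightarrow> t \<le> t0 \<Longrightarrow> 0 < w \<Longrightarrow> w < 1 \<Longrightarrow> joukowski w = joukowski \<bar>\<gamma>\<bar> / (1 + t) \<Longrightarrow> w \<le> r \<and> w \<le> \<bar>\<gamma>\<bar> * (1 + C * t)"
      using joukowski_dilation_bound[of "\<bar>\<gamma>\<bar>"] \<gamma> by auto
    show ?thesis
    proof (rule that[of "max C 1" "max r 0" t0])
      fix t w :: real
      assume t: "0 < t" "t \<le> t0" and w: "0 < w" "w < 1" "joukowski w = joukowski \<bar>\<gamma>\<bar> / (1 + t)"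
      have "\<bar>\<gamma>\<bar> * (1 + C * t) \<le> \<bar>\<gamma>\<bar> * (1 + max C 1 * t)"
        using t by (intro mult_left_mono add_left_mono mult_right_mono) auto
      then show "w \<le> max r 0 \<and> w \<le> \<bar>\<gamma>\<bar> * (1 + max C 1 * t)"
        using d(5)[OF t w] by auto
    qed (use d in auto)
  qed
  \<comment> \<open>Makes the dilation loss \<open>C * (n * t) / 2\<close> at most
    \<open>\<epsilon> / 4\<close>; the Taylor error and \<open>r ^ n / 2\<close> also get
    \<open>\<epsilon> / 4\<close> each.\<close>
  define \<sigma> where "\<sigma> = \<epsilon> / (2 * C)"
  have \<sigma>: "\<sigma> > 0"
    using \<epsilon> dil(1) by (simp add: \<sigma>_def)
  obtain c where c: "c > 0" "\<forall>\<^sub>F n in sequentially. \<exists>t>0. real n * t \<le> \<sigma> \<and> finite {k. y k > t} \<and>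
      (\<forall>k. y k > t \<longrightarrow> y k - t \<ge> c / real n powr (3/2)) \<and>
      (\<Sum>k | y k > t. 1 / sqrt (y k - t)) \<le> 1 / (48 * C1) * real n"
    using exists_threshold[OF y smy \<sigma>, of "1 / (48 * C1)"] C1 by auto
  define c' where "c' = sqrt c / (2 * C1)"
  have c': "c' > 0"
    using c(1) C1 by (simp add: c'_def)
  \<comment> \<open>The square root of the gap \<open>c / n powr (3/2)\<close>, up to the constant:
    as large as the distance of the zeros to the circle allows. Then \<open>\<rho> n * n\<close>
    grows like \<open>n powr (1/4)\<close>, so the exponential decay overwhelms
    \<open>1 / \<rho> n\<close>.\<close>
  define \<rho> where "\<rho> = (\<lambda>n::nat. c' * real n powr (-3/4))"
  have lim: "(\<lambda>n. exp (- \<rho> n * real n / 4) / \<rho> n) \<longlonglongrightarrow> 0" "\<rho> \<longlonglongrightarrow> 0"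
    unfolding \<rho>_def using c' by real_asymp+
  have ev1: "\<forall>\<^sub>F n in sequentially. exp (- \<rho> n * real n / 4) / \<rho> n < \<epsilon> / 4"
    by (rule order_tendstoD(2)[OF lim(1)]) (use \<epsilon> in simp)
  have ev2: "\<forall>\<^sub>F n in sequentially. \<rho> n < 1"
    by (rule order_tendstoD(2)[OF lim(2)]) simp
  have "(\<lambda>n. r ^ n) \<longlonglongrightarrow> 0"
    using dil by (intro LIMSEQ_realpow_zero) auto
  then have ev3: "\<forall>\<^sub>F n in sequentially. r ^ n < \<epsilon> / 2"
    by (rule order_tendstoD(2)) (use \<epsilon> in simp)
  have "(\<lambda>n. \<sigma> / real n) \<longlonglongrightarrow> 0"
    by real_asymp
  then have ev4: "\<forall>\<^sub>F n in sequentially. \<sigma> / real n < min t0 1"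
    using dil by (intro order_tendstoD) auto
  show ?thesis
    using c(2) ev1 ev2 ev3 ev4 eventually_gt_at_top[of 0]
  proof eventually_elim
    case (elim n)
    obtain t where t: "t > 0" "real n * t \<le> \<sigma>" "finite {k. y k > t}"
      "\<And>k. y k > t \<Longrightarrow> y k - t \<ge> c / real n powr (3/2)"
      "(\<Sum>k | y k > t. 1 / sqrt (y k - t)) \<le> 1 / (48 * C1) * real n"
      using elim(1) by blast
    have "t \<le> \<sigma> / real n"
      using t(2) elim(6) by (simp add: field_simps)
    then have t0: "t \<le> t0" "t \<le> 1"
      using elim(5) by auto
    have Keq: "{k. y k > t} = {k. \<bar>joukowski (\<beta> k)\<bar> > 1 + t}"
      by (auto simp: y_def)
    have yt: "y k - t = \<bar>joukowski (\<beta> k)\<bar> - 1 - t" for k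
      by (simp add: y_def)
    obtain p where p: "degree p \<le> n" "\<And>x. x \<in> {-1..1} \<Longrightarrow> norm (poly p (of_real x)) \<le> 1"
      "\<And>k. norm (poly p (of_real (joukowski (\<beta> k)))) \<le> 1"
      "norm (poly (disk_poly n p) (of_real \<gamma>)) \<ge> L / 2 - exp (- \<rho> n * real n / 4) / \<rho> n - r ^ n / 2 - C * (real n * t) / 2"
    proof (rule exists_competitor_step[OF \<beta> \<gamma> L dil(1,2) _ _ t(1) t0(2) elim(6) refl t(3)[unfolded Keq] C1 _ t(5)[unfolded Keq yt]])
      show "1 + t < \<bar>joukowski \<gamma>\<bar>" if "\<gamma> \<noteq> 0"
        using dil(5)[OF t(1) t0(1) that] by (simp add: abs_joukowski)
      show "w \<le> r \<and> w \<le> \<bar>\<gamma>\<bar> * (1 + C * t)"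
        if "0 < w" "w < 1" "\<gamma> \<noteq> 0" "joukowski w = joukowski \<bar>\<gamma>\<bar> / (1 + t)" for w
        using dil(6)[OF t(1) t0(1) that] .
      show "2 * sqrt (\<bar>joukowski (\<beta> k)\<bar> - 1 - t) \<le> C1" for k
      proof -
        have "sqrt (y k - t) \<le> sqrt (y k)"
          using t(1) by (intro real_sqrt_le_mono) simp
        then show ?thesis
          using Y[of k] unfolding C1_def yt by linarith
      qed
      show "0 < \<rho> n" "\<rho> n \<le> 1"
        using c' elim by (auto simp: \<rho>_def)
      show "\<rho> n \<le> sqrt (\<bar>joukowski (\<beta> k)\<bar> - 1 - t) / (2 * C1)" if "k \<in> {k. \<bar>joukowski (\<beta> k)\<bar> > 1 + t}" for k
      proof -
        have "real n powr (-3/4) = sqrt (1 / real n powr (3/2))"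
          using elim(6) by (simp add: powr_half_sqrt[symmetric] powr_powr flip: powr_minus_divide)
        then have "\<rho> n = sqrt (c / real n powr (3/2)) / (2 * C1)"
          by (simp add: \<rho>_def c'_def real_sqrt_divide)
        also have "\<dots> \<le> sqrt (y k - t) / (2 * C1)"
          using t(4)[of k] that Keq C1 by (intro divide_right_mono real_sqrt_le_mono) auto
        finally show ?thesis
          by (simp add: yt)
      qed
      fix p :: "complex poly"
      assume "degree p \<le> n" "\<And>x. x \<in> {-1..1} \<Longrightarrow> norm (poly p (of_real x)) \<le> 1"
        "\<And>k. norm (poly p (of_real (joukowski (\<beta> k)))) \<le> 1"
        "norm (poly (disk_poly n p) (of_real \<gamma>)) \<ge> L / 2 - exp (- \<rho> n * real n / 4) / \<rho> n - r ^ n / 2 - C * (real n * t) / 2"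
      then show thesis
        by (rule that)
    qed
    have "C * (real n * t) \<le> C * \<sigma>"
      using t(2) dil(1) by (intro mult_left_mono) auto
    also have "C * \<sigma> = \<epsilon> / 2"
      using dil(1) by (simp add: \<sigma>_def)
    finally have "L / 2 - \<epsilon> \<le> L / 2 - exp (- \<rho> n * real n / 4) / \<rho> n - r ^ n / 2 - C * (real n * t) / 2"
      using elim(2,4) \<epsilon> by linarith
    then show ?case
      using p by (intro exI[of _ p]) auto
  qed
qed

subsection \<open>The conformal map\<close>

text \<open>
  In terms of \<open>q = csqrt ((z - a) / (z - b))\<close> the map is \<open>(q - 1) / (q + 1)\<close>,
  so it takes values in the unit disk because \<open>Re q > 0\<close>.
\<close>

lemma B_map_Some:
  assumes ab: "a < b" and z: "z \<notin> complex_of_real ` {a..b}"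
  shows "norm (B_map a b (Some z)) < 1" "B_map a b (Some z) \<noteq> 0"
    "z = of_real ((a + b) / 2) + of_real ((b - a) / 2) * joukowski (B_map a b (Some z))"
proof -
  define D where "D = z - of_real b"
  define q where "q = csqrt ((z - of_real a) / (z - of_real b))"
  define w where "w = B_map a b (Some z)"
  have D: "D \<noteq> 0"
    using z ab by (auto simp: D_def)
  have q2: "q\<^sup>2 * D = z - of_real a"
    using D by (simp add: q_def D_def)
  have ba: "of_real (b - a) = (q\<^sup>2 - 1) * D"
    using q2 by (simp add: algebra_simps D_def)
  have q1: "q\<^sup>2 \<noteq> 1"
    using ba ab by auto
  \<comment> \<open>A purely imaginary \<open>q\<close> would make \<open>(z - a) / (z - b)\<close>
    a nonpositive real, so that \<open>z\<close> would be a convex combination of \<open>a\<close>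
    and \<open>b\<close>.\<close>
  have "Re q \<noteq> 0"
  proof
    assume "Re q = 0"
    then have "q\<^sup>2 = of_real (- (Im q)\<^sup>2)"
      by (simp add: complex_eq_iff power2_eq_square)
    with q2 have "z - of_real a = of_real (- (Im q)\<^sup>2) * (z - of_real b)"
      by (simp add: D_def)
    then have eq: "z * of_real (1 + (Im q)\<^sup>2) = of_real (a + (Im q)\<^sup>2 * b)"
      by (simp add: algebra_simps)
    have pos: "1 + (Im q)\<^sup>2 > 0"
      by (simp add: add_pos_nonneg)
    then have "z = of_real ((a + (Im q)\<^sup>2 * b) / (1 + (Im q)\<^sup>2))"
      using eq by (metis less_irrefl nonzero_mult_div_cancel_right of_real_divide of_real_eq_0_iff)
    moreover have "(a + (Im q)\<^sup>2 * b) / (1 + (Im q)\<^sup>2) \<in> {a..b}"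
    proof -
      have "a * (1 + (Im q)\<^sup>2) \<le> a + (Im q)\<^sup>2 * b" "a + (Im q)\<^sup>2 * b \<le> b * (1 + (Im q)\<^sup>2)"
        using ab mult_left_mono[of a b "(Im q)\<^sup>2"] by (auto simp: algebra_simps)
      then show ?thesis
        using pos by (simp add: pos_le_divide_eq pos_divide_le_eq)
    qed
    ultimately show False
      using z by blast
  qed
  moreover have "Re q \<ge> 0"
    unfolding q_def by (rule Re_csqrt)
  ultimately have Req: "Re q > 0"
    by simp
  then have qm: "q + 1 \<noteq> 0"
    by (auto simp: complex_eq_iff)
  have qp: "q - 1 \<noteq> 0"
    using q1 by auto
  have zc: "z - of_real ((a + b) / 2) = (q\<^sup>2 + 1) * D / 2"
  proof -
    have "(q\<^sup>2 + 1) * D = (z - of_real a) + (z - of_real b)"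
      unfolding distrib_right q2 by (simp add: D_def)
    moreover have "z - of_real ((a + b) / 2) = ((z - of_real a) + (z - of_real b)) / 2"
      by (simp add: field_simps)
    ultimately show ?thesis
      by simp
  qed
  have w: "w = (q - 1) / (q + 1)"
  proof -
    have "w = (z - of_real ((a + b) / 2) - D * q) / of_real ((b - a) / 2)"
      by (simp only: w_def B_map_def sqrt_branch_def option.case q_def D_def)
    also have "\<dots> = ((q\<^sup>2 + 1) * D / 2 - D * q) / ((q\<^sup>2 - 1) * D / 2)"
      unfolding zc using ba by simp
    also have "\<dots> = ((q - 1) * (q - 1) * (D / 2)) / ((q - 1) * (q + 1) * (D / 2))"
      by (simp add: power2_eq_square algebra_simps add_divide_distrib diff_divide_distrib)
    also have "\<dots> = (q - 1) / (q + 1)"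
      using D qp by simp
    finally show ?thesis .
  qed
  have "(norm (q - 1))\<^sup>2 < (norm (q + 1))\<^sup>2"
    using Req by (simp only: cmod_power2) (simp add: power2_eq_square algebra_simps)
  then have "norm (q - 1) < norm (q + 1)"
    by (rule power_less_imp_less_base) simp
  then show "norm (B_map a b (Some z)) < 1"
    using qm unfolding w_def[symmetric] w by (simp add: norm_divide)
  show "B_map a b (Some z) \<noteq> 0"
    using qm qp unfolding w_def[symmetric] w by simp
  have J: "joukowski w = (q\<^sup>2 + 1) / (q\<^sup>2 - 1)"
  proof -
    have "joukowski w = ((q - 1) * (q - 1) + (q + 1) * (q + 1)) / (2 * ((q - 1) * (q + 1)))"
      unfolding w using qm qp by (rule joukowski_divide[rotated])
    also have "\<dots> = (2 * (q\<^sup>2 + 1)) / (2 * (q\<^sup>2 - 1))"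
      by (simp add: power2_eq_square algebra_simps)
    also have "\<dots> = (q\<^sup>2 + 1) / (q\<^sup>2 - 1)"
      by (rule mult_divide_mult_cancel_left) simp
    finally show ?thesis .
  qed
  have h: "complex_of_real ((b - a) / 2) = (q\<^sup>2 - 1) * D / 2"
    using ba by simp
  have "of_real ((b - a) / 2) * joukowski w = (q\<^sup>2 + 1) * D / 2"
  proof -
    have "X * D / 2 * (Y / X) = Y * D / 2" if "X \<noteq> 0" for X Y :: complex
      using that by simp
    then show ?thesis
      unfolding h J using q1 by (metis right_minus_eq)
  qed
  then show "z = of_real ((a + b) / 2) + of_real ((b - a) / 2) * joukowski (B_map a b (Some z))"
    using zc unfolding w_def by (metis add_diff_cancel_left' add.commute diff_add_cancel)
qed

lemma B_map_real:
  assumes ab: "a < b" and x: "x \<notin> {a..b}"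
  obtains \<beta> where "B_map a b (Some (of_real x)) = of_real \<beta>" "\<bar>\<beta>\<bar> < 1" "\<beta> \<noteq> 0"
    "x = (a + b) / 2 + (b - a) / 2 * joukowski \<beta>"
proof -
  have z: "complex_of_real x \<notin> complex_of_real ` {a..b}"
    using x by auto
  have "(x - a) / (x - b) \<ge> 0"
    using x ab by (auto simp: zero_le_divide_iff)
  then have q: "csqrt (of_real ((x - a) / (x - b))) = of_real (sqrt ((x - a) / (x - b)))"
    by (simp add: csqrt_of_real_nonneg)
  define \<beta> where "\<beta> = (x - (a + b) / 2 - (x - b) * sqrt ((x - a) / (x - b))) / ((b - a) / 2)"
  have e: "B_map a b (Some (of_real x)) = of_real \<beta>"
    using q by (simp add: B_map_def sqrt_branch_def \<beta>_def)
  note B = B_map_Some[OF ab z, unfolded e]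
  show ?thesis
  proof
    show "B_map a b (Some (of_real x)) = of_real \<beta>" "\<bar>\<beta>\<bar> < 1" "\<beta> \<noteq> 0"
      using e B by auto
    have "complex_of_real x = of_real ((a + b) / 2 + (b - a) / 2 * joukowski \<beta>)"
      using B(3) by (simp add: of_real_joukowski)
    then show "x = (a + b) / 2 + (b - a) / 2 * joukowski \<beta>"
      by (simp only: of_real_eq_iff)
  qed
qed

text \<open>Multiplying the Joukowski relation by \<open>w\<close> gives
  \<open>(b - a) / 2 * (w\<^sup>2 + 1) / 2\<close> with \<open>norm w < 1\<close>. The explicit
  decay gives the limit at infinity and the boundedness needed for neighbourhoods of
  infinity.\<close>

lemma norm_B_map_le:
  assumes ab: "a < b" and z: "z \<notin> complex_of_real ` {a..b}"
  shows "norm (B_map a b (Some z)) * norm (z - of_real ((a + b) / 2)) \<le> (b - a) / 2"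
proof -
  let ?w = "B_map a b (Some z)"
  note B = B_map_Some[OF ab z]
  have "?w * (z - of_real ((a + b) / 2)) = of_real ((b - a) / 2) * (?w * joukowski ?w)"
    using B(3) by (metis add_diff_cancel_left' mult.left_commute)
  also have "?w * joukowski ?w = (?w\<^sup>2 + 1) / 2"
    using B(2) by (simp add: joukowski_def field_simps power2_eq_square)
  finally have "norm (?w * (z - of_real ((a + b) / 2))) = (b - a) / 2 * norm ((?w\<^sup>2 + 1) / 2)"
    using ab by (simp only: norm_mult norm_of_real) simp
  also have "\<dots> \<le> (b - a) / 2 * 1"
  proof (rule mult_left_mono)
    have "norm (?w\<^sup>2 + 1) \<le> norm ?w ^ 2 + 1"
      using norm_triangle_ineq[of "?w\<^sup>2" 1] by (simp add: norm_power)
    also have "norm ?w ^ 2 \<le> 1"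
      using B(1) by (intro power_le_one) auto
    finally show "norm ((?w\<^sup>2 + 1) / 2) \<le> 1"
      by (simp add: norm_divide)
  qed (use ab in simp)
  finally show ?thesis
    by (simp add: norm_mult)
qed

section \<open>Compact subsets of \<open>Omega\<close> and compactness of \<open>E\<close>\<close>

lemma compact_interval_image: "compact (complex_of_real ` {a..b})"
  by (intro compact_continuous_image continuous_intros) simp

lemma B_map_tendsto_0:
  assumes "a < b"
  shows "((\<lambda>z. B_map a b (Some z)) \<longlongrightarrow> 0) at_infinity"
    and "\<forall>\<^sub>F z in at_infinity. z \<notin> complex_of_real ` {a..b}"
proof -
  obtain M where M: "\<And>z. z \<in> complex_of_real ` {a..b} \<Longrightarrow> norm z \<le> M"
    using compact_imp_bounded[OF compact_interval_image[of a b]] unfolding bounded_iff by blast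
  show ev: "\<forall>\<^sub>F z in at_infinity. z \<notin> complex_of_real ` {a..b}"
    unfolding eventually_at_infinity using M by (intro exI[of _ "M + 1"]) force
  let ?c = "complex_of_real ((a + b) / 2)"
  have lim: "((\<lambda>z. (b - a) / 2 * norm (1 / (z - ?c))) \<longlongrightarrow> (b - a) / 2 * norm (0 :: complex)) at_infinity"
  proof (intro tendsto_intros tendsto_divide_0[OF tendsto_const])
    show "filterlim (\<lambda>z. z - ?c) at_infinity at_infinity"
      using tendsto_add_filterlim_at_infinity[OF tendsto_const filterlim_ident, of "- ?c"] by simp
  qed
  show "((\<lambda>z. B_map a b (Some z)) \<longlongrightarrow> 0) at_infinity"
  proof (rule Lim_null_comparison)
    show "((\<lambda>z. (b - a) / 2 * norm (1 / (z - ?c))) \<longlongrightarrow> 0) at_infinity"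
      using lim by simp
    show "\<forall>\<^sub>F z in at_infinity. norm (B_map a b (Some z)) \<le> (b - a) / 2 * norm (1 / (z - ?c))"
      using ev eventually_not_equal_at_infinity[of ?c]
    proof eventually_elim
      case (elim z)
      then show ?case
        using norm_B_map_le[OF assms elim(1)] by (simp add: norm_divide pos_le_divide_eq)
    qed
  qed
qed

lemma continuous_on_B_map:
  assumes "a < b"
  shows "continuous_on (- (complex_of_real ` {a..b})) (\<lambda>z. B_map a b (Some z))"
  unfolding B_map_def option.case using assms
  by (intro continuous_intros holomorphic_on_imp_continuous_on[OF sqrt_branch_holomorphic]) auto

text \<open>The sets where the norm of \<open>B_map\<close> is below some \<open>r < 1\<close> form
  an increasing open cover of \<open>Omega\<close>; a finite subcover of \<open>K\<close> yields a
  common radius.\<close>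

lemma compactin_Omega_bound:
  assumes ab: "a < b" and K: "compactin riemann_sphere K" "K \<subseteq> Omega a b"
  obtains r where "r < 1" "\<And>w. w \<in> K \<Longrightarrow> norm (B_map a b w) \<le> r"
proof -
  let ?S = "complex_of_real ` {a..b}"
  define U where "U = (\<lambda>r. {w\<in>Omega a b. norm (B_map a b w) < r})"
  have open_U: "openin riemann_sphere (U r)" if r: "0 < r" for r
  proof -
    \<comment> \<open>The complement of \<open>U r\<close> in the plane. It has to be compact,
      because \<open>U r\<close> contains infinity.\<close>
    define C where "C = - (- ?S \<inter> (\<lambda>z. norm (B_map a b (Some z))) -` {..<r})"
    have "open (- ?S \<inter> (\<lambda>z. norm (B_map a b (Some z))) -` {..<r})"
      by (intro continuous_open_preimage continuous_intros continuous_on_B_map ab)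
        (auto intro: open_Compl compact_imp_closed compact_interval_image)
    then have "closed C"
      unfolding C_def by (rule closed_Compl)
    moreover have "bounded C"
    proof (rule bounded_subset)
      show "bounded (?S \<union> cball (of_real ((a + b) / 2)) ((b - a) / 2 / r))"
        using compact_imp_bounded[OF compact_interval_image] by simp
      show "C \<subseteq> ?S \<union> cball (of_real ((a + b) / 2)) ((b - a) / 2 / r)"
      proof
        fix z assume z: "z \<in> C"
        show "z \<in> ?S \<union> cball (of_real ((a + b) / 2)) ((b - a) / 2 / r)"
        proof (cases "z \<in> ?S")
          case False
          then have "r \<le> norm (B_map a b (Some z))"
            using z by (auto simp: C_def)
          then have "r * norm (z - of_real ((a + b) / 2)) \<le> (b - a) / 2"
            using norm_B_map_le[OF ab False] by (meson mult_right_mono norm_ge_zero order_trans)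
          then have "norm (z - of_real ((a + b) / 2)) \<le> (b - a) / 2 / r"
            using r by (simp add: pos_le_divide_eq mult.commute)
          then show ?thesis
            by (simp add: dist_norm norm_minus_commute)
        qed simp
      qed
    qed
    ultimately have "compact C"
      by (simp add: compact_eq_bounded_closed)
    moreover have "U r = insert None (Some ` (topspace euclidean - C))"
    proof (rule set_eqI)
      fix w
      show "w \<in> U r \<longleftrightarrow> w \<in> insert None (Some ` (topspace euclidean - C))"
        using r by (cases w) (auto simp: U_def Omega_def C_def B_map_def[of _ _ None])
    qed
    ultimately show ?thesis
      unfolding openin_Alexandroff_compactification using \<open>closed C\<close>
      by (intro disjI2 exI[of _ C]) auto
  qed
  have "K \<subseteq> \<Union> (U ` {0<..<1})"
  proof
    fix w assume w: "w \<in> K"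
    have "norm (B_map a b w) < 1"
    proof (cases w)
      case (Some z)
      then have "z \<notin> ?S"
        using w K(2) unfolding Omega_def by blast
      then show ?thesis
        using B_map_Some(1)[OF ab] Some by simp
    qed (simp add: B_map_def)
    then obtain r where "norm (B_map a b w) < r" "r < 1"
      using dense by blast
    moreover have "0 < r"
      using \<open>norm (B_map a b w) < r\<close> by (rule le_less_trans[OF norm_ge_zero])
    ultimately show "w \<in> \<Union> (U ` {0<..<1})"
      using w K(2) by (auto simp: U_def intro!: bexI[of _ r])
  qed
  then have "\<exists>\<F>. finite \<F> \<and> \<F> \<subseteq> U ` {0<..<1} \<and> K \<subseteq> \<Union> \<F>"
    by (intro compactinD[OF K(1)]) (auto intro: open_U)
  then obtain \<F> where F: "finite \<F>" "\<F> \<subseteq> U ` {0<..<1}" "K \<subseteq> \<Union> \<F>"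
    by blast
  obtain R where R: "R \<subseteq> {0<..<1}" "finite R" "\<F> = U ` R"
    using finite_subset_image[OF F(1,2)] by auto
  show ?thesis
  proof
    show "Max (insert 0 R) < 1"
      using R by auto
    fix w assume "w \<in> K"
    then obtain r where "r \<in> R" "norm (B_map a b w) < r"
      using F(3) R(3) by (auto simp: U_def)
    then show "norm (B_map a b w) \<le> Max (insert 0 R)"
      using R(2) by (meson Max_ge finite.insertI insertI2 less_imp_le order_trans)
  qed
qed

lemma infdist_interval_ge:
  fixes a b t :: real
  assumes "a < b"
  shows "\<bar>t - (a + b) / 2\<bar> - (b - a) / 2 \<le> infdist t {a..b}"
proof -
  have "\<bar>t - (a + b) / 2\<bar> - (b - a) / 2 \<le> dist t s" if "s \<in> {a..b}" for s
  proof -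
    have "\<bar>s - (a + b) / 2\<bar> \<le> (b - a) / 2"
      using that by (auto simp: abs_le_iff field_simps)
    then show ?thesis
      unfolding dist_real_def by linarith
  qed
  then show ?thesis
    unfolding infdist_def using assms by (auto intro!: cINF_greatest)
qed

text \<open>Each closed neighbourhood of the interval misses only finitely many points, so adding
  these keeps it closed; the intersection over all widths is the set itself.\<close>

lemma compact_interval_Un_range:
  fixes a b :: real and x :: "nat \<Rightarrow> real"
  assumes ab: "a < b" and lim: "(\<lambda>k. infdist (x k) {a..b}) \<longlonglongrightarrow> 0"
  shows "compact ({a..b} \<union> range x)"
proof -
  have "{a..b} \<union> range x = (\<Inter>e\<in>{0<..}. {t. infdist t {a..b} \<le> e} \<union> x ` {k. \<not> infdist (x k) {a..b} < e})"
    (is "?E = ?F")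
  proof
    show "?E \<subseteq> ?F"
    proof (intro subsetI INT_I)
      fix t e :: real assume t: "t \<in> ?E" and e: "e \<in> {0<..}"
      then show "t \<in> {t. infdist t {a..b} \<le> e} \<union> x ` {k. \<not> infdist (x k) {a..b} < e}"
      proof (cases "infdist t {a..b} \<le> e")
        case False
        then have "t \<notin> {a..b}"
          using e infdist_zero[of t "{a..b}"] by fastforce
        then obtain k where "t = x k"
          using t by blast
        then show ?thesis
          using False by simp
      qed simp
    qed
    show "?F \<subseteq> ?E"
    proof
      fix t assume t: "t \<in> ?F"
      show "t \<in> ?E"
      proof (cases "t \<in> range x")
        case False
        have le: "infdist t {a..b} \<le> e" if "e > 0" for e
        proof -
          have "t \<in> {t. infdist t {a..b} \<le> e} \<union> x ` {k. \<not> infdist (x k) {a..b} < e}"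
            using t that by blast
          then show ?thesis
            using False by blast
        qed
        have "infdist t {a..b} \<le> 0"
          by (rule field_le_epsilon) (use le in simp)
        then have "infdist t {a..b} = 0"
          using infdist_nonneg[of t "{a..b}"] by linarith
        then have "t \<in> {a..b}"
          using ab by (subst in_closed_iff_infdist_zero) simp_all
        then show ?thesis ..
      qed auto
    qed
  qed
  moreover have "closed ?F"
  proof (intro closed_INT ballI closed_Un)
    fix e :: real assume e: "e \<in> {0<..}"
    show "closed {t. infdist t {a..b} \<le> e}"
      by (intro closed_Collect_le continuous_on_infdist continuous_on_id continuous_on_const)
    have "\<forall>\<^sub>F k in cofinite. infdist (x k) {a..b} < e"
      using order_tendstoD(2)[OF lim, of e] e unfolding cofinite_eq_sequentially by simp
    then show "closed (x ` {k. \<not> infdist (x k) {a..b} < e})"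
      by (intro finite_imp_closed finite_imageI) (simp add: eventually_cofinite)
  qed
  moreover have "bounded ?E"
  proof -
    have "Bseq (\<lambda>k. infdist (x k) {a..b})"
      by (rule convergent_imp_Bseq[OF convergentI[OF lim]])
    then obtain M where M: "\<And>k. norm (infdist (x k) {a..b}) \<le> M"
      unfolding Bseq_def by blast
    have "dist ((a + b) / 2) (x k) \<le> M + (b - a) / 2" for k
    proof -
      have "\<bar>x k - (a + b) / 2\<bar> \<le> infdist (x k) {a..b} + (b - a) / 2"
        using infdist_interval_ge[OF ab, of "x k"] by linarith
      also have "infdist (x k) {a..b} \<le> M"
        using M[of k] by (rule order_trans[rotated]) simp
      finally show ?thesis
        by (simp only: dist_real_def abs_minus_commute)
    qed
    then have "range x \<subseteq> cball ((a + b) / 2) (M + (b - a) / 2)"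
      unfolding cball_def by blast
    then have "bounded (range x)"
      by (rule bounded_subset[OF bounded_cball])
    then show ?thesis
      by simp
  qed
  ultimately show ?thesis
    by (simp add: compact_eq_bounded_closed)
qed

subsection \<open>Asymptotics of the extremal polynomials\<close>

text \<open>If convergence failed, infinitely many indices would violate one fixed error bound.
  Montel's theorem extracts from them a locally uniform limit, which \<open>unique\<close>
  identifies with \<open>G\<close>.\<close>

lemma uniform_limit_if_unique_subsequential_limit:
  fixes F :: "nat \<Rightarrow> complex \<Rightarrow> complex"
  assumes hol: "\<And>n. F n holomorphic_on ball 0 1"
    and bound: "\<And>n w. norm w < 1 \<Longrightarrow> norm (F n w) \<le> 1"
    and unique: "\<And>s g. strict_mono s \<Longrightarrow> g holomorphic_on ball 0 1 \<Longrightarrow>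
      (\<And>w. norm w < 1 \<Longrightarrow> (\<lambda>n. F (s n) w) \<longlonglongrightarrow> g w) \<Longrightarrow> (\<And>w. norm w < 1 \<Longrightarrow> g w = G w)"
    and r: "r < 1"
  shows "uniform_limit (cball 0 r) F G sequentially"
proof (rule ccontr)
  assume "\<not> ?thesis"
  then obtain e where e: "e > 0" "\<not> (\<forall>\<^sub>F n in sequentially. \<forall>w\<in>cball 0 r. dist (F n w) (G w) < e)"
    by (auto simp: uniform_limit_iff)
  let ?N = "{n. \<exists>w\<in>cball 0 r. \<not> dist (F n w) (G w) < e}"
  have "infinite ?N"
    using e(2) unfolding cofinite_eq_sequentially[symmetric] eventually_cofinite by simp
  from infinite_enumerate[OF this] obtain s where s: "strict_mono (s :: nat \<Rightarrow> nat)" "\<forall>n. s n \<in> ?N"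
    by (elim exE conjE)
  define \<H> where "\<H> = {h. h holomorphic_on ball 0 1 \<and> (\<forall>w. norm w < 1 \<longrightarrow> norm (h w :: complex) \<le> 1)}"
  obtain g t where g: "g holomorphic_on ball 0 1" "strict_mono (t :: nat \<Rightarrow> nat)"
    "\<And>w. w \<in> ball 0 1 \<Longrightarrow> ((\<lambda>n. (F \<circ> s) (t n) w) \<longlonglongrightarrow> g w)"
    "\<And>K. compact K \<Longrightarrow> K \<subseteq> ball 0 1 \<Longrightarrow> uniform_limit K ((F \<circ> s) \<circ> t) g sequentially"
  proof (rule Montel[of "ball 0 1" \<H> "F \<circ> s"])
    show "\<exists>B. \<forall>h\<in>\<H>. \<forall>z\<in>K. norm (h z) \<le> B" if "compact K" "K \<subseteq> ball 0 1" for K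
      using that by (intro exI[of _ 1]) (auto simp: \<H>_def)
    show "range (F \<circ> s) \<subseteq> \<H>"
      using hol bound by (auto simp: \<H>_def)
    show "h holomorphic_on ball 0 1" if "h \<in> \<H>" for h
      using that by (simp add: \<H>_def)
    fix g t
    assume "g holomorphic_on ball 0 1" "strict_mono (t :: nat \<Rightarrow> nat)"
      "\<And>w. w \<in> ball 0 1 \<Longrightarrow> ((\<lambda>n. (F \<circ> s) (t n) w) \<longlonglongrightarrow> g w)"
      "\<And>K. compact K \<Longrightarrow> K \<subseteq> ball 0 1 \<Longrightarrow> uniform_limit K ((F \<circ> s) \<circ> t) g sequentially"
    then show thesis
      by (rule that)
  qed simp
  have gG: "g w = G w" if "norm w < 1" for w
    using unique[of "s \<circ> t" g w] strict_mono_o[OF s(1) g(2)] g(1,3) that by (simp add: o_def)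
  have "uniform_limit (cball 0 r) ((F \<circ> s) \<circ> t) g sequentially"
    using r by (intro g(4)) auto
  then have "\<forall>\<^sub>F n in sequentially. \<forall>w\<in>cball 0 r. dist (F (s (t n)) w) (g w) < e"
    using e(1) by (auto simp: uniform_limit_iff)
  then obtain n where n: "\<forall>w\<in>cball 0 r. dist (F (s (t n)) w) (g w) < e"
    using eventually_happens'[OF sequentially_bot] by blast
  have "s (t n) \<in> ?N"
    using s(2) by (rule spec)
  then obtain w where w: "w \<in> cball 0 r" "\<not> dist (F (s (t n)) w) (G w) < e"
    unfolding mem_Collect_eq by (elim bexE)
  have "g w = G w"
    using w(1) r by (intro gG) simp
  then show False
    using bspec[OF n w(1)] w(2) by simp
qed

section \<open>Transfer of the extremal problem to the disk\<close>

lemma degree_pcompose_affine: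
  fixes p :: "'a::idom poly"
  shows "degree (pcompose p [:c, h:]) \<le> degree p"
  using degree_pcompose_le[of p "[:c, h:]"] by (auto split: if_splits)

lemma coeff_pcompose_affine:
  fixes p :: "'a::idom poly"
  assumes "degree p \<le> n" "h \<noteq> 0"
  shows "coeff (pcompose p [:c, h:]) n = coeff p n * h ^ n"
proof (cases "degree p = n")
  case True
  have "lead_coeff (pcompose p [:c, h:]) = lead_coeff p * lead_coeff [:c, h:] ^ degree p"
    using assms by (intro lead_coeff_comp) simp
  then show ?thesis
    using True assms by (simp add: degree_pcompose)
next
  case False
  then have "coeff p n = 0" "coeff (pcompose p [:c, h:]) n = 0"
    using assms degree_pcompose_affine[of p c h] by (auto intro!: coeff_eq_0)
  then show ?thesis
    by simp
qed

lemma poly_pcompose_affine: "poly (pcompose p [:c, h:]) z = poly p (c + h * z)"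
  by (simp add: poly_pcompose mult.commute)

text \<open>Carries everything in disk coordinates: \<open>\<beta> k\<close> belongs to
  \<open>x k\<close> and \<open>\<gamma>\<close> to the normalization point, with
  \<open>\<gamma> = 0\<close> for infinity. This lets both extremal problems share one
  argument.\<close>

locale interval_with_points =
  fixes a b :: real and x :: "nat \<Rightarrow> real" and E :: "real set" and xs :: "real option" and \<beta> :: "nat \<Rightarrow> real" and \<gamma> :: real
  assumes ab: "a < b" and E_def: "E = {a..b} \<union> range x"
    and inj_x: "inj x" and compact_E: "compact E"
    and xs: "xs \<notin> Some ` E"
    and B_x: "\<And>k. B_map a b (Some (of_real (x k))) = of_real (\<beta> k)"
    and \<beta>: "\<And>k. \<bar>\<beta> k\<bar> < 1" "\<And>k. \<beta> k \<noteq> 0"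
    and x_eq: "\<And>k. x k = (a + b) / 2 + (b - a) / 2 * joukowski (\<beta> k)"
    and sm: "summable (\<lambda>k. sqrt (\<bar>joukowski (\<beta> k)\<bar> - 1))"
    and B_xs: "B_map a b (map_option of_real xs) = of_real \<gamma>"
    and \<gamma>: "\<bar>\<gamma>\<bar> < 1" "xs = None \<longleftrightarrow> \<gamma> = 0"
    and xs_eq: "\<And>y. xs = Some y \<Longrightarrow> y = (a + b) / 2 + (b - a) / 2 * joukowski \<gamma>"
begin

definition "c = (a + b) / 2"
definition "h = (b - a) / 2"

lemma h_pos: "h > 0"
  using ab by (simp add: h_def)

sublocale blaschke_sequence \<beta>
proof
  show "summable (\<lambda>k. 1 - \<bar>\<beta> k\<bar>)"
  proof (rule summable_comparison_test'[OF summable_mult[OF sm, of "sqrt 2"], of 0])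
    show "norm (1 - \<bar>\<beta> k\<bar>) \<le> sqrt 2 * sqrt (\<bar>joukowski (\<beta> k)\<bar> - 1)" for k
      using abs_joukowski_preimage_le(1)[OF \<beta>] \<beta>(1)[of k] by simp
  qed
qed (use \<beta> in auto)

lemma inj_\<beta>: "inj \<beta>"
proof (rule injI)
  fix i j assume "\<beta> i = \<beta> j"
  then have "x i = x j"
    by (simp add: x_eq)
  then show "i = j"
    using inj_x by (simp add: inj_eq)
qed

lemma A_\<gamma>: "A (of_real \<gamma>) \<noteq> 0"
proof
  assume "A (of_real \<gamma>) = 0"
  then obtain k where k: "\<gamma> = \<beta> k"
    using A_eq_0_iff[of "of_real \<gamma>"] \<gamma> by auto
  then obtain y where y: "xs = Some y"
    using \<beta>(2)[of k] \<gamma>(2) by auto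
  then have "y = x k"
    using xs_eq[OF y] k x_eq[of k] by simp
  then show False
    using xs y by (auto simp: E_def)
qed

lemma infinite_E: "infinite E"
  using infinite_Icc[OF ab] by (auto simp: E_def)

lemma E_nonempty: "E \<noteq> {}"
  using infinite_E by auto

definition T :: "nat \<Rightarrow> complex poly"
  where "T n = extremal_poly E n xs"

definition N :: "nat \<Rightarrow> real"
  where "N n = sup_norm_on E (T n)"

definition P :: "nat \<Rightarrow> complex poly"
  where "P n = smult (of_real (1 / N n)) (pcompose (T n) [:of_real c, of_real h:])"

text \<open>The unimodular constant that normalizes \<open>B_map\<close> at the chosen point; it is
  a sign because \<open>\<gamma>\<close> is real.\<close>

definition \<epsilon> :: real
  where "\<epsilon> = (case xs of None \<Rightarrow> 1 | Some y \<Rightarrow> sgn \<gamma>)"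

definition H :: "nat \<Rightarrow> complex \<Rightarrow> complex"
  where "H n w = of_real (\<epsilon> ^ n) * poly (disk_poly n (P n)) w"

text \<open>The numerator of \<open>H n \<gamma>\<close>. At infinity it is a power of
  \<open>(b - a) / 4\<close>, the logarithmic capacity of the interval.\<close>

definition \<mu> :: "nat \<Rightarrow> real"
  where "\<mu> n = (case xs of None \<Rightarrow> (h / 2) ^ n | Some y \<Rightarrow> \<bar>\<gamma>\<bar> ^ n)"

lemma \<epsilon>_cases: "xs = None \<Longrightarrow> \<epsilon> = 1" "xs = Some y \<Longrightarrow> \<epsilon> = sgn \<gamma>"
  unfolding \<epsilon>_def by simp_all

lemma \<mu>_cases: "xs = None \<Longrightarrow> \<mu> n = (h / 2) ^ n" "xs = Some y \<Longrightarrow> \<mu> n = \<bar>\<gamma>\<bar> ^ n"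
  unfolding \<mu>_def by simp_all

lemma \<epsilon>_abs: "\<bar>\<epsilon>\<bar> = 1"
  using \<gamma>(2) by (auto simp: \<epsilon>_def abs_sgn_eq split: option.splits)

lemma T:
  assumes n: "n > 0"
  shows "admissible_poly n xs (T n)" "\<And>Q. admissible_poly n xs Q \<Longrightarrow> N n \<le> sup_norm_on E Q"
    "\<And>t. poly (T n) (of_real t) \<in> \<real>" "degree (T n) \<le> n"
proof -
  note e = extremal_poly[OF compact_E infinite_E n xs]
  show adm: "admissible_poly n xs (T n)"
    unfolding T_def by (rule e(1))
  show "N n \<le> sup_norm_on E Q" if "admissible_poly n xs Q" for Q
    unfolding N_def T_def using e(2)[OF that] .
  show "poly (T n) (of_real t) \<in> \<real>" for t
    unfolding T_def by (rule e(3))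
  show "degree (T n) \<le> n"
    using adm by (auto simp: admissible_poly_def split: option.splits)
qed

lemma norm_T_le: "t \<in> E \<Longrightarrow> norm (poly (T n) (of_real t)) \<le> N n"
  unfolding N_def by (rule norm_poly_le_sup_norm_on[OF compact_E])

lemma N_pos:
  assumes n: "n > 0"
  shows "N n > 0"
proof (rule ccontr)
  assume "\<not> N n > 0"
  then have "poly (T n) (of_real t) = 0" if "t \<in> E" for t
    using norm_T_le[OF that, of n] by (metis norm_ge_zero norm_le_zero_iff not_less order_trans)
  then have "complex_of_real ` E \<subseteq> {z. poly (T n) z = 0}"
    by auto
  moreover have "infinite (complex_of_real ` E)"
    using infinite_E by (simp add: finite_image_iff inj_on_def)
  ultimately have "T n = 0"
    using poly_roots_finite finite_subset by blast
  then show False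
    using T(1)[OF n] n by (auto simp: admissible_poly_def split: option.splits)
qed

lemma poly_P: "poly (P n) z = poly (T n) (of_real c + of_real h * z) / of_real (N n)"
  by (simp add: P_def poly_pcompose_affine)

lemma degree_P:
  assumes "n > 0"
  shows "degree (P n) \<le> n"
  unfolding P_def using T(4)[OF assms]
  by (intro order_trans[OF degree_smult_le] order_trans[OF degree_pcompose_affine])

lemma norm_poly_P_le:
  assumes "n > 0" "c + h * t \<in> E"
  shows "norm (poly (P n) (of_real t)) \<le> 1"
  using norm_T_le[OF assms(2), of n] N_pos[OF assms(1)]
  by (simp add: poly_P norm_divide)

lemma interval_in_E: "t \<in> {-1..1} \<Longrightarrow> c + h * t \<in> E"
proof -
  assume t: "t \<in> {-1..1}"
  then have "h * t \<le> h * 1" "h * (-1) \<le> h * t"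
    using h_pos by (intro mult_left_mono; simp)+
  then show ?thesis
    by (auto simp: E_def c_def h_def field_simps)
qed

lemma points_in_E: "c + h * joukowski (\<beta> k) \<in> E"
proof -
  have "c + h * joukowski (\<beta> k) = x k"
    using x_eq[of k] by (simp add: c_def h_def)
  then show ?thesis
    by (simp add: E_def)
qed

lemma norm_H_le:
  assumes n: "n > 0" and w: "norm w < 1"
  shows "norm (H n w) \<le> (1 + norm w ^ (2 * n)) / 2"
proof -
  have "norm (poly (disk_poly n (P n)) w) \<le> (1 + norm w ^ (2 * n)) / 2"
  proof (rule norm_disk_poly_le[OF degree_P[OF n] n _ _ w])
    fix t :: real assume t: "t \<in> {-1..1}"
    show "poly (P n) (of_real t) \<in> \<real>"
      unfolding poly_P using T(3)[OF n, of "c + h * t"] by simp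
    show "norm (poly (P n) (of_real t)) \<le> 1"
      by (rule norm_poly_P_le[OF n interval_in_E[OF t]])
  qed
  then show ?thesis
    by (simp add: H_def norm_mult norm_power \<epsilon>_abs)
qed

lemma norm_H_\<beta>_le:
  assumes n: "n > 0"
  shows "norm (H n (of_real (\<beta> k))) \<le> \<bar>\<beta> k\<bar> ^ n"
proof -
  have "norm (poly (disk_poly n (P n)) (of_real (\<beta> k))) = \<bar>\<beta> k\<bar> ^ n * norm (poly (P n) (of_real (joukowski (\<beta> k))))"
    using \<beta>(2)[of k] by (simp add: poly_disk_poly[OF degree_P[OF n]] norm_mult norm_power of_real_joukowski)
  also have "\<dots> \<le> \<bar>\<beta> k\<bar> ^ n * 1"
    by (intro mult_left_mono norm_poly_P_le[OF n points_in_E]) auto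
  finally show ?thesis
    by (simp add: H_def norm_mult norm_power \<epsilon>_abs)
qed

text \<open>The value is a positive multiple of \<open>\<mu> n\<close>. Its being real and
  nonnegative later fixes the phase of the limit, and its denominator \<open>N n\<close> turns
  minimal norm into maximal value.\<close>

lemma H_\<gamma>:
  assumes n: "n > 0"
  shows "H n (of_real \<gamma>) = of_real (\<mu> n / N n)"
proof (cases xs)
  case None
  then have "coeff (T n) n = 1"
    using T(1)[OF n] by (auto simp: admissible_poly_def)
  then have "coeff (P n) n = of_real (h ^ n / N n)"
    using T(4)[OF n] h_pos by (simp add: P_def coeff_pcompose_affine)
  moreover have "complex_of_real \<gamma> = 0"
    using None \<gamma>(2) by simp
  ultimately show ?thesis
    unfolding H_def \<epsilon>_cases(1)[OF None] \<mu>_cases(1)[OF None]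
    by (simp add: poly_disk_poly_0 power_divide)
next
  case (Some y)
  then have \<gamma>0: "\<gamma> \<noteq> 0"
    using \<gamma>(2) by simp
  have "poly (T n) (of_real y) = 1"
    using T(1)[OF n] Some by (simp add: admissible_poly_def)
  moreover have "of_real c + of_real h * joukowski (of_real \<gamma>) = complex_of_real y"
  proof -
    have "of_real c + of_real h * joukowski (of_real \<gamma>) = complex_of_real (c + h * joukowski \<gamma>)"
      by (simp add: of_real_joukowski)
    also have "c + h * joukowski \<gamma> = y"
      using xs_eq[OF Some] by (simp add: c_def h_def)
    finally show ?thesis .
  qed
  ultimately have "poly (disk_poly n (P n)) (of_real \<gamma>) = of_real (\<gamma> ^ n / N n)"
    using \<gamma>0 by (simp add: poly_disk_poly[OF degree_P[OF n]] poly_P)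
  moreover have "sgn \<gamma> ^ n * \<gamma> ^ n = \<bar>\<gamma>\<bar> ^ n"
    by (simp add: power_mult_distrib[symmetric] sgn_mult_self_eq abs_sgn mult.commute)
  ultimately show ?thesis
    unfolding H_def \<epsilon>_cases(2)[OF Some] \<mu>_cases(2)[OF Some]
    by (simp flip: of_real_power of_real_mult)
qed

text \<open>Duality: a competitor bounded by 1 on \<open>E\<close>, rescaled to satisfy the
  normalization, is admissible with norm at most the modulus of the scaling factor. Minimality of
  \<open>N n\<close> bounds that factor from below, hence the competitor's value at
  \<open>\<gamma>\<close> from above.\<close>

lemma norm_H_\<gamma>_ge:
  assumes n: "n > 0" and p: "degree p \<le> n" "\<And>t. t \<in> {-1..1} \<Longrightarrow> norm (poly p (of_real t)) \<le> 1"
    "\<And>k. norm (poly p (of_real (joukowski (\<beta> k)))) \<le> 1"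
  shows "norm (poly (disk_poly n p) (of_real \<gamma>)) \<le> norm (H n (of_real \<gamma>))"
proof (cases "poly (disk_poly n p) (of_real \<gamma>) = 0")
  case False
  define Q where "Q = pcompose p [:of_real (- c / h), of_real (1 / h):]"
  have Qp: "poly Q (of_real t) = poly p (of_real ((t - c) / h))" for t
    by (simp add: Q_def poly_pcompose_affine diff_divide_distrib)
  have degQ: "degree Q \<le> n"
    unfolding Q_def using p(1) by (intro order_trans[OF degree_pcompose_affine])
  have "sup_norm_on E Q \<le> 1"
  proof (rule sup_norm_on_le[OF E_nonempty])
    fix t assume "t \<in> E"
    then consider "t \<in> {a..b}" | k where "t = x k"
      by (auto simp: E_def)
    then show "norm (poly Q (of_real t)) \<le> 1"
    proof cases
      case 1
      then have "(t - c) / h \<in> {-1..1}"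
        using h_pos by (auto simp: pos_divide_le_eq pos_le_divide_eq) (auto simp: c_def h_def field_simps)
      then show ?thesis
        unfolding Qp by (rule p(2))
    next
      case 2
      then have "(t - c) / h = joukowski (\<beta> k)"
        using x_eq[of k] h_pos by (simp add: c_def h_def)
      then show ?thesis
        unfolding Qp using p(3)[of k] by simp
    qed
  qed
  then have N_le: "N n \<le> norm s" if "admissible_poly n xs (smult s Q)" for s
    using T(2)[OF n that] sup_norm_on_smult[OF E_nonempty compact_E, of s Q]
      mult_left_mono[of "sup_norm_on E Q" 1 "norm s"] by simp
  show ?thesis
  proof (cases xs)
    case None
    then have \<gamma>0: "\<gamma> = 0"
      using \<gamma>(2) by simp
    then have cp: "coeff p n \<noteq> 0"
      using False by (simp add: poly_disk_poly_0)
    have cQ: "coeff Q n = coeff p n / of_real h ^ n"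
      unfolding Q_def using h_pos by (subst coeff_pcompose_affine[OF p(1)]) (simp_all add: power_one_over)
    define s where "s = of_real h ^ n / coeff p n"
    have "coeff (smult s Q) n = 1"
      using cp cQ h_pos by (simp add: s_def)
    moreover have "degree (smult s Q) \<le> n"
      by (rule order_trans[OF degree_smult_le degQ])
    ultimately have "degree (smult s Q) = n \<and> lead_coeff (smult s Q) = 1"
      by (metis le_antisym le_degree zero_neq_one)
    then have "admissible_poly n xs (smult s Q)"
      unfolding admissible_poly_def None option.case .
    then have "N n \<le> h ^ n / norm (coeff p n)"
      using N_le[of s] h_pos by (simp add: s_def norm_divide norm_power)
    then have "norm (coeff p n) \<le> h ^ n / N n"
      using cp N_pos[OF n] by (simp add: field_simps)
    then have "norm (coeff p n) / 2 ^ n \<le> h ^ n / N n / 2 ^ n"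
      by (rule divide_right_mono) simp
    then show ?thesis
      unfolding H_\<gamma>[OF n] \<mu>_cases(1)[OF None] using \<gamma>0 N_pos[OF n] h_pos
      by (simp add: poly_disk_poly_0 norm_divide norm_mult norm_power power_divide mult.commute)
  next
    case (Some y)
    then have \<gamma>0: "\<gamma> \<noteq> 0"
      using \<gamma>(2) by simp
    define v where "v = poly p (of_real (joukowski \<gamma>))"
    have e: "poly (disk_poly n p) (of_real \<gamma>) = of_real \<gamma> ^ n * v"
      using \<gamma>0 by (simp add: poly_disk_poly[OF p(1)] v_def of_real_joukowski)
    then have v: "v \<noteq> 0"
      using False by auto
    have "(y - c) / h = joukowski \<gamma>"
      using xs_eq[OF Some] h_pos by (simp add: c_def h_def)
    then have "poly Q (of_real y) = v"
      by (simp add: Qp v_def)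
    then have "admissible_poly n xs (smult (1 / v) Q)"
      unfolding admissible_poly_def Some option.case
      using v degQ by simp
    then have "N n \<le> 1 / norm v"
      using N_le[of "1 / v"] by (simp add: norm_divide)
    then have "norm v \<le> 1 / N n"
      using v N_pos[OF n] by (simp add: field_simps)
    then have "\<bar>\<gamma>\<bar> ^ n * norm v \<le> \<bar>\<gamma>\<bar> ^ n * (1 / N n)"
      by (rule mult_left_mono) simp
    then show ?thesis
      unfolding H_\<gamma>[OF n] e \<mu>_cases(2)[OF Some] using N_pos[OF n]
      by (simp add: norm_mult norm_power norm_divide)
  qed
qed simp

lemma H_holomorphic: "H n holomorphic_on S"
  unfolding H_def by (intro holomorphic_intros)

lemma eventually_H_\<gamma>:
  assumes "\<delta> > 0"
  shows "\<forall>\<^sub>F n in sequentially. norm (A (of_real \<gamma>)) / 2 - \<delta> \<le> norm (H n (of_real \<gamma>))"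
proof -
  have "norm (A (of_real \<gamma>)) \<le> (\<Prod>k\<in>I. norm (blaschke (\<beta> k) (of_real \<gamma>)))" if "finite I" for I
    using norm_A_le[of "of_real \<gamma>" I] that \<gamma>(1) by simp
  then have "\<forall>\<^sub>F n in sequentially. \<exists>p. degree p \<le> n \<and> (\<forall>t\<in>{-1..1}. norm (poly p (of_real t)) \<le> 1) \<and>
    (\<forall>k. norm (poly p (of_real (joukowski (\<beta> k)))) \<le> 1) \<and>
    norm (poly (disk_poly n p) (of_real \<gamma>)) \<ge> norm (A (of_real \<gamma>)) / 2 - \<delta>"
    by (intro eventually_exists_competitor \<beta> \<gamma>(1) sm assms)
  then show ?thesis
    using eventually_gt_at_top[of 0]
  proof eventually_elim
    case (elim n)
    then obtain p where p: "degree p \<le> n" "\<forall>t\<in>{-1..1}. norm (poly p (of_real t)) \<le> 1"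
      "\<forall>k. norm (poly p (of_real (joukowski (\<beta> k)))) \<le> 1"
      "norm (poly (disk_poly n p) (of_real \<gamma>)) \<ge> norm (A (of_real \<gamma>)) / 2 - \<delta>"
      by blast
    have "norm (poly (disk_poly n p) (of_real \<gamma>)) \<le> norm (H n (of_real \<gamma>))"
      using p elim(2) by (intro norm_H_\<gamma>_ge) auto
    then show ?case
      using p(4) by linarith
  qed
qed

text \<open>The shift by \<open>Suc\<close> keeps the degree positive, as the estimates for
  \<open>H\<close> require.\<close>

lemma subsequential_limit_H:
  assumes s: "strict_mono s" and g: "g holomorphic_on ball 0 1"
    and lim: "\<And>w. norm w < 1 \<Longrightarrow> (\<lambda>n. H (Suc (s n)) w) \<longlonglongrightarrow> g w" and w: "norm w < 1"
  shows "g w = of_real (norm (A (of_real \<gamma>))) / A (of_real \<gamma>) / 2 * A w"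
proof -
  have sub: "filterlim (\<lambda>n. Suc (s n)) sequentially sequentially"
    using filterlim_compose[OF filterlim_Suc filterlim_subseq[OF s]] .
  have g_le: "norm (g w) \<le> 1 / 2" if "norm w < 1" for w
  proof -
    have "(\<lambda>n. (1 + norm w ^ (2 * Suc (s n))) / 2) \<longlonglongrightarrow> (1 + 0) / 2"
    proof (intro tendsto_intros)
      have "(\<lambda>n. ((norm w)\<^sup>2) ^ n) \<longlonglongrightarrow> 0"
        using that by (intro LIMSEQ_realpow_zero) (auto simp: power_less_one_iff)
      then show "(\<lambda>n. norm w ^ (2 * Suc (s n))) \<longlonglongrightarrow> 0"
        unfolding power_mult using sub by (rule filterlim_compose)
    qed simp
    moreover have "norm (H (Suc (s n)) w) \<le> (1 + norm w ^ (2 * Suc (s n))) / 2" for n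
      by (rule norm_H_le[OF _ that]) simp
    ultimately show ?thesis
      using tendsto_norm[OF lim[OF that]] by (intro LIMSEQ_le[where Y = "\<lambda>n. (1 + norm w ^ (2 * Suc (s n))) / 2"]) auto
  qed
  have g_zero: "g (of_real (\<beta> k)) = 0" for k
  proof -
    have "(\<lambda>n. \<bar>\<beta> k\<bar> ^ Suc (s n)) \<longlonglongrightarrow> 0"
      by (rule filterlim_compose[OF LIMSEQ_realpow_zero sub]) (use \<beta> in auto)
    moreover have "\<forall>\<^sub>F n in sequentially. norm (H (Suc (s n)) (of_real (\<beta> k))) \<le> \<bar>\<beta> k\<bar> ^ Suc (s n)"
      by (intro always_eventually allI norm_H_\<beta>_le) simp
    ultimately have "(\<lambda>n. H (Suc (s n)) (of_real (\<beta> k))) \<longlonglongrightarrow> 0"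
      by (rule Lim_null_comparison[rotated])
    then show ?thesis
      using lim[of "of_real (\<beta> k)"] \<beta>(1)[of k] LIMSEQ_unique by auto
  qed
  have n\<gamma>: "norm (complex_of_real \<gamma>) < 1"
    using \<gamma> by simp
  have g_ge: "norm (A (of_real \<gamma>)) / 2 \<le> norm (g (of_real \<gamma>))"
  proof (rule field_le_epsilon)
    fix \<delta> :: real assume "\<delta> > 0"
    have "\<forall>\<^sub>F n in sequentially. norm (A (of_real \<gamma>)) / 2 - \<delta> \<le> norm (H (Suc (s n)) (of_real \<gamma>))"
      using eventually_compose_filterlim[OF eventually_H_\<gamma>[OF \<open>\<delta> > 0\<close>] sub] .
    then have "norm (A (of_real \<gamma>)) / 2 - \<delta> \<le> norm (g (of_real \<gamma>))"
      using tendsto_norm[OF lim[OF n\<gamma>]] by (intro tendsto_lowerbound[of _ _ sequentially]) auto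
    then show "norm (A (of_real \<gamma>)) / 2 \<le> norm (g (of_real \<gamma>)) + \<delta>"
      by simp
  qed
  have g_le_A: "norm (g (of_real \<gamma>)) \<le> 1 / 2 * norm (A (of_real \<gamma>))"
    using norm_le_norm_A[OF g _ inj_\<beta> g_zero n\<gamma>, of "1/2"] g_le by blast
  \<comment> \<open>All values at \<open>\<gamma>\<close> are nonnegative reals, so the limit there
    equals its own norm. This selects one constant among those of modulus 1/2.\<close>
  have "(\<lambda>n. H (Suc (s n)) (of_real \<gamma>)) \<longlonglongrightarrow> of_real (norm (g (of_real \<gamma>)))"
  proof -
    have "H n (of_real \<gamma>) = of_real (norm (H n (of_real \<gamma>)))" if "n > 0" for n
    proof -
      have "\<mu> n / N n \<ge> 0"
        using N_pos[OF that] h_pos by (auto simp: \<mu>_def split: option.splits)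
      then show ?thesis
        unfolding H_\<gamma>[OF that] norm_of_real by (simp only: abs_of_nonneg)
    qed
    then have "H (Suc (s n)) (of_real \<gamma>) = of_real (norm (H (Suc (s n)) (of_real \<gamma>)))" for n
      by blast
    then show ?thesis
      using tendsto_of_real[OF tendsto_norm[OF lim[OF n\<gamma>]], where 'a = complex] by simp
  qed
  then have "g (of_real \<gamma>) = of_real (norm (g (of_real \<gamma>)))"
    using lim[OF n\<gamma>] LIMSEQ_unique by blast
  moreover have "norm (g (of_real \<gamma>)) = norm (A (of_real \<gamma>)) / 2"
    using g_ge g_le_A by simp
  ultimately have "g (of_real \<gamma>) = of_real (norm (A (of_real \<gamma>)) / 2)"
    by metis
  moreover have "g w = g (of_real \<gamma>) / A (of_real \<gamma>) * A w"
    by (rule eq_multiple_of_A[OF g _ inj_\<beta> g_zero n\<gamma> A_\<gamma> _ w, of "1/2"]) (use g_le g_ge in auto)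
  ultimately have "g w = of_real (norm (A (of_real \<gamma>)) / 2) / A (of_real \<gamma>) * A w"
    by (simp only:)
  then show ?thesis
    by simp
qed

lemma uniform_limit_H:
  assumes "r < 1"
  shows "uniform_limit (cball 0 r) H (\<lambda>w. of_real (norm (A (of_real \<gamma>))) / A (of_real \<gamma>) / 2 * A w) sequentially"
proof -
  have "uniform_limit (cball 0 r) (\<lambda>n. H (Suc n)) (\<lambda>w. of_real (norm (A (of_real \<gamma>))) / A (of_real \<gamma>) / 2 * A w) sequentially"
  proof (rule uniform_limit_if_unique_subsequential_limit[OF _ _ _ assms])
    show "norm (H (Suc n) w) \<le> 1" if "norm w < 1" for n w
    proof -
      have "norm w ^ (2 * Suc n) \<le> 1"
        using that by (intro power_le_one) auto
      then show ?thesis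
        using norm_H_le[of "Suc n" w] that by simp
    qed
  qed (use H_holomorphic subsequential_limit_H in auto)
  then show ?thesis
    unfolding uniform_limit_iff by (subst (asm) eventually_sequentially_Suc)
qed

lemma normalized_B: "normalized_at xs (B_map a b) w = of_real \<epsilon> * B_map a b w"
proof (cases xs)
  case (Some y)
  have "B_map a b (Some (of_real y)) = of_real \<gamma>"
    using B_xs Some by simp
  moreover have "complex_of_real \<bar>\<gamma>\<bar> / of_real \<gamma> = of_real (sgn \<gamma>)"
  proof -
    have "\<bar>\<gamma>\<bar> / \<gamma> = sgn \<gamma>"
      using Some \<gamma>(2) by (simp add: sgn_if)
    then show ?thesis
      by (metis of_real_divide)
  qed
  ultimately show ?thesis
    unfolding \<epsilon>_cases(2)[OF Some] by (simp add: normalized_at_def Some)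
next
  case None
  show ?thesis
    unfolding \<epsilon>_cases(1)[OF None] by (simp add: normalized_at_def None)
qed

lemma A_prod_eq: "A_prod a b x w = A (B_map a b w)"
proof -
  have s: "complex_of_real \<bar>\<beta> k\<bar> / of_real (\<beta> k) = of_real (sgn (\<beta> k))" for k
  proof -
    have "\<bar>\<beta> k\<bar> / \<beta> k = sgn (\<beta> k)"
      using \<beta>(2)[of k] by (simp add: sgn_if)
    then show ?thesis
      by (metis of_real_divide)
  qed
  have m: "(of_real (\<beta> k) - v) / (1 - of_real (\<beta> k) * v) = - blaschke (\<beta> k) v" for k v
    unfolding blaschke_def minus_divide_left by simp
  have "blaschke_factor a b (x k) w = factor k (B_map a b w)" for k
    unfolding blaschke_factor_def Let_def B_x norm_of_real complex_cnj_complex_of_real s m factor_def by simp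
  then show ?thesis
    by (simp add: A_prod_def A_def)
qed

lemma normalized_A: "normalized_at xs (A_prod a b x) w = of_real (norm (A (of_real \<gamma>))) / A (of_real \<gamma>) * A (B_map a b w)"
proof (cases xs)
  case (Some y)
  have "B_map a b (Some (of_real y)) = of_real \<gamma>"
    using B_xs Some by simp
  then show ?thesis
    using Some by (simp add: normalized_at_def A_prod_eq)
next
  case None
  then have \<gamma>0: "\<gamma> = 0"
    using \<gamma>(2) by simp
  \<comment> \<open>At infinity the normalization prescribes no constant. The general formula still
    agrees, because \<open>A 0\<close> is a limit of products of the positive numbers
    \<open>\<bar>\<beta> k\<bar>\<close>.\<close>
  have f0: "factor k 0 = of_real \<bar>\<beta> k\<bar>" for k
    by (simp add: factor_def blaschke_def abs_if sgn_if)
  have "(\<lambda>n. \<Prod>k<n. factor k 0) \<longlonglongrightarrow> A 0"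
    by (rule A_LIMSEQ) simp
  moreover have "(\<lambda>n. of_real (norm (\<Prod>k<n. factor k 0))) \<longlonglongrightarrow> complex_of_real (norm (A 0))"
    by (intro tendsto_intros calculation)
  moreover have "of_real (norm (\<Prod>k<n. factor k 0)) = (\<Prod>k<n. factor k 0)" for n
    by (simp add: f0 prod_norm[symmetric] of_real_prod)
  ultimately have "A 0 = of_real (norm (A 0))"
    using LIMSEQ_unique by simp
  then have "of_real (norm (A 0)) / A 0 = 1"
    using A_\<gamma> \<gamma>0 by simp
  then show ?thesis
    using None \<gamma>0 by (simp add: normalized_at_def A_prod_eq)
qed

text \<open>The normalized polynomial times the power of \<open>B_map\<close> is the polynomial
  \<open>H n\<close> in \<open>B_map\<close>, and \<open>B_map\<close> tends to 0 at infinity, so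
  the limit defining the extension is \<open>H n 0\<close>.\<close>

lemma extend_eq_H:
  assumes n: "n > 0" and w: "w \<in> Omega a b"
  shows "extend_to_infinity (\<lambda>z. poly (T n) z / of_real (N n) * normalized_at xs (B_map a b) (Some z) ^ n) w
    = H n (B_map a b w)"
proof -
  let ?f = "\<lambda>z. poly (T n) z / of_real (N n) * normalized_at xs (B_map a b) (Some z) ^ n"
  have eq: "?f z = H n (B_map a b (Some z))" if "z \<notin> complex_of_real ` {a..b}" for z
  proof -
    note B = B_map_Some[OF ab that, folded c_def h_def]
    have "poly (disk_poly n (P n)) (B_map a b (Some z)) = B_map a b (Some z) ^ n * (poly (T n) z / of_real (N n))"
      by (simp add: poly_disk_poly[OF degree_P[OF n] B(2)] poly_P B(3)[symmetric])
    then show ?thesis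
      by (simp add: H_def normalized_B power_mult_distrib mult_ac)
  qed
  show ?thesis
  proof (cases w)
    case (Some z)
    then have "z \<notin> complex_of_real ` {a..b}"
      using w unfolding Omega_def by blast
    then show ?thesis
      using eq Some by (simp add: extend_to_infinity_def)
  next
    case None
    have "isCont (H n) 0"
      unfolding H_def by (intro continuous_intros)
    then have "((\<lambda>z. H n (B_map a b (Some z))) \<longlongrightarrow> H n 0) at_infinity"
      using B_map_tendsto_0(1)[OF ab] by (rule isCont_tendsto_compose)
    moreover have "\<forall>\<^sub>F z in at_infinity. H n (B_map a b (Some z)) = ?f z"
      using B_map_tendsto_0(2)[OF ab] by eventually_elim (rule eq[symmetric])
    ultimately have "(?f \<longlongrightarrow> H n 0) at_infinity"
      by (rule Lim_transform_eventually)
    then have "Lim at_infinity ?f = H n 0"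
      by (intro tendsto_Lim trivial_limit_at_infinity)
    then show ?thesis
      using None by (simp add: extend_to_infinity_def B_map_def[of _ _ None])
  qed
qed

lemma uniform_limit_extremal:
  assumes K: "compactin riemann_sphere K" "K \<subseteq> Omega a b"
  shows "uniform_limit K
      (\<lambda>n. extend_to_infinity (\<lambda>z.
          poly (extremal_poly E n xs) z / of_real (sup_norm_on E (extremal_poly E n xs))
            * normalized_at xs (B_map a b) (Some z) ^ n))
      (\<lambda>w. 1 / 2 * normalized_at xs (A_prod a b x) w)
      sequentially" (is "uniform_limit K ?F ?G sequentially")
proof -
  obtain r where r: "r < 1" "\<And>w. w \<in> K \<Longrightarrow> norm (B_map a b w) \<le> r"
    using compactin_Omega_bound[OF ab K] by blast
  show ?thesis
    unfolding uniform_limit_iff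
  proof (intro allI impI)
    fix e :: real assume "e > 0"
    then have "\<forall>\<^sub>F n in sequentially. \<forall>w\<in>cball 0 r.
        dist (H n w) (of_real (norm (A (of_real \<gamma>))) / A (of_real \<gamma>) / 2 * A w) < e"
      using uniform_limit_H[OF r(1)] by (simp add: uniform_limit_iff)
    then show "\<forall>\<^sub>F n in sequentially. \<forall>w\<in>K. dist (?F n w) (?G w) < e"
      using eventually_gt_at_top[of 0]
    proof eventually_elim
      case (elim n)
      have "dist (?F n w) (?G w) < e" if w: "w \<in> K" for w
      proof -
        have "dist (H n (B_map a b w)) (of_real (norm (A (of_real \<gamma>))) / A (of_real \<gamma>) / 2 * A (B_map a b w)) < e"
          using elim(1) r(2)[OF w] by simp
        then show ?thesis
          using extend_eq_H[OF elim(2), of w] w K(2) unfolding T_def N_def T_def normalized_A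
          by (auto simp: mult.commute)
      qed
      then show ?case ..
    qed
  qed
qed

end

theorem theorem5p7:
  fixes a b :: real and x :: "nat \<Rightarrow> real" and E :: "real set" and xs :: "real option"
  assumes "a < b"
    and "E = {a..b} \<union> range x"
    and "\<And>k. x k \<notin> {a..b}"
    and "inj x"
    and "summable (\<lambda>k. (infdist (x k) {a..b}) powr (1/2))"
    and "xs \<notin> Some ` E"
  shows "\<forall>K. compactin riemann_sphere K \<and> K \<subseteq> Omega a b \<longrightarrow>
    uniform_limit K
      (\<lambda>n. extend_to_infinity (\<lambda>z.
          poly (extremal_poly E n xs) z / of_real (sup_norm_on E (extremal_poly E n xs))
            * normalized_at xs (B_map a b) (Some z) ^ n))
      (\<lambda>w. 1 / 2 * normalized_at xs (A_prod a b x) w)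
      sequentially"
proof -
  let ?c = "(a + b) / 2" and ?h = "(b - a) / 2"
  have h: "?h > 0"
    using assms(1) by simp
  have sm: "summable (\<lambda>k. sqrt (infdist (x k) {a..b}))"
    using assms(5) by (simp add: powr_half_sqrt infdist_nonneg)
  have "\<exists>\<beta>. B_map a b (Some (of_real (x k))) = of_real \<beta> \<and> \<bar>\<beta>\<bar> < 1 \<and> \<beta> \<noteq> 0 \<and> x k = ?c + ?h * joukowski \<beta>" for k
    using B_map_real[OF assms(1) assms(3)[of k]] by metis
  then obtain \<beta> where \<beta>: "\<And>k. B_map a b (Some (of_real (x k))) = of_real (\<beta> k)" "\<And>k. \<bar>\<beta> k\<bar> < 1" "\<And>k. \<beta> k \<noteq> 0"
    "\<And>k. x k = ?c + ?h * joukowski (\<beta> k)"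
    by metis
  obtain \<gamma> where \<gamma>: "B_map a b (map_option of_real xs) = of_real \<gamma>" "\<bar>\<gamma>\<bar> < 1" "xs = None \<longleftrightarrow> \<gamma> = 0"
    "\<And>y. xs = Some y \<Longrightarrow> y = ?c + ?h * joukowski \<gamma>"
  proof (cases xs)
    case None
    then show ?thesis
      by (intro that[of 0]) (simp_all add: B_map_def)
  next
    case (Some y)
    then have "y \<notin> {a..b}"
      using assms(2,6) by auto
    from B_map_real[OF assms(1) this] obtain \<gamma> where "B_map a b (Some (of_real y)) = of_real \<gamma>" "\<bar>\<gamma>\<bar> < 1" "\<gamma> \<noteq> 0"
      "y = ?c + ?h * joukowski \<gamma>"
      by blast
    then show ?thesis
      using Some by (intro that[of \<gamma>]) auto
  qed
  have "(\<lambda>k. (sqrt (infdist (x k) {a..b}))\<^sup>2) \<longlonglongrightarrow> 0\<^sup>2"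
    by (intro tendsto_power summable_LIMSEQ_zero[OF sm])
  then have compE: "compact E"
    unfolding assms(2) by (intro compact_interval_Un_range assms(1)) (simp add: infdist_nonneg)
  \<comment> \<open>After scaling the half length to 1, the quantity
    \<open>\<bar>joukowski (\<beta> k)\<bar> - 1\<close> is bounded by the distance to the interval,
    so the assumed summability carries over.\<close>
  have smJ: "summable (\<lambda>k. sqrt (\<bar>joukowski (\<beta> k)\<bar> - 1))"
  proof (rule summable_comparison_test'[OF summable_mult[OF sm, of "1 / sqrt ?h"], of 0])
    fix k
    have "\<bar>x k - ?c\<bar> = ?h * \<bar>joukowski (\<beta> k)\<bar>"
      using \<beta>(4)[of k] h by (simp add: abs_mult)
    then have "?h * (\<bar>joukowski (\<beta> k)\<bar> - 1) \<le> infdist (x k) {a..b}"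
      using infdist_interval_ge[OF assms(1), of "x k"] by (simp add: right_diff_distrib)
    then have "\<bar>joukowski (\<beta> k)\<bar> - 1 \<le> infdist (x k) {a..b} / ?h"
      using h by (simp only: pos_le_divide_eq mult.commute)
    then have "sqrt (\<bar>joukowski (\<beta> k)\<bar> - 1) \<le> sqrt (infdist (x k) {a..b}) / sqrt ?h"
      unfolding real_sqrt_divide[symmetric] by (rule real_sqrt_le_mono)
    then show "norm (sqrt (\<bar>joukowski (\<beta> k)\<bar> - 1)) \<le> 1 / sqrt ?h * sqrt (infdist (x k) {a..b})"
      using abs_joukowski_gt_1[OF \<beta>(3,2)[of k]] by simp
  qed
  interpret interval_with_points a b x E xs \<beta> \<gamma>
    by standard (use assms compE \<beta> \<gamma> smJ in auto)
  show ?thesis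
    using uniform_limit_extremal by blast
qed

end
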